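(* Let $G$ be a group of order $2^np$ where $n\geq 1$ is an integer and $p$ is an odd prime. If $G$ is filled, then $G$ is isomorphic to one of $D_6$, $D_{10}$, $D_{12}$, $D_{14}$ or $D_{22}$.
   Context: $D_{2m}$ denotes the dihedral group of order $2m$. Let $G$ be a finite group. For $S\subseteq G$ write $SS=\{ab : a,b\in S\}$ ($a$ and $b$ not necessarily distinct). A non-empty subset $S$ of $G$ is product-free if $S\cap SS=\varnothing$. A product-free set $S$ is locally maximal if whenever $\Sigma$ is product-free in $G$ and $S\subseteq\Sigma$, then $S=\Sigma$. A product-free set $S$ fills $G$ (equivalently, is complete) if $G^{*}\subseteq S\cup SS$, where $G^{*}$ is the set of non-identity elements of $G$. The group $G$ is filled if every locally maximal product-free set in $G$ fills $G$. *)

theory Defs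
  imports "HOL-Algebra.Algebra" "HOL-Computational_Algebra.Primes"
begin

definition product_free :: "('a, 'b) monoid_scheme \<Rightarrow> 'a set \<Rightarrow> bool"
  where "product_free G S \<longleftrightarrow>
    S \<noteq> {} \<and> S \<subseteq> carrier G \<and> S \<inter> (S <#>\<^bsub>G\<^esub> S) = {}"

definition locally_maximal_product_free :: "('a, 'b) monoid_scheme \<Rightarrow> 'a set \<Rightarrow> bool"
  where "locally_maximal_product_free G S \<longleftrightarrow>
    product_free G S \<and> (\<forall>T. product_free G T \<and> S \<subseteq> T \<longrightarrow> S = T)"

definition fills :: "('a, 'b) monoid_scheme \<Rightarrow> 'a set \<Rightarrow> bool"
  where "fills G S \<longleftrightarrow> carrier G - {\<one>\<^bsub>G\<^esub>} \<subseteq> S \<union> (S <#>\<^bsub>G\<^esub> S)"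

definition filled :: "('a, 'b) monoid_scheme \<Rightarrow> bool"
  where "filled G \<longleftrightarrow> (\<forall>S. locally_maximal_product_free G S \<longrightarrow> fills G S)"

text \<open>The argument is \<open>m\<close>, half the order: \<open>dihedral_group m\<close> is the group of order \<open>2 * m\<close>.
  For a rotation \<open>r\<close> of order \<open>m\<close> and a reflection \<open>s\<close>, the pair \<open>(i, a)\<close> stands for
  \<open>r\<^sup>i\<close> if \<open>a\<close> is \<open>False\<close> and for \<open>r\<^sup>i s\<close> if \<open>a\<close> is \<open>True\<close>; the product comes from
  \<open>s r\<^sup>j = r\<^sup>-\<^sup>j s\<close>.\<close>

definition dihedral_group :: "nat \<Rightarrow> (int \<times> bool) monoid"
  where "dihedral_group m =
    \<lparr>carrier = {0..<int m} \<times> UNIV,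
     monoid.mult = (\<lambda>(i, a) (j, b). ((if a then i - j else i + j) mod int m, a \<noteq> b)),
     one = (0, False)\<rparr>"

lemma group_dihedral_group:
  assumes "m \<ge> 1"
  shows "group (dihedral_group m)"
proof (rule groupI)
  fix x y z
  assume "x \<in> carrier (dihedral_group m)" "y \<in> carrier (dihedral_group m)"
    "z \<in> carrier (dihedral_group m)"
  show "x \<otimes>\<^bsub>dihedral_group m\<^esub> y \<otimes>\<^bsub>dihedral_group m\<^esub> z =
    x \<otimes>\<^bsub>dihedral_group m\<^esub> (y \<otimes>\<^bsub>dihedral_group m\<^esub> z)"
    by (cases x; cases y; cases z) (auto simp: dihedral_group_def mod_simps algebra_simps)
next
  fix x
  assume x: "x \<in> carrier (dihedral_group m)"
  obtain i a where xi: "x = (i, a)" by (cases x)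
  show "\<exists>y\<in>carrier (dihedral_group m). y \<otimes>\<^bsub>dihedral_group m\<^esub> x = \<one>\<^bsub>dihedral_group m\<^esub>"
    using assms x xi
    by (intro bexI[of _ "(if a then i else (- i) mod int m, a)"])
      (auto simp: dihedral_group_def mod_simps)
qed (use assms in \<open>auto simp: dihedral_group_def\<close>)

lemma order_dihedral_group: "order (dihedral_group m) = 2 * m"
  by (simp add: order_def dihedral_group_def card_cartesian_product)

end

theory Submission
  imports Defs
begin

text \<open>
  Let \<open>N\<close> be the core of a Sylow 2-subgroup of \<open>G\<close>. Any two distinct Sylow 2-subgroups meet in \<open>N\<close>,
  so counting gives a normal subgroup of order \<open>p\<close> in \<open>G/N\<close>, and this subgroup is its own
  centralizer. As quotients of filled groups are filled, \<open>G/N\<close> acts on it through \<open>\<plusminus>1\<close> only, so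
  \<open>G/N\<close> is cyclic of order \<open>p\<close> or dihedral of order \<open>2p\<close>.

  A group is not filled once a product-free set \<open>S\<close> and an element \<open>w \<noteq> 1\<close> are found such that no
  product-free \<open>T \<supseteq> S\<close> contains \<open>w\<close> or has \<open>w\<close> as a product. Intervals of exponents serve for cyclic
  groups of order at least 7 and for dihedral groups of order \<open>2p\<close>, \<open>p \<ge> 13\<close>. If \<open>N \<noteq> 1\<close>, one takes the
  preimage in \<open>G\<close> of a subset of \<open>G/N\<close> and changes it at a few points. For \<open>p = 3\<close> this needs a
  reflection of order 2 and \<open>|N| \<ge> 3\<close>; what remains is \<open>|N| = 2\<close>, the dihedral group of order 12.
\<close>

section \<open>Product-free sets in extensions\<close>

text \<open>Why full preimages do not suffice: a product-free set of rotations stays product-free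
  when a reflection is added, so every locally maximal set of a dihedral group contains a reflection
  and has 1 among its products. The preimage of a set that fills the quotient then fills the whole
  group, kernel included. The remedy is to add a single point y over a rotation c and to give up y^2
  over c^2; the other points over c can then neither be added nor be reached as products, provided
  that everything else is blocked without the damaged fibre. This works for p = 7 and p = 11. For p
  = 5 the fibres over c^3 and c^4 are blocked through the damaged fibre, and y^5 = 1 is needed to
  control the exceptions. For p = 3 the square of c^2 is c itself and the construction collapses.
  Its substitute lives between two involutory reflections, so that their existence becomes the main
  task: reflections may all have order 4, as in the dicyclic group of order 12.\<close>

lemma product_free_iff:
  "product_free G S \<longleftrightarrow>
    S \<noteq> {} \<and> S \<subseteq> carrier G \<and> (\<forall>a\<in>S. \<forall>b\<in>S. a \<otimes>\<^bsub>G\<^esub> b \<notin> S)"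
  unfolding product_free_def set_mult_def by auto

lemma product_free_mult: "product_free G S \<Longrightarrow> a \<in> S \<Longrightarrow> b \<in> S \<Longrightarrow> a \<otimes>\<^bsub>G\<^esub> b \<notin> S"
  by (simp add: product_free_iff)

lemma product_free_subset: "product_free G S \<Longrightarrow> S \<subseteq> carrier G"
  by (simp add: product_free_def)

lemma product_free_extend:
  assumes fin: "finite (carrier G)" and S: "product_free G S"
  obtains T where "locally_maximal_product_free G T" "S \<subseteq> T"
proof -
  let ?P = "\<lambda>T. product_free G T \<and> S \<subseteq> T"
  have "finite {T. ?P T}"
    by (rule finite_subset[OF _ finite_Pow_iff[THEN iffD2, OF fin]]) (auto simp: product_free_def)
  then obtain T where "T \<in> {T. ?P T}" and max: "\<forall>U\<in>{T. ?P T}. T \<subseteq> U \<longrightarrow> T = U"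
    using finite_has_maximal2[of "{T. ?P T}" S] S by auto
  then have T: "?P T" by simp
  have "locally_maximal_product_free G T"
    unfolding locally_maximal_product_free_def using T max by auto
  with T that show thesis by blast
qed

lemma not_filledI:
  assumes "finite (carrier G)" "product_free G S" "w \<in> carrier G" "w \<noteq> \<one>\<^bsub>G\<^esub>"
    and w: "\<And>T. product_free G T \<Longrightarrow> S \<subseteq> T \<Longrightarrow> w \<notin> T \<and> (\<forall>a\<in>T. \<forall>b\<in>T. a \<otimes>\<^bsub>G\<^esub> b \<noteq> w)"
  shows "\<not> filled G"
proof
  assume "filled G"
  obtain T where T: "locally_maximal_product_free G T" "S \<subseteq> T"
    using product_free_extend assms by metis
  then have "fills G T" using \<open>filled G\<close> by (simp add: filled_def)
  then have "w \<in> T \<union> (T <#>\<^bsub>G\<^esub> T)" using assms unfolding fills_def by blast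
  moreover have "product_free G T" using T by (simp add: locally_maximal_product_free_def)
  ultimately show False using w[OF _ T(2)] unfolding set_mult_def by blast
qed

text \<open>The preimage \<open>A\<close> of a locally maximal set \<open>S\<close> is again locally
  maximal. If a product-free \<open>T\<close> containing \<open>A\<close> had a point
  \<open>t\<close> outside \<open>A\<close>, then \<open>insert (h t) S\<close> would be
  product-free: fibres over \<open>S\<close> lie entirely in \<open>T\<close>, so a forbidden
  relation in \<open>H\<close> lifts to one in \<open>T\<close>, one of its members being corrected
  within its fibre. Since \<open>A\<close> fills \<open>G\<close>, its image fills
  \<open>H\<close>.\<close>

lemma (in group_hom) filled_image:
  assumes surj: "h ` carrier G = carrier H" and fil: "filled G"
  shows "filled H"
  unfolding filled_def
proof (intro allI impI)
  fix S assume S: "locally_maximal_product_free H S"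
  then have pf: "product_free H S" and mx: "\<And>T. product_free H T \<Longrightarrow> S \<subseteq> T \<Longrightarrow> S = T"
    by (auto simp: locally_maximal_product_free_def)
  define A where "A = {g \<in> carrier G. h g \<in> S}"
  have SH: "S \<subseteq> carrier H" using pf by (rule product_free_subset)
  have lift: "\<exists>g\<in>carrier G. h g = s" if "s \<in> S" for s
    using that SH surj by (metis imageE subsetD)
  have pfA: "product_free G A"
  proof -
    have "A \<noteq> {}" using pf lift unfolding product_free_iff A_def by blast
    then show ?thesis
      using pf unfolding product_free_iff A_def by auto
  qed
  have "locally_maximal_product_free G A"
    unfolding locally_maximal_product_free_def
  proof (intro conjI allI impI pfA)
    fix T assume T: "product_free G T \<and> A \<subseteq> T"
    then have TG: "T \<subseteq> carrier G" and Tpf: "\<And>a b. a \<in> T \<Longrightarrow> b \<in> T \<Longrightarrow> a \<otimes> b \<notin> T"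
      by (auto simp: product_free_iff)
    have AT: "g \<in> T" if "g \<in> carrier G" "h g \<in> S" for g using that T by (auto simp: A_def)
    have "t \<in> A" if t: "t \<in> T" for t
    proof (rule ccontr)
      assume "t \<notin> A"
      have tG: "t \<in> carrier G" using t TG by blast
      with \<open>t \<notin> A\<close> have tS: "h t \<notin> S" by (simp add: A_def)
      have "product_free H (insert (h t) S)"
        unfolding product_free_iff
      proof (intro conjI ballI)
        fix a b assume a: "a \<in> insert (h t) S" and b: "b \<in> insert (h t) S"
        obtain g where g: "g \<in> T" "h g = a" "g \<in> carrier G"
          using a t lift AT TG by (metis insertE subsetD)
        obtain k where k: "k \<in> T" "h k = b" "k \<in> carrier G"
          using b t lift AT TG by (metis insertE subsetD)
        have 1: "g \<otimes> k \<notin> T" using Tpf g k by blast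
        then have 2: "a \<otimes>\<^bsub>H\<^esub> b \<notin> S" using AT[of "g \<otimes> k"] g k by auto
        obtain s where s: "s \<in> carrier G" "h s \<in> S" "s \<in> T"
          using pf lift AT unfolding product_free_iff by blast
        have "a \<otimes>\<^bsub>H\<^esub> b \<noteq> h t"
        proof
          assume e: "a \<otimes>\<^bsub>H\<^esub> b = h t"
          \<comment> \<open>In the first two cases the other factor is 1, hence not in
            \<open>S\<close> and so equal to \<open>h t\<close>. Multiplication by \<open>t\<close>
            then maps the fibre of \<open>h s\<close> to itself.\<close>
          consider "a = h t" | "b = h t" | "a \<in> S" "b \<in> S" using a b by blast
          then show False
          proof cases
            case 1
            then have "b = \<one>\<^bsub>H\<^esub>" using e k(2,3) tG H.l_cancel_one[of "h t" b] by auto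
            then have "b \<notin> S" using pf unfolding product_free_iff
              by (metis H.l_one SH subsetD)
            then have "h t = \<one>\<^bsub>H\<^esub>" using b \<open>b = \<one>\<^bsub>H\<^esub>\<close> by simp
            then have "t \<otimes> s \<in> T" using AT[of "t \<otimes> s"] s tG by simp
            then show False using Tpf t s by blast
          next
            case 2
            then have "a = \<one>\<^bsub>H\<^esub>" using e g(2,3) tG H.r_cancel_one[of "h t" a] by auto
            then have "a \<notin> S" using pf unfolding product_free_iff
              by (metis H.l_one SH subsetD)
            then have "h t = \<one>\<^bsub>H\<^esub>" using a \<open>a = \<one>\<^bsub>H\<^esub>\<close> by simp
            then have "t \<otimes> s \<in> T" using AT[of "t \<otimes> s"] s tG by simp
            then show False using Tpf t s by blast
          next
            case 3
            have h: "h (inv g \<otimes> t) = b"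
              using g k tG e H.inv_solve_left[of b a "h t"] hom_closed[OF g(3)] hom_closed[OF k(3)] by auto
            then have "inv g \<otimes> t \<in> T" using AT[of "inv g \<otimes> t"] g(3) tG 3 h by (simp del: hom_mult)
            then have "g \<otimes> (inv g \<otimes> t) \<notin> T" using Tpf g by blast
            moreover have "g \<otimes> (inv g \<otimes> t) = t"
              using g tG by (simp add: G.m_assoc[symmetric])
            ultimately show False using t by simp
          qed
        qed
        with 2 show "a \<otimes>\<^bsub>H\<^esub> b \<notin> insert (h t) S" by blast
      qed (use SH tG in auto)
      then have "S = insert (h t) S" using mx by blast
      then show False using tS by blast
    qed
    then show "A = T" using T by blast
  qed
  then have fA: "fills G A" using fil by (simp add: filled_def)
  show "fills H S"
    unfolding fills_def
  proof
    fix y assume y: "y \<in> carrier H - {\<one>\<^bsub>H\<^esub>}"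
    then obtain g where g: "g \<in> carrier G" "h g = y" using surj by (metis DiffD1 imageE)
    then have "g \<noteq> \<one>" using y hom_one by auto
    then have "g \<in> A \<union> (A <#> A)" using fA g unfolding fills_def by blast
    then show "y \<in> S \<union> (S <#>\<^bsub>H\<^esub> S)"
      using g unfolding A_def set_mult_def by fastforce
  qed
qed

text \<open>A product-free set of the quotient whose preimage is perturbed at \<open>c\<close> and \<open>c\<^sup>2\<close>: the point \<open>y\<close>
  of the fibre over \<open>c\<close> is added at the cost of removing \<open>y\<^sup>2\<close>, and all other points of the fibre
  over \<open>c\<close> are then blocked by \<open>y\<close> without being products.\<close>

lemma (in group_hom) perturbed_preimage_not_filled:
  assumes fin: "finite (carrier G)" and surj: "h ` carrier G = carrier H"
    and y: "y \<in> carrier G" "h y = c" and z: "z \<in> carrier G" "z \<noteq> \<one>" "h z = \<one>\<^bsub>H\<^esub>"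
    and \<Sigma>: "\<Sigma> \<subseteq> carrier H" and d: "c \<otimes>\<^bsub>H\<^esub> c \<in> \<Sigma>" and c: "c \<notin> \<Sigma>"
    and pf: "\<And>a b. a \<in> \<Sigma> \<Longrightarrow> b \<in> \<Sigma> \<Longrightarrow> a \<otimes>\<^bsub>H\<^esub> b \<notin> insert c \<Sigma>"
    and pfc: "\<And>a. a \<in> \<Sigma> \<Longrightarrow> c \<otimes>\<^bsub>H\<^esub> a \<notin> \<Sigma> \<and> a \<otimes>\<^bsub>H\<^esub> c \<notin> \<Sigma>"
    and block: "\<And>k. k \<in> carrier H - insert c \<Sigma> \<Longrightarrow>
      \<exists>a \<in> \<Sigma> - {c \<otimes>\<^bsub>H\<^esub> c}. \<exists>b \<in> insert c \<Sigma>. k = a \<otimes>\<^bsub>H\<^esub> b \<or> k = b \<otimes>\<^bsub>H\<^esub> a \<or>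
        k \<otimes>\<^bsub>H\<^esub> b = a \<or> b \<otimes>\<^bsub>H\<^esub> k = a \<or> k \<otimes>\<^bsub>H\<^esub> a = b \<or> a \<otimes>\<^bsub>H\<^esub> k = b"
  shows "\<not> filled G"
proof -
  define S where "S = insert y {g \<in> carrier G. h g \<in> \<Sigma> \<and> g \<noteq> y \<otimes> y}"
  have cH: "c \<in> carrier H" using y by auto
  have one: "\<one>\<^bsub>H\<^esub> \<notin> \<Sigma>" using pf[of "\<one>\<^bsub>H\<^esub>" "\<one>\<^bsub>H\<^esub>"] by auto
  have hyy: "h (y \<otimes> y) = c \<otimes>\<^bsub>H\<^esub> c" using y by simp
  have SG: "S \<subseteq> carrier G" using y by (auto simp: S_def)
  have mem: "g \<in> S" if "g \<in> carrier G" "h g \<in> \<Sigma> - {c \<otimes>\<^bsub>H\<^esub> c}" for g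
    using that hyy by (auto simp: S_def)
  have rep: "\<exists>g\<in>S. h g = b" if "b \<in> insert c \<Sigma>" for b
  proof -
    consider "b = c" | "b = c \<otimes>\<^bsub>H\<^esub> c" "b \<in> \<Sigma>" | "b \<in> \<Sigma> - {c \<otimes>\<^bsub>H\<^esub> c}" using \<open>b \<in> insert c \<Sigma>\<close> by blast
    then show ?thesis
    proof cases
      case 1 then show ?thesis using y by (auto simp: S_def)
    next
      case 2
      \<comment> \<open>The point y^2 is missing from this fibre; the kernel element
        \<open>z\<close> provides another one.\<close>
      have "y \<otimes> y \<otimes> z \<noteq> y \<otimes> y" using y z by simp
      moreover have "h (y \<otimes> y \<otimes> z) = b" using y z 2 cH by simp
      ultimately show ?thesis using 2 y z unfolding S_def by blast
    next
      case 3
      then obtain g where "g \<in> carrier G" "h g = b" using surj \<Sigma> by (metis DiffD1 imageE subsetD)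
      then show ?thesis using mem 3 by blast
    qed
  qed
  have hS: "h g \<in> insert c \<Sigma>" if "g \<in> S" for g using that y by (auto simp: S_def)
  have "product_free G S"
    unfolding product_free_iff
  proof (intro conjI ballI SG)
    show "S \<noteq> {}" by (simp add: S_def)
    fix a b assume a: "a \<in> S" and b: "b \<in> S"
    have ab: "a \<in> carrier G" "b \<in> carrier G" using a b SG by auto
    consider "a = y" "b = y" | "h a \<in> \<Sigma>" "b = y" | "a = y" "h b \<in> \<Sigma>" | "h a \<in> \<Sigma>" "h b \<in> \<Sigma>"
      using a b by (auto simp: S_def)
    then show "a \<otimes> b \<notin> S"
    proof cases
      case 1
      have "c \<otimes>\<^bsub>H\<^esub> c \<noteq> c" using d c by metis
      then have "y \<otimes> y \<noteq> y" using hyy y by metis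
      then show ?thesis using 1 by (auto simp: S_def)
    next
      case 2
      have "h a \<noteq> \<one>\<^bsub>H\<^esub>" using 2 one by auto
      then have "h a \<otimes>\<^bsub>H\<^esub> c \<noteq> c" using cH ab by simp
      then show ?thesis using pfc[of "h a"] 2 y ab hS[of "a \<otimes> b"] by auto
    next
      case 3
      have "h b \<noteq> \<one>\<^bsub>H\<^esub>" using 3 one by auto
      then have "c \<otimes>\<^bsub>H\<^esub> h b \<noteq> c" using cH ab by simp
      then show ?thesis using pfc[of "h b"] 3 y ab hS[of "a \<otimes> b"] by auto
    next
      case 4
      then show ?thesis using pf[of "h a" "h b"] ab hS[of "a \<otimes> b"] by auto
    qed
  qed
  moreover have "y \<otimes> z \<notin> T \<and> (\<forall>a\<in>T. \<forall>b\<in>T. a \<otimes> b \<noteq> y \<otimes> z)" if T: "product_free G T" "S \<subseteq> T" for T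
  proof -
    have TG: "t \<in> carrier G" if "t \<in> T" for t using that T(1) product_free_subset by blast
    have no: "\<And>s t. s \<in> T \<Longrightarrow> t \<in> T \<Longrightarrow> s \<otimes> t \<notin> T" using T(1) by (rule product_free_mult)
    have noS: "\<And>s t. s \<in> S \<Longrightarrow> t \<in> T \<Longrightarrow> s \<otimes> t \<notin> S \<and> t \<otimes> s \<notin> S" using no T(2) by blast
    have lab: "h t \<in> insert c \<Sigma>" if t: "t \<in> T" for t
    proof (rule ccontr)
      assume "h t \<notin> insert c \<Sigma>"
      then obtain a b where a: "a \<in> \<Sigma> - {c \<otimes>\<^bsub>H\<^esub> c}" and b: "b \<in> insert c \<Sigma>"
        and cs: "h t = a \<otimes>\<^bsub>H\<^esub> b \<or> h t = b \<otimes>\<^bsub>H\<^esub> a \<or>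
          h t \<otimes>\<^bsub>H\<^esub> b = a \<or> b \<otimes>\<^bsub>H\<^esub> h t = a \<or> h t \<otimes>\<^bsub>H\<^esub> a = b \<or> a \<otimes>\<^bsub>H\<^esub> h t = b"
        using block[of "h t"] hom_closed[OF TG[OF t]] by (metis DiffI)
      obtain u where u: "u \<in> S" "h u = b" using rep b by blast
      have tG: "t \<in> carrier G" and uG: "u \<in> carrier G" using TG t u SG by auto
      have aH: "a \<in> carrier H" and bH: "b \<in> carrier H" using a \<Sigma> uG u by auto
      \<comment> \<open>In each relation given by \<open>block\<close> the element over
        \<open>b\<close> is the chosen \<open>u\<close>, while the one over \<open>a\<close> is then
        forced and may be any point of its fibre. It lies in \<open>S\<close> because that fibre is
        complete, which is why \<open>block\<close> does not admit the square of \<open>c\<close> in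
        the role of \<open>a\<close>.\<close>
      have m1: "t \<otimes> inv u \<in> S" if "h t = a \<otimes>\<^bsub>H\<^esub> b"
        using that tG uG u a aH bH by (intro mem) (auto simp: H.m_assoc)
      have m2: "inv u \<otimes> t \<in> S" if "h t = b \<otimes>\<^bsub>H\<^esub> a"
        using that tG uG u a aH bH by (intro mem) (auto simp: H.m_assoc[symmetric])
      have m3: "t \<otimes> u \<in> S" if "h t \<otimes>\<^bsub>H\<^esub> b = a"
        using that tG uG u a by (intro mem) auto
      have m4: "u \<otimes> t \<in> S" if "b \<otimes>\<^bsub>H\<^esub> h t = a"
        using that tG uG u a by (intro mem) auto
      have m5: "inv t \<otimes> u \<in> S" if "h t \<otimes>\<^bsub>H\<^esub> a = b"
        using that[symmetric] tG uG u a aH by (intro mem) (auto simp: H.m_assoc[symmetric])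
      have m6: "u \<otimes> inv t \<in> S" if "a \<otimes>\<^bsub>H\<^esub> h t = b"
        using that[symmetric] tG uG u a aH by (intro mem) (auto simp: H.m_assoc)
      have e: "t \<otimes> inv u \<otimes> u = t" "u \<otimes> (inv u \<otimes> t) = t" "t \<otimes> (inv t \<otimes> u) = u" "u \<otimes> inv t \<otimes> t = u"
        using tG uG by (auto simp: G.m_assoc G.m_assoc[symmetric])
      show False
        using cs m1 m2 m3 m4 m5 m6 e no[of "t \<otimes> inv u" u] no[of u "inv u \<otimes> t"] no[of t u] no[of u t]
          no[of t "inv t \<otimes> u"] no[of "u \<otimes> inv t" t] t u(1) T(2) by (metis subsetD)
    qed
    have only: "t = y" if t: "t \<in> T" "h t = c" for t
    proof (rule ccontr)
      assume "t \<noteq> y"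
      then have "t \<otimes> y \<noteq> y \<otimes> y" using y TG t by simp
      then have "t \<otimes> y \<in> S" using t TG y d by (auto simp: S_def)
      then show False using noS[of y t] t by (auto simp: S_def)
    qed
    have hw: "h (y \<otimes> z) = c" using y z cH by simp
    have "y \<otimes> z \<noteq> y" using y z by simp
    then have "y \<otimes> z \<notin> T" using only hw by blast
    moreover have "a \<otimes> b \<noteq> y \<otimes> z" if ab: "a \<in> T" "b \<in> T" for a b
    proof
      assume "a \<otimes> b = y \<otimes> z"
      then have e: "h a \<otimes>\<^bsub>H\<^esub> h b = c" using hw ab TG hom_mult by metis
      consider "h a = c" "h b = c" | "h a = c" "h b \<in> \<Sigma>" | "h a \<in> \<Sigma>" "h b = c" | "h a \<in> \<Sigma>" "h b \<in> \<Sigma>"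
        using lab ab by blast
      then show False
      proof cases
        case 1 then show ?thesis using e d c by metis
      next
        case 2
        then have "h b = \<one>\<^bsub>H\<^esub>" using e cH ab TG by (metis H.l_cancel_one hom_closed)
        then show ?thesis using 2 one by simp
      next
        case 3
        then have "h a = \<one>\<^bsub>H\<^esub>" using e cH ab TG by (metis H.r_cancel_one hom_closed)
        then show ?thesis using 3 one by simp
      next
        case 4
        then show ?thesis using pf[of "h a" "h b"] e by auto
      qed
    qed
    ultimately show ?thesis by blast
  qed
  ultimately show ?thesis
  proof (intro not_filledI[OF fin, of S "y \<otimes> z"])
    show "y \<otimes> z \<noteq> \<one>"
      using c pf[OF d d] y z cH d hom_one hom_mult one
      by (metis H.r_one)
  qed (use y z in auto)
qed

text \<open>Here 1 is not a product of members of {c}, so the plain preimage works. A product-free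
  set containing the fibre over \<open>c\<close> has no further points: an element over 1 moves that
  fibre to itself, and an element over c^2 is a product of two of its points. All products then lie
  over c^2, and the kernel element \<open>z\<close> is missed.\<close>

lemma (in group_hom) index_3_not_filled:
  assumes fin: "finite (carrier G)" and surj: "h ` carrier G = carrier H"
    and H: "carrier H = {\<one>\<^bsub>H\<^esub>, c, c \<otimes>\<^bsub>H\<^esub> c}" "c \<noteq> \<one>\<^bsub>H\<^esub>" "c \<otimes>\<^bsub>H\<^esub> c \<noteq> \<one>\<^bsub>H\<^esub>"
    and z: "z \<in> carrier G" "z \<noteq> \<one>" "h z = \<one>\<^bsub>H\<^esub>"
  shows "\<not> filled G"
proof -
  define S where "S = {g \<in> carrier G. h g = c}"
  have cH: "c \<in> carrier H" using H by blast
  have cc: "c \<otimes>\<^bsub>H\<^esub> c \<noteq> c" using H(2) cH by simp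
  obtain y where y: "y \<in> S" using surj cH unfolding S_def by (metis (mono_tags) imageE mem_Collect_eq)
  have "product_free G S"
    unfolding product_free_iff using y cc by (auto simp: S_def)
  moreover have "z \<notin> T \<and> (\<forall>a\<in>T. \<forall>b\<in>T. a \<otimes> b \<noteq> z)" if T: "product_free G T" "S \<subseteq> T" for T
  proof -
    have TG: "t \<in> carrier G" if "t \<in> T" for t using that T(1) product_free_subset by blast
    have no: "\<And>s t. s \<in> T \<Longrightarrow> t \<in> T \<Longrightarrow> s \<otimes> t \<notin> T" using T(1) by (rule product_free_mult)
    have yT: "y \<in> T" "y \<in> carrier G" "h y = c" using y T by (auto simp: S_def)
    have "h t = c" if t: "t \<in> T" for t
    proof -
      have tG: "t \<in> carrier G" using TG t .
      have "h t \<noteq> \<one>\<^bsub>H\<^esub>"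
      proof
        assume "h t = \<one>\<^bsub>H\<^esub>"
        then have "t \<otimes> y \<in> S" using tG yT cH by (simp add: S_def)
        then show False using no t yT T by blast
      qed
      moreover have "h t \<noteq> c \<otimes>\<^bsub>H\<^esub> c"
      proof
        assume "h t = c \<otimes>\<^bsub>H\<^esub> c"
        then have "t \<otimes> inv y \<in> S" using tG yT cH by (simp add: S_def H.m_assoc)
        then have "t \<otimes> inv y \<otimes> y \<notin> T" using no yT T by blast
        then show False using t tG yT by (simp add: G.m_assoc)
      qed
      ultimately show ?thesis using hom_closed[OF tG] H(1) by blast
    qed
    then have "a \<otimes> b \<noteq> z" if "a \<in> T" "b \<in> T" for a b
      using that TG hom_mult H(3) z(3) by metis
    moreover have "z \<notin> T" using \<open>\<And>t. t \<in> T \<Longrightarrow> h t = c\<close> z H(2) by metis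
    ultimately show ?thesis by blast
  qed
  ultimately show ?thesis using not_filledI[OF fin] z by blast
qed

text \<open>Powers of each of these powers return to \<open>c\<close>: c^6 is the cube of c^2 and
  the square of c^3, and c^16 is the fourth power of c^4.\<close>

lemma (in group) pow_5_cases:
  assumes "c \<in> carrier G" "c [^] (5::nat) = \<one>" "c \<noteq> \<one>"
  shows "c [^] (2::nat) \<noteq> \<one>" "c [^] (3::nat) \<noteq> \<one>" "c [^] (4::nat) \<noteq> \<one>"
proof -
  have c6: "c [^] (6::nat) = c"
    using nat_pow_mult[of c 5 1] assms by simp
  have "c [^] (16::nat) = c"
    using nat_pow_mult[of c 5 11] nat_pow_mult[of c 5 6] assms(1,2) c6 by simp
  with c6 show "c [^] (2::nat) \<noteq> \<one>" "c [^] (3::nat) \<noteq> \<one>" "c [^] (4::nat) \<noteq> \<one>"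
    using nat_pow_pow[of c 2 3] nat_pow_pow[of c 3 2] nat_pow_pow[of c 4 4] assms by auto
qed

text \<open>The same perturbation at \<open>c\<close> and \<open>c\<^sup>2\<close>. The missed element is \<open>y\<^sup>3\<close>: its square
  \<open>y\<^sup>6 = y\<close> lies in the set, and \<open>y \<cdot> y\<^sup>2\<close> is not available as a product.\<close>

lemma (in group_hom) quotient_5_not_filled:
  assumes fin: "finite (carrier G)" and surj: "h ` carrier G = carrier H"
    and y: "y \<in> carrier G" "y [^] (5::nat) = \<one>" "h y = c" "c \<noteq> \<one>\<^bsub>H\<^esub>"
    and z: "z \<in> carrier G" "z \<noteq> \<one>" "h z = \<one>\<^bsub>H\<^esub>"
    and \<Sigma>: "\<Sigma> \<subseteq> carrier H" "\<And>a i. a \<in> \<Sigma> \<Longrightarrow> a \<noteq> c [^]\<^bsub>H\<^esub> (i::nat)"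
      "\<And>a b. a \<in> \<Sigma> \<Longrightarrow> b \<in> \<Sigma> \<Longrightarrow> a \<otimes>\<^bsub>H\<^esub> b = \<one>\<^bsub>H\<^esub>"
    and cover: "\<And>k. k \<in> carrier H \<Longrightarrow> (\<exists>i<5. k = c [^]\<^bsub>H\<^esub> (i::nat)) \<or> k \<in> \<Sigma> \<or>
      (\<exists>a\<in>\<Sigma>. \<exists>i\<in>{1,2::nat}. k = c [^]\<^bsub>H\<^esub> i \<otimes>\<^bsub>H\<^esub> a \<or> k = a \<otimes>\<^bsub>H\<^esub> c [^]\<^bsub>H\<^esub> i)"
  shows "\<not> filled G"
proof -
  let ?c = "\<lambda>i::nat. c [^]\<^bsub>H\<^esub> i"
  have cH: "c \<in> carrier H" using y by auto
  have c5: "?c 5 = \<one>\<^bsub>H\<^esub>" using y hom_nat_pow[of y 5] by simp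
  have cne: "?c 2 \<noteq> \<one>\<^bsub>H\<^esub>" "?c 3 \<noteq> \<one>\<^bsub>H\<^esub>" "?c 4 \<noteq> \<one>\<^bsub>H\<^esub>"
    using H.pow_5_cases[OF cH c5 y(4)] .
  have cadd: "?c i \<otimes>\<^bsub>H\<^esub> ?c j = ?c (i + j)" for i j using cH by (simp add: H.nat_pow_mult)
  have c0: "?c 0 = \<one>\<^bsub>H\<^esub>" and c1: "?c 1 = c" using cH by auto
  have c6: "?c 6 = c" using cadd[of 5 1] c5 cH by simp
  have cinj: "?c i \<noteq> ?c j" if "i < j" "j < 5" for i j
  proof
    assume "?c i = ?c j"
    then have "?c i \<otimes>\<^bsub>H\<^esub> ?c (j - i) = ?c i" using cadd[of i "j - i"] that by simp
    then have "?c (j - i) = \<one>\<^bsub>H\<^esub>" using cH by simp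
    moreover have "j - i \<in> {1,2,3,4}" using that by auto
    ultimately show False using cne y(4) c1 by auto
  qed
  have sq: "a \<otimes>\<^bsub>H\<^esub> a = \<one>\<^bsub>H\<^esub>" if "a \<in> \<Sigma>" for a using \<Sigma>(3) that by blast
  have \<Sigma>H: "a \<in> carrier H" if "a \<in> \<Sigma>" for a using that \<Sigma>(1) by blast
  have \<Sigma>pow: "a \<otimes>\<^bsub>H\<^esub> ?c i \<noteq> ?c j" "?c i \<otimes>\<^bsub>H\<^esub> a \<noteq> ?c j" if a: "a \<in> \<Sigma>" "i < 5" for a i j
  proof -
    have i: "?c i \<otimes>\<^bsub>H\<^esub> ?c (5 - i) = \<one>\<^bsub>H\<^esub>" "?c (5 - i) \<otimes>\<^bsub>H\<^esub> ?c i = \<one>\<^bsub>H\<^esub>"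
      using cadd[of i "5 - i"] cadd[of "5 - i" i] a c5 by auto
    show "a \<otimes>\<^bsub>H\<^esub> ?c i \<noteq> ?c j"
    proof
      assume "a \<otimes>\<^bsub>H\<^esub> ?c i = ?c j"
      then have "(a \<otimes>\<^bsub>H\<^esub> ?c i) \<otimes>\<^bsub>H\<^esub> ?c (5 - i) = ?c (j + (5 - i))" using cadd by simp
      then have "a = ?c (j + (5 - i))" using i \<Sigma>H a cH by (simp add: H.m_assoc)
      then show False using \<Sigma>(2) a by blast
    qed
    show "?c i \<otimes>\<^bsub>H\<^esub> a \<noteq> ?c j"
    proof
      assume "?c i \<otimes>\<^bsub>H\<^esub> a = ?c j"
      then have "?c (5 - i) \<otimes>\<^bsub>H\<^esub> (?c i \<otimes>\<^bsub>H\<^esub> a) = ?c ((5 - i) + j)" using cadd by simp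
      then have "a = ?c ((5 - i) + j)" using i \<Sigma>H a cH by (simp add: H.m_assoc[symmetric])
      then show False using \<Sigma>(2) a by blast
    qed
  qed
  have \<Sigma>mul: "a \<otimes>\<^bsub>H\<^esub> ?c i \<notin> \<Sigma>" "?c i \<otimes>\<^bsub>H\<^esub> a \<notin> \<Sigma>" if a: "a \<in> \<Sigma>" "i \<in> {1,2}" for a i
  proof -
    have i: "?c i \<noteq> \<one>\<^bsub>H\<^esub>" using a cne y(4) c1 by auto
    show "a \<otimes>\<^bsub>H\<^esub> ?c i \<notin> \<Sigma>"
    proof
      assume "a \<otimes>\<^bsub>H\<^esub> ?c i \<in> \<Sigma>"
      then have "a \<otimes>\<^bsub>H\<^esub> (a \<otimes>\<^bsub>H\<^esub> ?c i) = \<one>\<^bsub>H\<^esub>" using \<Sigma>(3) a by blast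
      then show False using i sq a \<Sigma>H cH by (simp add: H.m_assoc[symmetric])
    qed
    show "?c i \<otimes>\<^bsub>H\<^esub> a \<notin> \<Sigma>"
    proof
      assume "?c i \<otimes>\<^bsub>H\<^esub> a \<in> \<Sigma>"
      then have "?c i \<otimes>\<^bsub>H\<^esub> a \<otimes>\<^bsub>H\<^esub> a = \<one>\<^bsub>H\<^esub>" using \<Sigma>(3) a by blast
      then show False using i sq a \<Sigma>H cH by (simp add: H.m_assoc)
    qed
  qed
  \<comment> \<open>The fibres over c^3 and c^4 are blocked through the fibre over c^2, which has
    lost y^2. This leaves one exceptional point in each of them, y^3 and y^4, which y^5 = 1
    identifies and which are excluded separately.\<close>
  define S where "S = insert y {g \<in> carrier G. h g = ?c 2 \<and> g \<noteq> y [^] (2::nat) \<or> h g \<in> \<Sigma>}"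
  have y2: "y \<otimes> y = y [^] (2::nat)" "y \<otimes> y [^] (2::nat) = y [^] (3::nat)" "y [^] (2::nat) \<otimes> y = y [^] (3::nat)"
    "y [^] (3::nat) \<otimes> y [^] (3::nat) = y"
    using y G.nat_pow_mult[of y 1 1] G.nat_pow_mult[of y 1 2] G.nat_pow_mult[of y 2 1] G.nat_pow_mult[of y 3 3]
      G.nat_pow_mult[of y 5 1] by (auto simp: numeral_eq_Suc)
  have hyp: "h (y [^] (i::nat)) = ?c i" for i using y hom_nat_pow by simp
  have SG: "S \<subseteq> carrier G" using y by (auto simp: S_def)
  have Scases: "a = y \<or> h a = ?c 2 \<and> a \<noteq> y [^] (2::nat) \<or> h a \<in> \<Sigma>" if "a \<in> S" for a
    using that by (auto simp: S_def)
  have pf: "product_free G S"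
    unfolding product_free_iff
  proof (intro conjI ballI SG)
    show "S \<noteq> {}" by (simp add: S_def)
    fix a b assume a: "a \<in> S" and b: "b \<in> S"
    have ab: "a \<in> carrier G" "b \<in> carrier G" using a b SG by auto
    have lab: "(\<exists>i\<in>{1,2}. h x = ?c i) \<or> h x \<in> \<Sigma>" if "x \<in> S" for x
      using Scases[OF that] y(3) c1 by auto
    have out: "x \<notin> S" if "x \<in> carrier G" "h x = ?c i" "i \<in> {0,3,4}" for x i
    proof
      assume "x \<in> S"
      then show False using lab[of x] that cinj[of 0 1] cinj[of 0 2] cinj[of 1 3] cinj[of 2 3]
          cinj[of 1 4] cinj[of 2 4] \<Sigma>(2)[of "h x" i] by auto
    qed
    have out2: "x \<notin> S" if "x \<in> carrier G" "h x \<notin> \<Sigma>" "\<And>j. h x \<noteq> ?c j" for x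
      using lab[of x] that by blast
    consider (1) "a = y" "b = y" | (2) i j where "i \<in> {1,2}" "j \<in> {1,2}" "h a = ?c i" "h b = ?c j" "i + j \<noteq> 2"
      | (3) i where "i \<in> {1,2}" "h a = ?c i" "h b \<in> \<Sigma>" | (4) i where "h a \<in> \<Sigma>" "i \<in> {1,2}" "h b = ?c i"
      | (5) "h a \<in> \<Sigma>" "h b \<in> \<Sigma>"
    proof -
      have "a = y \<or> h a = ?c 2 \<or> h a \<in> \<Sigma>" "b = y \<or> h b = ?c 2 \<or> h b \<in> \<Sigma>" "h y = ?c 1"
        using Scases a b y c1 by auto
      then show thesis using that(1,3,4,5) that(2)[of 1 2] that(2)[of 2 1] that(2)[of 2 2] by fastforce
    qed
    then show "a \<otimes> b \<notin> S"
    proof cases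
      case 1
      then show ?thesis
        using y2 hyp[of 2] cinj[of 1 2] y c1 \<Sigma>(2)[of _ 2] by (auto simp: S_def)
    next
      case (2 i j)
      then have "h (a \<otimes> b) = ?c (i + j)" "i + j \<in> {0,3,4}" using ab cadd by auto
      then show ?thesis using out ab by blast
    next
      case (3 i)
      then show ?thesis using out2[of "a \<otimes> b"] \<Sigma>pow(2)[of "h b" i] \<Sigma>mul(2)[of "h b" i] ab by auto
    next
      case (4 i)
      then show ?thesis using out2[of "a \<otimes> b"] \<Sigma>pow(1)[of "h a" i] \<Sigma>mul(1)[of "h a" i] ab by auto
    next
      case 5
      then show ?thesis using out[of "a \<otimes> b" 0] \<Sigma>(3) ab by simp
    qed
  qed
  moreover have "y [^] (3::nat) \<notin> T \<and> (\<forall>a\<in>T. \<forall>b\<in>T. a \<otimes> b \<noteq> y [^] (3::nat))"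
    if T: "product_free G T" "S \<subseteq> T" for T
  proof -
    have TG: "t \<in> carrier G" if "t \<in> T" for t using that T(1) product_free_subset by blast
    have no: "\<And>s t. s \<in> T \<Longrightarrow> t \<in> T \<Longrightarrow> s \<otimes> t \<notin> T" using T(1) by (rule product_free_mult)
    have yT: "y \<in> T" using T by (auto simp: S_def)
    have STI: "g \<in> T" if "g \<in> carrier G" "h g = ?c 2 \<and> g \<noteq> y [^] (2::nat) \<or> h g \<in> \<Sigma>" for g
      using that T(2) by (auto simp: S_def)
    have w: "y [^] (3::nat) \<notin> T" using no[of "y [^] (3::nat)" "y [^] (3::nat)"] y2 yT by auto
    have y2T: "y [^] (2::nat) \<notin> T" using no[OF yT yT] y2 by simp
    \<comment> \<open>Kernel elements, the label 0, are not excluded from \<open>T\<close>. They do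
      no harm: two labels among 0, 1, 2 add up to 3 only as 1 + 2.\<close>
    have lab: "(\<exists>i\<in>{0,1,2}. h t = ?c i) \<or> h t \<in> \<Sigma>" if t: "t \<in> T" for t
    proof (rule ccontr)
      assume n: "\<not> ?thesis"
      have tG: "t \<in> carrier G" using TG t .
      consider (3) "h t = ?c 3" | (4) "h t = ?c 4"
        | (5) a i where "a \<in> \<Sigma>" "i \<in> {1,2}" "h t = ?c i \<otimes>\<^bsub>H\<^esub> a"
        | (6) a i where "a \<in> \<Sigma>" "i \<in> {1,2}" "h t = a \<otimes>\<^bsub>H\<^esub> ?c i"
      proof -
        have "i \<in> {0,1,2,3,4}" if "i < 5" for i::nat using that by auto
        then show thesis using cover[OF hom_closed[OF tG]] n that by fastforce
      qed
      then show False
      proof cases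
        case 3
        have "inv y \<otimes> t \<noteq> y [^] (2::nat)"
        proof
          assume "inv y \<otimes> t = y [^] (2::nat)"
          then have "t = y [^] (3::nat)" using y2 y tG by (metis G.inv_solve_left' G.nat_pow_closed)
          then show False using w t by simp
        qed
        moreover have "h (inv y \<otimes> t) = ?c 2"
        proof -
          have "(1::nat) + 2 = 3" by simp
          then have "c \<otimes>\<^bsub>H\<^esub> ?c 2 = ?c 3" using cadd[of 1 2] c1 by metis
          then show ?thesis using 3 y tG cH by (simp add: H.inv_solve_left')
        qed
        ultimately have "inv y \<otimes> t \<in> T" using STI[of "inv y \<otimes> t"] y tG by simp
        then have "y \<otimes> (inv y \<otimes> t) \<notin> T" using no yT by blast
        then show False using t tG y by (simp add: G.m_assoc[symmetric])
      next
        case 4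
        show False
        proof (cases "inv t \<otimes> y = y [^] (2::nat)")
          case False
          have "h (inv t \<otimes> y) = ?c 2"
          proof -
            have "?c 4 \<otimes>\<^bsub>H\<^esub> ?c 2 = c" using cadd[of 4 2] c6 by simp
            then show ?thesis using 4 y tG cH by (simp add: H.inv_solve_left')
          qed
          then have "inv t \<otimes> y \<in> T" using STI[of "inv t \<otimes> y"] False y tG by simp
          then have "t \<otimes> (inv t \<otimes> y) \<notin> T" using no t by blast
          then show False using yT tG y by (simp add: G.m_assoc[symmetric])
        next
          case True
          then have "t \<otimes> y [^] (2::nat) = y"
            using y tG by (metis G.inv_solve_left' G.nat_pow_closed)
          then have "t \<otimes> y [^] (2::nat) \<otimes> y [^] (3::nat) = y \<otimes> y [^] (3::nat)" by simp
          then have t4: "t = y [^] (4::nat)"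
            using y tG G.nat_pow_mult[of y 2 3] G.nat_pow_mult[of y 1 3] by (simp add: G.m_assoc)
          \<comment> \<open>The exceptional point y^4 is the square of the removed y^2; inserting
            \<open>z\<close> and its inverse moves both factors to other points of the fibre without
            changing the product.\<close>
          let ?u = "y [^] (2::nat) \<otimes> z" and ?v = "inv z \<otimes> y [^] (2::nat)"
          have "?u \<in> T" "?v \<in> T"
            using y z hyp cH by (auto intro!: STI simp: G.inv_solve_left')
          then have "?u \<otimes> ?v \<notin> T" by (rule no)
          moreover have "z \<otimes> (inv z \<otimes> y [^] (2::nat)) = y [^] (2::nat)"
            using y(1) z(1) by (simp add: G.m_assoc[symmetric])
          then have "?u \<otimes> ?v = y [^] (2::nat) \<otimes> y [^] (2::nat)"
            using y(1) z(1) by (simp add: G.m_assoc)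
          then have "?u \<otimes> ?v = t" using t4 y(1) G.nat_pow_mult[of y 2 2] by simp
          ultimately show False using t by simp
        qed
      next
        case (5 a i)
        obtain g where g: "g \<in> T" "g \<in> carrier G" "h g = ?c i"
        proof -
          have "y [^] (2::nat) \<otimes> z \<in> T" using y z hyp cH by (auto intro!: STI)
          then show thesis using 5 that[of y] that[of "y [^] (2::nat) \<otimes> z"] yT y z c1 hyp cH by auto
        qed
        have "h (inv g \<otimes> t) = a" using 5 g tG \<Sigma>H cH by (simp add: H.m_assoc[symmetric])
        then have "inv g \<otimes> t \<in> T" using STI[of "inv g \<otimes> t"] 5 g tG by simp
        then have "g \<otimes> (inv g \<otimes> t) \<notin> T" using no g by blast
        then show False using t tG g by (simp add: G.m_assoc[symmetric])
      next
        case (6 a i)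
        obtain g where g: "g \<in> T" "g \<in> carrier G" "h g = ?c i"
        proof -
          have "y [^] (2::nat) \<otimes> z \<in> T" using y z hyp cH by (auto intro!: STI)
          then show thesis using 6 that[of y] that[of "y [^] (2::nat) \<otimes> z"] yT y z c1 hyp cH by auto
        qed
        have "h (t \<otimes> inv g) = a" using 6 g tG \<Sigma>H cH by (simp add: H.m_assoc)
        then have "t \<otimes> inv g \<in> T" using STI[of "t \<otimes> inv g"] 6 g tG by simp
        then have "t \<otimes> inv g \<otimes> g \<notin> T" using no g by blast
        then show False using t tG g by (simp add: G.m_assoc)
      qed
    qed
    have only: "t = y" if t: "t \<in> T" "h t = c" for t
    proof (rule ccontr)
      assume "t \<noteq> y"
      then have "t \<otimes> y \<noteq> y [^] (2::nat)" using y TG t y2(1) by (metis G.right_cancel)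
      moreover have "h (t \<otimes> y) = ?c 2" using t TG y cadd[of 1 1] c1 by (simp add: numeral_2_eq_2)
      ultimately have "t \<otimes> y \<in> T" using t TG y STI[of "t \<otimes> y"] by simp
      then show False using no t yT by blast
    qed
    have "a \<otimes> b \<noteq> y [^] (3::nat)" if ab: "a \<in> T" "b \<in> T" for a b
    proof
      assume e0: "a \<otimes> b = y [^] (3::nat)"
      have abG: "a \<in> carrier G" "b \<in> carrier G" using ab TG by auto
      have e: "h a \<otimes>\<^bsub>H\<^esub> h b = ?c 3" using e0 hyp[of 3] abG hom_mult by metis
      consider (1) i j where "i \<in> {0,1,2}" "j \<in> {0,1,2}" "h a = ?c i" "h b = ?c j"
        | (2) i where "i \<in> {0,1,2}" "h a = ?c i" "h b \<in> \<Sigma>" | (3) i where "i \<in> {0,1,2}" "h a \<in> \<Sigma>" "h b = ?c i"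
        | (4) "h a \<in> \<Sigma>" "h b \<in> \<Sigma>"
        using lab[OF ab(1)] lab[OF ab(2)] by blast
      then show False
      proof cases
        case (1 i j)
        then have "?c (i + j) = ?c 3" using e cadd by simp
        then have "i + j = 3" using 1 cinj[of "i + j" 3] cinj[of 3 "i + j"] by (cases "i + j" "3::nat" rule: linorder_cases) auto
        \<comment> \<open>The factor over \<open>c\<close> must be \<open>y\<close>, the only point
          of \<open>T\<close> there, and the other factor would then be the absent y^2.\<close>
        then consider "i = 1" "j = 2" | "i = 2" "j = 1" using 1 by auto
        then show False
        proof cases
          case 1
          then have "a = y" using only ab \<open>h a = ?c i\<close> c1 by simp
          then have "b = y [^] (2::nat)" using e0 y2(2) y abG by (metis G.l_cancel G.nat_pow_closed)
          then show False using y2T ab by simp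
        next
          case 2
          then have "b = y" using only ab \<open>h b = ?c j\<close> c1 by simp
          then have "a = y [^] (2::nat)" using e0 y2(3) y abG by (metis G.right_cancel G.nat_pow_closed)
          then show False using y2T ab by simp
        qed
      next
        case (2 i) then show False using e \<Sigma>pow(2)[of "h b" i 3] by auto
      next
        case (3 i) then show False using e \<Sigma>pow(1)[of "h a" i 3] by auto
      next
        case 4 then show False using e \<Sigma>(3) cne by metis
      qed
    qed
    with w show ?thesis by blast
  qed
  ultimately show ?thesis
  proof (intro not_filledI[OF fin, of S "y [^] (3::nat)"])
    show "y [^] (3::nat) \<noteq> \<one>" using hyp[of 3] cne hom_one by metis
  qed (use y in auto)
qed

section \<open>Cyclic and dihedral groups\<close>

text \<open>For \<open>a = m div 3\<close> the powers with exponent in the interval from \<open>a\<close> to \<open>2 a - 1\<close> form a locally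
  maximal product-free set; \<open>a - 1\<close> is a difference of two exponents but not a sum.\<close>

lemma (in group) cyclic_not_filled:
  assumes fin: "finite (carrier G)" and x: "x \<in> carrier G" and gen: "carrier G = (\<lambda>i::nat. x [^] i) ` {..<m}"
    and xm: "x [^] m = \<one>" and inj: "inj_on (\<lambda>i::nat. x [^] i) {..<m}" and m: "m \<ge> 7"
  shows "\<not> filled G"
proof -
  define a where "a = m div 3"
  have a: "3 * a \<le> m" "m < 3 * a + 3" "a \<ge> 2" unfolding a_def using m by auto
  \<comment> \<open>This bound puts both halves of every exponent from 2 a to m - a into the
    interval.\<close>
  have a5: "m + 2 \<le> 5 * a"
  proof (cases "a = 2")
    case True then show ?thesis using a m unfolding a_def by presburger
  next
    case False then show ?thesis using a by linarith
  qed
  let ?P = "\<lambda>i::nat. x [^] i"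
  have add: "?P i \<otimes> ?P j = ?P (i + j)" for i j using x by (simp add: nat_pow_mult)
  have red: "?P i = ?P (i mod m)" for i
  proof -
    have "?P i = ?P (m * (i div m)) \<otimes> ?P (i mod m)" using add[of "m * (i div m)" "i mod m"] by simp
    also have "?P (m * (i div m)) = \<one>" using x xm nat_pow_pow[of x m "i div m"] by simp
    finally show ?thesis using x by simp
  qed
  have eq: "i mod m = j mod m" if "?P i = ?P j" for i j
  proof -
    have "?P (i mod m) = ?P (j mod m)" using that red by metis
    then show ?thesis using inj m unfolding inj_on_def by simp
  qed
  have modm: "i mod m = i \<and> i < m \<or> i mod m = i - m \<and> m \<le> i" if "i < 2 * m" for i
    using that by (cases "i < m") (auto simp: mod_if)
  define S where "S = ?P ` {a..2 * a - 1}"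
  have pf: "product_free G S"
    unfolding product_free_iff
  proof (intro conjI ballI)
    show "S \<noteq> {}" "S \<subseteq> carrier G" using a x by (auto simp: S_def)
    fix s t assume "s \<in> S" "t \<in> S"
    then obtain i j where ij: "s = ?P i" "t = ?P j" "a \<le> i" "i \<le> 2 * a - 1" "a \<le> j" "j \<le> 2 * a - 1"
      by (auto simp: S_def)
    show "s \<otimes> t \<notin> S"
    proof
      assume "s \<otimes> t \<in> S"
      then obtain k where k: "?P (i + j) = ?P k" "a \<le> k" "k \<le> 2 * a - 1"
        using ij add by (auto simp: S_def)
      show False using eq[OF k(1)] k modm[of "i + j"] ij a modm[of k] by linarith
    qed
  qed
  moreover have "?P (a - 1) \<notin> T \<and> (\<forall>s\<in>T. \<forall>t\<in>T. s \<otimes> t \<noteq> ?P (a - 1))"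
    if T: "product_free G T" "S \<subseteq> T" for T
  proof -
    have no: "\<And>s t. s \<in> T \<Longrightarrow> t \<in> T \<Longrightarrow> s \<otimes> t \<notin> T" using T(1) by (rule product_free_mult)
    have ST: "?P i \<in> T" if "a \<le> i" "i \<le> 2 * a - 1" for i using that T(2) by (auto simp: S_def)
    have rng: "a \<le> i \<and> i \<le> 2 * a - 1" if i: "i < m" "?P i \<in> T" for i
    proof (rule ccontr)
      assume n: "\<not> ?thesis"
      \<comment> \<open>Exponents near 0, on either side, are differences of two members of the
        interval; those in between are sums of two members, namely of their halves.\<close>
      consider "i < a" | "m - a < i" | "2 * a \<le> i" "i \<le> m - a" using n by linarith
      then show False
      proof cases
        case 1
        then have "?P (i + a) \<in> T" by (intro ST) auto
        moreover have "?P a \<in> T" using a by (intro ST) auto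
        ultimately show False using no[OF i(2)] add by metis
      next
        case 2
        have e: "(i + (2 * a - 1)) mod m = i + (2 * a - 1) - m"
          using 2 i a modm[of "i + (2 * a - 1)"] by linarith
        have "?P (i + (2 * a - 1)) = ?P (i + (2 * a - 1) - m)"
          by (rule trans[OF red]) (simp only: e)
        moreover have "?P (i + (2 * a - 1) - m) \<in> T" using 2 i a by (intro ST) auto
        moreover have "?P (2 * a - 1) \<in> T" using a by (intro ST) auto
        ultimately show False using no[OF i(2)] add by metis
      next
        case 3
        have "?P (i div 2) \<in> T" "?P (i - i div 2) \<in> T" using 3 a a5 by (auto intro!: ST)
        then have "?P (i div 2 + (i - i div 2)) \<notin> T" using no add by metis
        then show False using i by simp
      qed
    qed
    have "s \<otimes> t \<noteq> ?P (a - 1)" if st: "s \<in> T" "t \<in> T" for s t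
    proof
      assume e: "s \<otimes> t = ?P (a - 1)"
      obtain i j where ij: "s = ?P i" "i < m" "t = ?P j" "j < m"
      proof -
        have "s \<in> ?P ` {..<m}" "t \<in> ?P ` {..<m}"
          using st product_free_subset[OF T(1)] gen by auto
        then show thesis using that by auto
      qed
      then have r: "a \<le> i" "i \<le> 2 * a - 1" "a \<le> j" "j \<le> 2 * a - 1" using rng st by auto
      have "?P (i + j) = ?P (a - 1)" using e ij add by simp
      from eq[OF this] show False using r a modm[of "i + j"] modm[of "a - 1"] by linarith
    qed
    moreover have "?P (a - 1) \<notin> T"
    proof
      assume "?P (a - 1) \<in> T"
      moreover have "a - 1 < m" using a by linarith
      ultimately have "a \<le> a - 1" using rng by blast
      then show False using a by linarith
    qed
    ultimately show ?thesis by blast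
  qed
  moreover have "?P (a - 1) \<noteq> \<one>" using eq[of "a - 1" 0] a by auto
  ultimately show ?thesis using not_filledI[OF fin, of S "?P (a - 1)"] x by blast
qed

section \<open>Dihedral groups with many rotations\<close>

lemma int_mod_cases:
  fixes x m :: int
  assumes "- m \<le> x" "x < 2 * m"
  shows "x mod m = x \<and> 0 \<le> x \<and> x < m \<or> x mod m = x - m \<and> m \<le> x \<or> x mod m = x + m \<and> x < 0"
proof -
  consider "x < 0" | "0 \<le> x" "x < m" | "m \<le> x" by linarith
  then show ?thesis
  proof cases
    case 1 then show ?thesis using assms mod_add_self2[of x m] mod_pos_pos_trivial[of "x + m" m] by simp
  next
    case 2 then show ?thesis by simp
  next
    case 3 then show ?thesis using assms mod_pos_geq[of m x] mod_pos_pos_trivial[of "x - m" m] by simp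
  qed
qed

lemma carrier_dihedral: "(i, b) \<in> carrier (dihedral_group m) \<longleftrightarrow> 0 \<le> i \<and> i < int m"
  by (auto simp: dihedral_group_def)

lemma mult_dihedral:
  "(i, a) \<otimes>\<^bsub>dihedral_group m\<^esub> (j, b) = ((if a then i - j else i + j) mod int m, a \<noteq> b)"
  by (simp add: dihedral_group_def)

lemma one_dihedral: "\<one>\<^bsub>dihedral_group m\<^esub> = (0, False)"
  by (simp add: dihedral_group_def)

text \<open>The witness has the rotations in the interval from \<open>a\<close> to \<open>2 a - 1\<close> and two blocks of reflections
  at a distance chosen so that every further reflection is blocked, while no two of the
  reflections differ by \<open>a - 1\<close>. One of the rotations \<open>a - 1\<close> and \<open>1 - a\<close> is then missed.\<close>

lemma dihedral_group_not_filled: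
  fixes a w :: int
  assumes a: "2 \<le> a" and w: "0 \<le> w" "w \<le> a - 2" "4 * a + w \<le> int m" "int m \<le> 5 * a + w - 2"
  shows "\<not> filled (dihedral_group m)"
proof -
  define M where "M = int m"
  let ?D = "dihedral_group m"
  note w = w[folded M_def]
  note mult = mult_dihedral[where m = m, folded M_def]
  define R where "R = (\<lambda>i::int. a \<le> i \<and> i \<le> 2 * a - 1)"
  \<comment> \<open>Each block has at most a - 1 points, and points of different blocks are at least
    2 a apart in both directions around the circle. So quotients of two reflections avoid the
    residues from a - 1 to 2 a - 1 and their negatives.\<close>
  define B where "B = (\<lambda>i::int. 0 \<le> i \<and> i \<le> w \<or> 2 * a + w \<le> i \<and> i \<le> M - 2 * a)"
  define S where "S = {(i, b). if b then B i else R i}"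
  \<comment> \<open>If M > 5 a - 2, rotations from 4 a - 1 to M - a may survive in an extension, and
    the sum of 2 a - 1 and M - a is a - 1 modulo M. In that case the inverse rotation M - a + 1 is
    the missed one; otherwise that range is empty and a - 1 is missed.\<close>
  define r where "r = (if M \<le> 5 * a - 2 then a - 1 else M - a + 1)"
  have carr: "(i, b) \<in> carrier ?D \<longleftrightarrow> 0 \<le> i \<and> i < M" for i b by (simp add: carrier_dihedral M_def)
  have Rr: "0 \<le> i \<and> i < M" if "R i" for i using that a w by (auto simp: R_def)
  have Br: "0 \<le> i \<and> i < M" if "B i" for i using that a w by (auto simp: B_def)
  have pf: "product_free ?D S"
    unfolding product_free_iff
  proof (intro conjI ballI)
    have "(a, False) \<in> S" using a by (simp add: S_def R_def)
    then show "S \<noteq> {}" by blast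
    show "S \<subseteq> carrier ?D" using Rr Br by (auto simp: S_def carr split: if_splits)
    fix s t assume st: "s \<in> S" "t \<in> S"
    obtain i b j c where ij: "s = (i, b)" "t = (j, c)" by (cases s; cases t)
    have rg: "0 \<le> i" "i < M" "0 \<le> j" "j < M" using st ij Rr Br by (auto simp: S_def split: if_splits)
    have mi: "(i - j) mod M = i - j \<and> 0 \<le> i - j \<and> i - j < M \<or> (i - j) mod M = i - j + M \<and> i - j < 0"
      using int_mod_cases[of M "i - j"] rg by linarith
    have pl: "(i + j) mod M = i + j \<and> i + j < M \<or> (i + j) mod M = i + j - M \<and> M \<le> i + j"
      using int_mod_cases[of M "i + j"] rg by linarith
    show "s \<otimes>\<^bsub>?D\<^esub> t \<notin> S"
    proof (cases b; cases c)
      assume bc: "b" "c"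
      then have "B i" "B j" using st ij by (auto simp: S_def)
      then have "\<not> R ((i - j) mod M)"
        using mi w a unfolding R_def B_def by (elim disjE conjE; linarith)
      then show ?thesis using ij bc by (simp add: mult S_def)
    next
      assume bc: "\<not> b" "\<not> c"
      then have "R i" "R j" using st ij by (auto simp: S_def)
      then have "\<not> R ((i + j) mod M)"
        using pl w a unfolding R_def B_def by (elim disjE conjE; linarith)
      then show ?thesis using ij bc by (simp add: mult S_def)
    next
      assume bc: "b" "\<not> c"
      then have "B i" "R j" using st ij by (auto simp: S_def)
      then have "\<not> B ((i - j) mod M)"
        using mi w a unfolding R_def B_def by (elim disjE conjE; linarith)
      then show ?thesis using ij bc by (simp add: mult S_def)
    next
      assume bc: "\<not> b" "c"
      then have "R i" "B j" using st ij by (auto simp: S_def)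
      then have "\<not> B ((i + j) mod M)"
        using pl w a unfolding R_def B_def by (elim disjE conjE; linarith)
      then show ?thesis using ij bc by (simp add: mult S_def)
    qed
  qed
  have key: "(r, False) \<notin> T \<and> (\<forall>s\<in>T. \<forall>t\<in>T. s \<otimes>\<^bsub>?D\<^esub> t \<noteq> (r, False))"
    if T: "product_free ?D T" "S \<subseteq> T" for T
  proof -
    have no: "\<And>s t. s \<in> T \<Longrightarrow> t \<in> T \<Longrightarrow> s \<otimes>\<^bsub>?D\<^esub> t \<notin> T" using T(1) by (rule product_free_mult)
    have RT: "(i, False) \<in> T" if "R i" for i using that T(2) by (auto simp: S_def)
    have BT: "(i, True) \<in> T" if "B i" for i using that T(2) by (auto simp: S_def)
    have rg: "0 \<le> i \<and> i < M" if "(i, b) \<in> T" for i b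
      using that T(1) carr unfolding product_free_iff by blast
    have Trot: "R i \<or> 4 * a - 1 \<le> i \<and> i \<le> M - a" if i: "(i, False) \<in> T" for i
    proof (rule ccontr)
      assume n: "\<not> ?thesis"
      have ir: "0 \<le> i" "i < M" using rg i by auto
      consider "i < a" | "M - a < i" | "2 * a \<le> i" "i \<le> 4 * a - 2" using n unfolding R_def by linarith
      then show False
      proof cases
        case 1
        then have "R (i + a)" "R a" "(i + a) mod M = i + a" using ir a w by (auto simp: R_def)
        then show False using no[OF i RT[of a]] RT[of "i + a"] by (simp add: mult)
      next
        case 2
        then have "R (i + (2 * a - 1) - M)" "R (2 * a - 1)" using ir a by (auto simp: R_def)
        moreover have "(i + (2 * a - 1)) mod M = i + (2 * a - 1) - M"
          using int_mod_cases[of M "i + (2 * a - 1)"] ir 2 a w by linarith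
        ultimately show False using no[OF i RT[of "2 * a - 1"]] RT by (simp add: mult)
      next
        case 3
        define u v where "u = i div 2" and "v = i - i div 2"
        have "R u" "R v" "(u + v) mod M = i" using 3 ir unfolding u_def v_def R_def by auto
        then show False using no[OF RT[of u] RT[of v]] i by (simp add: mult)
      qed
    qed
    have Tref: "B i" if i: "(i, True) \<in> T" for i
    proof (rule ccontr)
      assume n: "\<not> B i"
      have ir: "0 \<le> i" "i < M" using rg i by auto
      \<comment> \<open>It suffices to find a block point \<open>b\<close> whose distance from
        \<open>i\<close>, in one of the two directions, lies between a and 2 a - 1. In each case
        below \<open>b\<close> is the point at distance a or 2 a - 1, clamped to the end of a block
        if it falls outside.\<close>
      have plus: False if "B b" "R c" "(b - i) mod M = c \<or> (i - b) mod M = c" for b c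
        using that no[OF BT[of b] i] no[OF i BT[of b]] RT[of c] by (auto simp: mult)
      define h where "h = 2 * a + w"
      define k where "k = M - 2 * a"
      have hk: "B 0" "B w" "B h" "B k" "h \<le> k" using w a by (auto simp: B_def h_def k_def)
      have Bmid: "B b" if "h \<le> b" "b \<le> k" for b using that by (auto simp: B_def h_def k_def)
      have Blow: "B b" if "0 \<le> b" "b \<le> w" for b using that by (auto simp: B_def)
      consider (1) "w < i" "i < h" | (2) "k < i" using n ir unfolding B_def h_def k_def by linarith
      then show False
      proof cases
        case 1
        show False
        proof (cases "i \<le> w + 2 * a - 1 \<and> a \<le> i")
          case True
          define b where "b = max 0 (i - (2 * a - 1))"
          have "B b" using True w by (intro Blow) (auto simp: b_def)
          moreover have "R (i - b)" using True a by (auto simp: b_def R_def)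
          moreover have "(i - b) mod M = i - b" using True ir a by (simp add: b_def max_def)
          ultimately show False using plus by blast
        next
          case False
          then have ia: "i < a" using 1 by (auto simp: h_def)
          define b where "b = max h (i + a)"
          have "B b" using ia 1 a w by (intro Bmid) (auto simp: b_def h_def k_def)
          moreover have "R (b - i)" using ia 1 a by (auto simp: b_def R_def h_def)
          moreover have "(b - i) mod M = b - i" using ir ia 1 a w by (auto simp: b_def h_def)
          ultimately show False using plus by blast
        qed
      next
        case 2
        show False
        proof (cases "i \<le> M - a + w")
          case True
          define b where "b = max 0 (i + a - M)"
          have "B b" using True w by (intro Blow) (auto simp: b_def)
          moreover have "R (b - i + M)" using True 2 a w by (auto simp: b_def R_def k_def)
          moreover have "(b - i) mod M = b - i + M"
          proof -
            have "b - i < 0" "- M \<le> b - i" using True ir 2 a w by (auto simp: b_def k_def)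
            then show ?thesis using int_mod_cases[of M "b - i"] a w by linarith
          qed
          ultimately show False using plus by blast
        next
          case False
          define b where "b = min k (i - a)"
          have "B b" using False w a 2 by (intro Bmid) (auto simp: b_def h_def k_def)
          moreover have "R (i - b)" using False 2 ir a by (auto simp: b_def R_def k_def)
          moreover have "(i - b) mod M = i - b"
            using False ir 2 a w by (intro mod_pos_pos_trivial) (auto simp: b_def k_def)
          ultimately show False using plus by blast
        qed
      qed
    qed
    have rv: "M \<le> 5 * a - 2 \<and> r = a - 1 \<or> 5 * a - 2 < M \<and> r = M - a + 1"
      by (simp add: r_def)
    have rr: "\<not> (R r \<or> 4 * a - 1 \<le> r \<and> r \<le> M - a)" using a w by (auto simp: r_def R_def)
    have "s \<otimes>\<^bsub>?D\<^esub> t \<noteq> (r, False)" if st: "s \<in> T" "t \<in> T" for s t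
    proof
      assume e: "s \<otimes>\<^bsub>?D\<^esub> t = (r, False)"
      obtain i b j c where ij: "s = (i, b)" "t = (j, c)" by (cases s; cases t)
      have rgs: "0 \<le> i" "i < M" "0 \<le> j" "j < M" using rg st ij by auto
      have bc: "b = c" using e ij by (simp add: mult)
      show False
      proof (cases b)
        case True
        then have "(i - j) mod M = r" and "B i" "B j" using e ij bc st Tref by (auto simp: mult)
        moreover have "(i - j) mod M = i - j \<or> (i - j) mod M = i - j + M"
          using int_mod_cases[of M "i - j"] rgs by linarith
        ultimately have "i - j = r \<or> i - j + M = r" by auto
        with rv \<open>B i\<close> \<open>B j\<close> show False
          using a w unfolding B_def by (elim disjE conjE; linarith)
      next
        case False
        then have "(i + j) mod M = r" and ri: "R i \<or> 4 * a - 1 \<le> i \<and> i \<le> M - a"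
          and rj: "R j \<or> 4 * a - 1 \<le> j \<and> j \<le> M - a"
          using e ij bc st Trot by (auto simp: mult)
        then have "i + j = r \<or> i + j = r + M" using int_mod_cases[of M "i + j"] rgs by linarith
        with rv ri rj show False
          using a w unfolding R_def by (elim disjE conjE; linarith)
      qed
    qed
    with rr Trot show ?thesis by blast
  qed
  have "finite (carrier ?D)" by (simp add: dihedral_group_def)
  then show ?thesis
  proof (rule not_filledI[OF _ pf])
    show "(r, False) \<in> carrier ?D" "(r, False) \<noteq> \<one>\<^bsub>?D\<^esub>"
      using a w by (auto simp: carr one_dihedral r_def)
  qed (rule key)
qed

section \<open>Extensions of the dihedral groups of order 14, 22 and 10\<close>

lemma carrier_dihedral_list:
  "carrier (dihedral_group m) = set (map (\<lambda>i. (int i, False)) [0..<m] @ map (\<lambda>i. (int i, True)) [0..<m])"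
proof -
  have "{0..<int m} = int ` {..<m}" by (simp add: image_int_atLeastLessThan lessThan_atLeast0)
  then show ?thesis by (auto simp: dihedral_group_def UNIV_bool image_iff)
qed

text \<open>The perturbed rotation is c = 4, with 4 + 4 = 1 modulo 7. The inverse 6 of the damaged
  rotation 1 is kept in \<Sigma>, and so are two reflections with quotients 0, 2 and 5; these,
  together with the intact fibres, block all remaining elements, for instance 3 as 4 + 6.\<close>

lemma dihedral_7_extension_not_filled:
  assumes "group_hom G (dihedral_group 7) h" "finite (carrier G)"
    and "h ` carrier G = carrier (dihedral_group 7)"
    and "z \<in> carrier G" "z \<noteq> \<one>\<^bsub>G\<^esub>" "h z = \<one>\<^bsub>dihedral_group 7\<^esub>"
  shows "\<not> filled G"
proof -
  interpret group_hom G "dihedral_group 7" h by fact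
  let ?\<Sigma> = "{(1, False), (6, False), (0, True), (2, True)} :: (int \<times> bool) set"
  have "(4, False) \<in> h ` carrier G" using assms(3) by (simp add: carrier_dihedral)
  then obtain y where y: "y \<in> carrier G" "h y = (4, False)" by (metis imageE)
  show ?thesis
  proof (rule perturbed_preimage_not_filled[OF assms(2,3) y assms(4-6), of ?\<Sigma>])
    fix k assume "k \<in> carrier (dihedral_group 7) - insert (4, False) ?\<Sigma>"
    then have "k \<in> {(0, False), (2, False), (3, False), (5, False), (1, True), (3, True), (4, True), (5, True), (6, True)}"
      by (auto simp: carrier_dihedral_list upt_rec)
    then show "\<exists>a \<in> ?\<Sigma> - {(4, False) \<otimes>\<^bsub>dihedral_group 7\<^esub> (4, False)}. \<exists>b \<in> insert (4, False) ?\<Sigma>.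
        k = a \<otimes>\<^bsub>dihedral_group 7\<^esub> b \<or> k = b \<otimes>\<^bsub>dihedral_group 7\<^esub> a \<or>
        k \<otimes>\<^bsub>dihedral_group 7\<^esub> b = a \<or> b \<otimes>\<^bsub>dihedral_group 7\<^esub> k = a \<or>
        k \<otimes>\<^bsub>dihedral_group 7\<^esub> a = b \<or> a \<otimes>\<^bsub>dihedral_group 7\<^esub> k = b"
      by (elim insertE emptyE) (simp_all add: mult_dihedral)
  qed (auto simp: mult_dihedral carrier_dihedral)
qed

text \<open>Same pattern with c = 7, where 7 + 7 = 3 modulo 11: the rotations 3 and -3 and three
  consecutive reflections, whose quotients are 0, 1, 2 and their negatives. The remaining rotations
  4, 5 and 6 are blocked through 8, as 7 + 8, 8 + 8 and 3 - 8.\<close>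

lemma dihedral_11_extension_not_filled:
  assumes "group_hom G (dihedral_group 11) h" "finite (carrier G)"
    and "h ` carrier G = carrier (dihedral_group 11)"
    and "z \<in> carrier G" "z \<noteq> \<one>\<^bsub>G\<^esub>" "h z = \<one>\<^bsub>dihedral_group 11\<^esub>"
  shows "\<not> filled G"
proof -
  interpret group_hom G "dihedral_group 11" h by fact
  let ?\<Sigma> = "{(3, False), (8, False), (0, True), (1, True), (2, True)} :: (int \<times> bool) set"
  have "(7, False) \<in> h ` carrier G" using assms(3) by (simp add: carrier_dihedral)
  then obtain y where y: "y \<in> carrier G" "h y = (7, False)" by (metis imageE)
  show ?thesis
  proof (rule perturbed_preimage_not_filled[OF assms(2,3) y assms(4-6), of ?\<Sigma>])
    fix k assume "k \<in> carrier (dihedral_group 11) - insert (7, False) ?\<Sigma>"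
    then have "k \<in> {(0, False), (1, False), (2, False), (4, False), (5, False), (6, False), (9, False), (10, False),
        (3, True), (4, True), (5, True), (6, True), (7, True), (8, True), (9, True), (10, True)}"
      by (auto simp: carrier_dihedral_list upt_rec)
    then show "\<exists>a \<in> ?\<Sigma> - {(7, False) \<otimes>\<^bsub>dihedral_group 11\<^esub> (7, False)}. \<exists>b \<in> insert (7, False) ?\<Sigma>.
        k = a \<otimes>\<^bsub>dihedral_group 11\<^esub> b \<or> k = b \<otimes>\<^bsub>dihedral_group 11\<^esub> a \<or>
        k \<otimes>\<^bsub>dihedral_group 11\<^esub> b = a \<or> b \<otimes>\<^bsub>dihedral_group 11\<^esub> k = a \<or>
        k \<otimes>\<^bsub>dihedral_group 11\<^esub> a = b \<or> a \<otimes>\<^bsub>dihedral_group 11\<^esub> k = b"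
      by (elim insertE emptyE) (simp_all add: mult_dihedral)
  qed (auto simp: mult_dihedral carrier_dihedral)
qed

text \<open>Since \<open>y\<close> has order 5, its image c is a rotation. The set \<Sigma> can hold
  only one reflection: two distinct ones have as their two products a nontrivial rotation and its
  inverse, one of which is c or c^2.\<close>

lemma dihedral_5_extension_not_filled:
  assumes "group_hom G (dihedral_group 5) h" "finite (carrier G)"
    and "h ` carrier G = carrier (dihedral_group 5)"
    and "z \<in> carrier G" "z \<noteq> \<one>\<^bsub>G\<^esub>" "h z = \<one>\<^bsub>dihedral_group 5\<^esub>"
    and y: "y \<in> carrier G" "y [^]\<^bsub>G\<^esub> (5::nat) = \<one>\<^bsub>G\<^esub>" "h y \<noteq> \<one>\<^bsub>dihedral_group 5\<^esub>"
  shows "\<not> filled G"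
proof -
  interpret group_hom G "dihedral_group 5" h by fact
  obtain i b where ib: "h y = (i, b)" by (cases "h y")
  have r: "0 \<le> i" "i < 5" using hom_closed[OF y(1)] ib by (auto simp: carrier_dihedral)
  have h5: "h y [^]\<^bsub>dihedral_group 5\<^esub> (5::nat) = \<one>\<^bsub>dihedral_group 5\<^esub>" using y hom_nat_pow[of y 5] by simp
  have c: "h y \<in> carrier (dihedral_group 5)" using y by simp
  have "\<not> b"
  proof
    assume b
    then have "h y \<otimes>\<^bsub>dihedral_group 5\<^esub> h y = \<one>\<^bsub>dihedral_group 5\<^esub>"
      using ib by (simp add: mult_dihedral one_dihedral)
    then have "h y [^]\<^bsub>dihedral_group 5\<^esub> (2::nat) = \<one>\<^bsub>dihedral_group 5\<^esub>"
      using c by (simp add: numeral_2_eq_2)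
    then show False using H.pow_5_cases[OF c h5 y(3)] by simp
  qed
  with ib y(3) r have i: "h y = (i, False)" "i \<in> {1, 2, 3, 4}" by (auto simp: one_dihedral)
  have pow: "(i, False) [^]\<^bsub>dihedral_group 5\<^esub> (n::nat) = (i * int n mod 5, False)" for n
    by (induction n) (auto simp: one_dihedral mult_dihedral mod_simps algebra_simps)
  show ?thesis
  proof (rule quotient_5_not_filled[OF assms(2,3) y(1,2) i(1) _ assms(4-6), of "{(0, True)}"])
    show "(i, False) \<noteq> \<one>\<^bsub>dihedral_group 5\<^esub>" using i by (auto simp: one_dihedral)
    fix k assume "k \<in> carrier (dihedral_group 5)"
    then have "k \<in> {(0, False), (1, False), (2, False), (3, False), (4, False)} \<or>
       k \<in> {(0, True), (1, True), (2, True), (3, True), (4, True)}"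
      by (auto simp: carrier_dihedral_list upt_rec)
    then show "(\<exists>n<5. k = (i, False) [^]\<^bsub>dihedral_group 5\<^esub> (n::nat)) \<or> k \<in> {(0, True)} \<or>
      (\<exists>a\<in>{(0, True)}. \<exists>n\<in>{1,2::nat}. k = (i, False) [^]\<^bsub>dihedral_group 5\<^esub> n \<otimes>\<^bsub>dihedral_group 5\<^esub> a \<or>
        k = a \<otimes>\<^bsub>dihedral_group 5\<^esub> (i, False) [^]\<^bsub>dihedral_group 5\<^esub> n)"
    proof
      assume k: "k \<in> {(0, False), (1, False), (2, False), (3, False), (4, False)}"
      have "\<exists>n\<in>{0,1,2,3,4::nat}. k = (i * int n mod 5, False)"
        using k i(2) by (elim insertE emptyE) simp_all
      then obtain n :: nat where "n \<in> {0,1,2,3,4}" "k = (i, False) [^]\<^bsub>dihedral_group 5\<^esub> n"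
        unfolding pow by blast
      moreover from this(1) have "n < 5" by auto
      ultimately show ?thesis by blast
    next
      assume k: "k \<in> {(0, True), (1, True), (2, True), (3, True), (4, True)}"
      show ?thesis unfolding pow
        using k i(2) by (elim insertE emptyE) (simp_all add: mult_dihedral)
    qed
  qed (auto simp: pow carrier_dihedral mult_dihedral one_dihedral)
qed

section \<open>Groups of order $2^n p$\<close>

lemma group_action_restrictI:
  assumes "group G"
    and cl: "\<And>g x. g \<in> carrier G \<Longrightarrow> x \<in> E \<Longrightarrow> f g x \<in> E"
    and one: "\<And>x. x \<in> E \<Longrightarrow> f \<one>\<^bsub>G\<^esub> x = x"
    and mult: "\<And>g k x. g \<in> carrier G \<Longrightarrow> k \<in> carrier G \<Longrightarrow> x \<in> E \<Longrightarrow> f (g \<otimes>\<^bsub>G\<^esub> k) x = f g (f k x)"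
  shows "group_action G E (\<lambda>g. \<lambda>x\<in>E. f g x)"
proof -
  interpret group G by fact
  have inv: "f (inv\<^bsub>G\<^esub> g) (f g x) = x" "f g (f (inv\<^bsub>G\<^esub> g) x) = x" if "g \<in> carrier G" "x \<in> E" for g x
    using mult[of "inv\<^bsub>G\<^esub> g" g x] mult[of g "inv\<^bsub>G\<^esub> g" x] one that by auto
  \<comment> \<open>Members of \<open>Bij E\<close> are extensional, hence the restriction to
    \<open>E\<close> in the statement.\<close>
  have "(\<lambda>x\<in>E. f g x) \<in> Bij E" if g: "g \<in> carrier G" for g
  proof -
    have "bij_betw (f g) E E"
      by (rule bij_betw_byWitness[of _ "f (inv\<^bsub>G\<^esub> g)"]) (use inv cl g in auto)
    then show ?thesis unfolding Bij_def by (simp cong: bij_betw_cong)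
  qed
  moreover have "(\<lambda>x\<in>E. f (g \<otimes>\<^bsub>G\<^esub> k) x) = compose E (\<lambda>x\<in>E. f g x) (\<lambda>x\<in>E. f k x)"
    if "g \<in> carrier G" "k \<in> carrier G" for g k
    unfolding compose_def using cl mult that by fastforce
  ultimately have "(\<lambda>g. \<lambda>x\<in>E. f g x) \<in> hom G (BijGroup E)"
    by (auto simp: hom_def BijGroup_def)
  then show ?thesis
    unfolding group_action_def group_hom_def group_hom_axioms_def
    using group_BijGroup is_group by blast
qed

text \<open>Orbit sizes are powers of 2, so the orbits of odd size are the fixed points; the orbits
  collected in \<open>C\<close> make up the rest and contribute an even number.\<close>

lemma (in group_action) even_card_iff_even_fixed_points:
  assumes order: "order G = 2 ^ k" and fin: "finite E"
  shows "even (card E) \<longleftrightarrow> even (card {x \<in> E. \<forall>g\<in>carrier G. \<phi> g x = x})"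
proof -
  interpret group G using group_hom by (simp add: group_hom_def)
  define F where "F = {x \<in> E. \<forall>g\<in>carrier G. \<phi> g x = x}"
  define C where "C = {U \<in> orbits G E \<phi>. even (card U)}"
  have UE: "\<Union> C \<subseteq> E" using orbits_coverture unfolding C_def by blast
  have orb: "x \<in> orbit G \<phi> x" if "x \<in> E" for x using orbit_refl that by blast
  have "\<Union> C = E - F"
  proof (intro equalityI subsetI)
    fix x assume "x \<in> \<Union> C"
    then obtain U where U: "x \<in> U" "U \<in> orbits G E \<phi>" "even (card U)" by (auto simp: C_def)
    have xE: "x \<in> E" using UE \<open>x \<in> \<Union> C\<close> by blast
    have "U = orbit G \<phi> x"
      using disjoint_union[OF U(2), of "orbit G \<phi> x"] orb[OF xE] U xE unfolding orbits_def by blast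
    moreover have "orbit G \<phi> x = {x}" if "x \<in> F" using that one_closed unfolding orbit_def F_def by (auto intro!: exI[of _ \<one>])
    ultimately show "x \<in> E - F" using xE U by auto
  next
    fix x assume x: "x \<in> E - F"
    then have xE: "x \<in> E" by blast
    obtain g where g: "g \<in> carrier G" "\<phi> g x \<noteq> x" using x unfolding F_def by blast
    then have gx: "\<phi> g x \<in> orbit G \<phi> x" unfolding orbit_def by blast
    have XO: "orbit G \<phi> x \<in> orbits G E \<phi>" using xE unfolding orbits_def by blast
    then have f: "finite (orbit G \<phi> x)" using orbits_coverture fin by (metis Union_upper finite_subset)
    have "card (orbit G \<phi> x) dvd 2 ^ k"
      using orbit_stabilizer_theorem[OF xE] order by (metis dvd_triv_left)
    then obtain j where j: "card (orbit G \<phi> x) = 2 ^ j" by (auto simp: divides_primepow_nat)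
    have "j \<noteq> 0"
    proof
      assume "j = 0"
      then obtain u where "orbit G \<phi> x = {u}" using j by (auto simp: card_1_singleton_iff)
      then show False using gx orb[OF xE] g(2) by auto
    qed
    then have "even (card (orbit G \<phi> x))" using j by simp
    then show "x \<in> \<Union> C" using XO orb[OF xE] unfolding C_def by blast
  qed
  moreover have "2 dvd card (\<Union> C)"
  proof (rule dvd_partition)
    show "finite (\<Union> C)" using UE fin finite_subset by blast
    show "\<forall>c1\<in>C. \<forall>c2\<in>C. c1 \<noteq> c2 \<longrightarrow> c1 \<inter> c2 = {}" using disjoint_union unfolding C_def by blast
  qed (simp add: C_def)
  ultimately have "even (card (E - F))" by simp
  moreover have "card E = card (E - F) + card F"
    using fin card_Diff_subset[of F E] card_mono[of E F] finite_subset[of F E] by (simp add: F_def)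
  ultimately show ?thesis unfolding F_def by simp
qed

text \<open>The inverse turns multiplication of cosets from the right into a left action.\<close>

lemma (in group) rcosets_action:
  assumes H: "subgroup H G" and R: "subgroup R G"
  shows "group_action (G\<lparr>carrier := R\<rparr>) (rcosets H) (\<lambda>g. \<lambda>U\<in>rcosets H. U #> (inv g))"
proof (rule group_action_restrictI)
  have HG: "H \<subseteq> carrier G" using H by (rule subgroup.subset)
  have RG: "R \<subseteq> carrier G" using R by (rule subgroup.subset)
  show "group (G\<lparr>carrier := R\<rparr>)" using R by (rule subgroup_imp_group)
  have XG: "U \<subseteq> carrier G" if "U \<in> rcosets H" for U using that rcosets_subset_PowG[OF H] by blast
  fix U assume U: "U \<in> rcosets H"
  show "U #> (inv \<one>\<^bsub>G\<lparr>carrier := R\<rparr>\<^esub>) = U" using XG[OF U] by simp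
  fix g assume g: "g \<in> carrier (G\<lparr>carrier := R\<rparr>)"
  then have gG: "g \<in> carrier G" using RG by auto
  obtain a where a: "a \<in> carrier G" "U = H #> a" using U by (auto simp: RCOSETS_def)
  have "U #> (inv g) = H #> (a \<otimes> inv g)" using a gG HG by (simp add: coset_mult_assoc)
  then show "U #> (inv g) \<in> rcosets H" using a gG HG rcosetsI by simp
  fix k assume k: "k \<in> carrier (G\<lparr>carrier := R\<rparr>)"
  then have kG: "k \<in> carrier G" using RG by auto
  show "U #> (inv (g \<otimes>\<^bsub>G\<lparr>carrier := R\<rparr>\<^esub> k)) = U #> (inv k) #> (inv g)"
    using XG[OF U] gG kG by (simp add: inv_mult_group coset_mult_assoc)
qed

lemma (in group) even_fixed_rcosets:
  assumes fin: "finite (carrier G)" and H: "subgroup H G" and R: "subgroup R G" "card R = 2 ^ k"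
  shows "even (card (rcosets H)) \<longleftrightarrow>
    even (card {U \<in> (rcosets H). \<forall>g\<in>R. U #> g = U})"
proof -
  interpret group_action "G\<lparr>carrier := R\<rparr>" "rcosets H" "\<lambda>g. \<lambda>U\<in>rcosets H. U #> (inv g)"
    by (rule rcosets_action[OF H R(1)])
  have "finite (rcosets H)" using fin by (simp add: RCOSETS_def)
  moreover have "order (G\<lparr>carrier := R\<rparr>) = 2 ^ k" using R by (simp add: order_def)
  ultimately have "even (card (rcosets H)) \<longleftrightarrow> even (card {U \<in> rcosets H.
      \<forall>g\<in>carrier (G\<lparr>carrier := R\<rparr>). (\<lambda>U\<in>rcosets H. U #> (inv g)) U = U})"
    by (rule even_card_iff_even_fixed_points[rotated])
  also have "{U \<in> (rcosets H). \<forall>g\<in>carrier (G\<lparr>carrier := R\<rparr>). (\<lambda>U\<in>rcosets H. U #> (inv g)) U = U} =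
      {U \<in> (rcosets H). \<forall>g\<in>R. U #> g = U}"
  proof -
    have RG: "R \<subseteq> carrier G" using R(1) by (rule subgroup.subset)
    have "(\<forall>g\<in>R. U #> (inv g) = U) \<longleftrightarrow> (\<forall>g\<in>R. U #> g = U)" for U
      using subgroup.m_inv_closed[OF R(1)] RG by (metis inv_inv subsetD)
    then show ?thesis by auto
  qed
  finally show ?thesis .
qed

text \<open>The number of cosets of \<open>H\<close> is odd, so \<open>R\<close> fixes one of them,
  and that \<open>H #> g\<close> is fixed by \<open>R\<close> means that \<open>g\<close> conjugates
  \<open>R\<close> into \<open>H\<close>.\<close>

lemma (in group) two_subgroup_conjugate:
  assumes fin: "finite (carrier G)" and H: "subgroup H G" "order G = card H * m" "odd m"
    and R: "subgroup R G" "card R = 2 ^ k"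
  obtains g where "g \<in> carrier G" "\<And>r. r \<in> R \<Longrightarrow> g \<otimes> r \<otimes> inv g \<in> H"
proof -
  have HG: "H \<subseteq> carrier G" using H by (simp add: subgroup.subset)
  have "card (rcosets H) * card H = order G" using lagrange H by simp
  moreover have "card H \<noteq> 0" using H(1) fin subgroup.finite_imp_card_positive by fastforce
  ultimately have "card (rcosets H) = m" using H(2) by simp
  then have "odd (card {U \<in> (rcosets H). \<forall>g\<in>R. U #> g = U})"
    using even_fixed_rcosets[OF fin H(1) R] H(3) by simp
  then obtain U where U: "U \<in> rcosets H" "\<forall>g\<in>R. U #> g = U"
    using odd_card_imp_not_empty by fastforce
  then obtain g where g: "g \<in> carrier G" "U = H #> g" by (auto simp: RCOSETS_def)
  have "g \<otimes> r \<otimes> inv g \<in> H" if r: "r \<in> R" for r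
  proof -
    have rG: "r \<in> carrier G" using r R(1) subgroup.mem_carrier by fast
    have "g \<otimes> r \<in> H #> g"
      using U(2) r g rcos_self[OF g(1) H(1)] rG HG unfolding r_coset_def by blast
    then obtain h where "h \<in> H" "g \<otimes> r = h \<otimes> g" unfolding r_coset_def by blast
    then show ?thesis using g rG HG by (metis inv_solve_right' m_closed subsetD)
  qed
  with g(1) show thesis using that by blast
qed

text \<open>Let \<open>D\<close> act on its own cosets in \<open>Q\<close>, an even number. The
  coset \<open>D\<close> is fixed, so a second coset \<open>D #> g\<close> is fixed as well, and
  then \<open>g\<close> normalizes \<open>D\<close>.\<close>

lemma (in group) two_subgroup_normalizer_grows:
  assumes fin: "finite (carrier G)" and Q: "subgroup Q G" "card Q = 2 ^ k" and D: "subgroup D G" "D \<subset> Q"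
  obtains g where "g \<in> Q" "g \<notin> D" "\<And>d. d \<in> D \<Longrightarrow> g \<otimes> d \<otimes> inv g \<in> D"
proof -
  let ?Q = "G\<lparr>carrier := Q\<rparr>"
  interpret Q: group ?Q using Q(1) by (rule subgroup_imp_group)
  have QG: "Q \<subseteq> carrier G" using Q(1) by (rule subgroup.subset)
  have finQ: "finite Q" using fin QG finite_subset by blast
  have DQ: "subgroup D ?Q" using subgroup_incl[OF D(1) Q(1)] D(2) by blast
  have oQ: "order ?Q = 2 ^ k" using Q by (simp add: order_def)
  have lag: "card (rcosets\<^bsub>?Q\<^esub> D) * card D = 2 ^ k" using Q.lagrange[OF DQ] oQ by simp
  have cD: "card D < 2 ^ k" using psubset_card_mono[OF finQ D(2)] Q by simp
  have "card (rcosets\<^bsub>?Q\<^esub> D) dvd 2 ^ k" using lag by (metis dvd_triv_left)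
  then obtain j where j: "card (rcosets\<^bsub>?Q\<^esub> D) = 2 ^ j" by (auto simp: divides_primepow_nat)
  have "card D dvd 2 ^ k" using lag by (metis dvd_triv_right)
  then obtain i where i: "card D = 2 ^ i" by (auto simp: divides_primepow_nat)
  have "j \<noteq> 0" using lag cD j by (cases j) auto
  then have "even (card (rcosets\<^bsub>?Q\<^esub> D))" using j by simp
  then have ev: "even (card {U \<in> (rcosets\<^bsub>?Q\<^esub> D). \<forall>g\<in>D. U #>\<^bsub>?Q\<^esub> g = U})"
    using iffD1[OF Q.even_fixed_rcosets[OF _ DQ DQ i]] finQ by fastforce
  define E where "E = {U \<in> (rcosets\<^bsub>?Q\<^esub> D). \<forall>g\<in>D. U #>\<^bsub>?Q\<^esub> g = U}"
  have "D #> g = D" if "g \<in> D" for g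
    using that coset_join2[OF _ D(1)] subgroup.mem_carrier[OF D(1)] by blast
  then have DE: "D \<in> E" using subgroup.subgroup_in_rcosets[OF DQ Q.is_group] unfolding E_def by simp
  have "E \<noteq> {D}"
  proof
    assume "E = {D}"
    then have "card E = 1" by simp
    then show False using ev unfolding E_def by simp
  qed
  then obtain U where U: "U \<in> E" "U \<noteq> D" using DE by blast
  then obtain g where g: "g \<in> Q" "U = D #> g" unfolding E_def RCOSETS_def by auto
  have gG: "g \<in> carrier G" using g QG by blast
  have "g \<notin> D" using U(2) g(2) \<open>\<And>g. g \<in> D \<Longrightarrow> D #> g = D\<close> by blast
  moreover have "g \<otimes> d \<otimes> inv g \<in> D" if d: "d \<in> D" for d
  proof -
    have dG: "d \<in> carrier G" using d D(1) subgroup.mem_carrier by fast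
    have "g \<otimes> d \<in> (D #> g) #> d"
      using rcos_self[OF gG D(1)] unfolding r_coset_def by blast
    also have "\<dots> = D #> g" using U(1) d g(2) unfolding E_def by simp
    finally obtain e where "e \<in> D" "g \<otimes> d = e \<otimes> g" unfolding r_coset_def by blast
    then show ?thesis using gG dG D(1) by (metis inv_solve_right' m_closed subgroup.mem_carrier)
  qed
  ultimately show thesis using that g(1) by blast
qed

text \<open>The fixed points of conjugation are the centre, which therefore has even order. For a
  nontrivial central x, the last nontrivial term of x, x^2, x^4, ... is a central
  involution.\<close>

lemma (in group) two_group_central_involution:
  assumes order: "order G = 2 ^ k" and k: "k > 0"
  obtains z where "z \<in> carrier G" "z \<noteq> \<one>" "z \<otimes> z = \<one>" "\<And>g. g \<in> carrier G \<Longrightarrow> g \<otimes> z = z \<otimes> g"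
proof -
  have fin: "finite (carrier G)" using order order_gt_0_iff_finite by simp
  interpret A: group_action G "carrier G" "\<lambda>g. (\<lambda>h \<in> carrier G. g \<otimes> h \<otimes> inv g)"
    by (rule action_by_conjugation)
  define Z where "Z = {x \<in> carrier G. \<forall>g\<in>carrier G. (\<lambda>h \<in> carrier G. g \<otimes> h \<otimes> inv g) x = x}"
  have "even (card Z)"
    unfolding Z_def using A.even_card_iff_even_fixed_points[OF order fin] order k by (simp add: order_def)
  moreover have "\<one> \<in> Z" by (simp add: Z_def)
  ultimately have "Z \<noteq> {\<one>}" by auto
  then obtain x where x: "x \<in> Z" "x \<noteq> \<one>" using \<open>\<one> \<in> Z\<close> by blast
  have xG: "x \<in> carrier G" using x by (simp add: Z_def)
  have comm: "g \<otimes> x = x \<otimes> g" if g: "g \<in> carrier G" for g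
  proof -
    have "g \<otimes> x \<otimes> inv g = x" using x(1) g unfolding Z_def by auto
    then show ?thesis using inv_solve_right'[of x "g \<otimes> x" g] g xG by simp
  qed
  define P where "P = (\<lambda>j::nat. x [^] ((2::nat) ^ j) = \<one>)"
  have "P k" using pow_order_eq_1[OF xG] order by (simp add: P_def)
  define j where "j = (LEAST j. P j)"
  have Pj: "P j" unfolding j_def using \<open>P k\<close> by (rule LeastI)
  have "\<not> P 0" using x xG by (simp add: P_def)
  then obtain i where i: "j = Suc i" using Pj by (cases j) auto
  have ni: "\<not> P i" using i not_less_Least[of i P] j_def by simp
  define z where "z = x [^] ((2::nat) ^ i)"
  have "z \<otimes> z = \<one>" using Pj xG unfolding P_def z_def i by (simp add: nat_pow_mult mult_2)
  moreover have "g \<otimes> z = z \<otimes> g" if "g \<in> carrier G" for g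
    unfolding z_def using group_commutes_pow[OF comm[OF that, symmetric] xG that] by simp
  moreover have "z \<in> carrier G" "z \<noteq> \<one>" using ni xG unfolding P_def z_def by auto
  ultimately show thesis using that[of z] by blast
qed

lemma finite_max_witness:
  fixes f :: "'a \<Rightarrow> nat"
  assumes "finite S" "a \<in> S"
  obtains m where "m \<in> S" "\<And>q. q \<in> S \<Longrightarrow> f q \<le> f m"
proof -
  have "Max (f ` S) \<in> f ` S" using assms by (intro Max_in) auto
  then obtain m where "m \<in> S" "Max (f ` S) = f m" by blast
  then show thesis using that[of m] Max_ge[of "f ` S"] assms(1) by simp
qed

section \<open>Conjugates of subgroups and elements of prime order\<close>

definition conj_set :: "('a, 'b) monoid_scheme \<Rightarrow> 'a \<Rightarrow> 'a set \<Rightarrow> 'a set"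
  where "conj_set G g H = (\<lambda>h. g \<otimes>\<^bsub>G\<^esub> h \<otimes>\<^bsub>G\<^esub> inv\<^bsub>G\<^esub> g) ` H"

context group
begin

lemma inv_mult_cancel [simp]:
  assumes "a \<in> carrier G" "b \<in> carrier G"
  shows "inv a \<otimes> (a \<otimes> b) = b" "a \<otimes> (inv a \<otimes> b) = b"
  using assms by (simp_all add: m_assoc[symmetric])

lemma conj_mult:
  assumes "g \<in> carrier G" "a \<in> carrier G" "b \<in> carrier G"
  shows "g \<otimes> (a \<otimes> b) \<otimes> inv g = (g \<otimes> a \<otimes> inv g) \<otimes> (g \<otimes> b \<otimes> inv g)"
  using assms by (simp add: m_assoc)

lemma conj_conj:
  assumes "g \<in> carrier G" "k \<in> carrier G" "a \<in> carrier G"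
  shows "g \<otimes> (k \<otimes> a \<otimes> inv k) \<otimes> inv g = (g \<otimes> k) \<otimes> a \<otimes> inv (g \<otimes> k)"
  using assms by (simp add: m_assoc inv_mult_group)

lemma conj_set_mult:
  assumes "g \<in> carrier G" "k \<in> carrier G" "H \<subseteq> carrier G"
  shows "conj_set G g (conj_set G k H) = conj_set G (g \<otimes> k) H"
  unfolding conj_set_def image_image using assms conj_conj by (intro image_cong) auto

lemma conj_set_one: "H \<subseteq> carrier G \<Longrightarrow> conj_set G \<one> H = H"
  unfolding conj_set_def by (simp add: subset_iff)

lemma conj_set_carrier: "g \<in> carrier G \<Longrightarrow> H \<subseteq> carrier G \<Longrightarrow> conj_set G g H \<subseteq> carrier G"
  unfolding conj_set_def by auto

lemma card_conj_set: "g \<in> carrier G \<Longrightarrow> H \<subseteq> carrier G \<Longrightarrow> card (conj_set G g H) = card H"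
  unfolding conj_set_def by (intro card_image inj_onI) (simp add: subset_iff)

lemma mem_conj_set_iff:
  assumes "g \<in> carrier G" "H \<subseteq> carrier G" "a \<in> carrier G"
  shows "a \<in> conj_set G g H \<longleftrightarrow> inv g \<otimes> a \<otimes> g \<in> H"
proof
  assume "a \<in> conj_set G g H"
  then obtain h where h: "h \<in> H" "a = g \<otimes> h \<otimes> inv g" by (auto simp: conj_set_def)
  then have "h \<in> carrier G" using assms by blast
  then have "inv g \<otimes> a \<otimes> g = h" using h assms conj_conj[of "inv g" g h] by simp
  then show "inv g \<otimes> a \<otimes> g \<in> H" using h by simp
next
  assume "inv g \<otimes> a \<otimes> g \<in> H"
  moreover have "g \<otimes> (inv g \<otimes> a \<otimes> g) \<otimes> inv g = a"
    using assms conj_conj[of g "inv g" a] by simp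
  ultimately show "a \<in> conj_set G g H" unfolding conj_set_def by (metis image_eqI)
qed

lemma subgroup_conj_set:
  assumes g: "g \<in> carrier G" and H: "subgroup H G"
  shows "subgroup (conj_set G g H) G"
proof -
  have HG: "H \<subseteq> carrier G" using H by (rule subgroup.subset)
  show ?thesis
  proof (rule subgroupI)
    show "conj_set G g H \<subseteq> carrier G" using conj_set_carrier g HG by simp
    show "conj_set G g H \<noteq> {}" using subgroup.one_closed[OF H] by (auto simp: conj_set_def)
    fix a assume a: "a \<in> conj_set G g H"
    then obtain h where h: "h \<in> H" "a = g \<otimes> h \<otimes> inv g" by (auto simp: conj_set_def)
    then have hG: "h \<in> carrier G" using HG by blast
    have "inv a = g \<otimes> inv h \<otimes> inv g" using h hG g by (simp add: inv_mult_group m_assoc)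
    then show "inv a \<in> conj_set G g H" using subgroup.m_inv_closed[OF H] h by (auto simp: conj_set_def)
    fix b assume b: "b \<in> conj_set G g H"
    then obtain k where k: "k \<in> H" "b = g \<otimes> k \<otimes> inv g" by (auto simp: conj_set_def)
    then have kG: "k \<in> carrier G" using HG by blast
    have "a \<otimes> b = g \<otimes> (h \<otimes> k) \<otimes> inv g" using conj_mult[OF g hG kG] h k by simp
    then show "a \<otimes> b \<in> conj_set G g H" using subgroup.m_closed[OF H] h k by (auto simp: conj_set_def)
  qed
qed

lemma conj_set_self:
  assumes H: "subgroup H G" "finite H" and q: "q \<in> H"
  shows "conj_set G q H = H"
proof (rule card_subset_eq[OF H(2)])
  have HG: "H \<subseteq> carrier G" using H(1) by (rule subgroup.subset)
  show "conj_set G q H \<subseteq> H"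
    unfolding conj_set_def using subgroup.m_closed[OF H(1)] subgroup.m_inv_closed[OF H(1)] q by auto
  show "card (conj_set G q H) = card H" using card_conj_set q HG by blast
qed

lemma prime_pow_eq_one_iff:
  assumes "u \<in> carrier G" "u \<noteq> \<one>" "u [^] p = \<one>" "Factorial_Ring.prime (p::nat)"
  shows "u [^] (i::nat) = \<one> \<longleftrightarrow> p dvd i"
proof -
  have "ord u dvd p" using assms pow_eq_id by blast
  moreover have "ord u \<noteq> 1" using assms ord_eq_1 by blast
  ultimately have "ord u = p" using assms(4) prime_nat_iff by blast
  then show ?thesis using pow_eq_id[OF assms(1)] by blast
qed

lemma prime_pow_mem_subgroup:
  assumes fin: "finite (carrier G)" and u: "u \<in> carrier G" "u [^] p = \<one>" "Factorial_Ring.prime (p::nat)"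
    and H: "subgroup H G" "\<not> p dvd card H" and i: "u [^] (i::nat) \<in> H"
  shows "u [^] i = \<one>"
proof -
  let ?v = "u [^] i"
  have v: "?v \<in> carrier G" using u by simp
  interpret H: group "G\<lparr>carrier := H\<rparr>" using H(1) by (rule subgroup_imp_group)
  have "?v [^]\<^bsub>G\<lparr>carrier := H\<rparr>\<^esub> card H = \<one>"
    using H.pow_order_eq_1[of ?v] i by (simp add: order_def)
  then have "?v [^] card H = \<one>" using nat_pow_consistent by metis
  then have "ord ?v dvd card H" using pow_eq_id[OF v] by blast
  moreover have "?v [^] p = (u [^] p) [^] i" using u(1) by (simp add: nat_pow_pow mult.commute)
  then have "?v [^] p = \<one>" using u by simp
  then have "ord ?v dvd p" using pow_eq_id[OF v] by blast
  ultimately have "ord ?v = 1" using u(3) H(2) by (metis prime_nat_iff)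
  then show ?thesis using ord_eq_1[OF v] by simp
qed

text \<open>The powers of \<open>u\<close> meet \<open>H\<close> only in 1, so the products of the p
  powers of \<open>u\<close> with the elements of \<open>H\<close> are pairwise distinct, and there
  are \<open>order G\<close> of them.\<close>

lemma prime_power_complement:
  assumes ord: "order G = card H * p" and p: "Factorial_Ring.prime (p::nat)"
    and u: "u \<in> carrier G" "u \<noteq> \<one>" "u [^] p = \<one>"
    and H: "subgroup H G" "\<not> p dvd card H" and g: "g \<in> carrier G"
  obtains i q where "i < p" "q \<in> H" "g = u [^] (i::nat) \<otimes> q"
proof -
  have p0: "p > 0" using p by (simp add: prime_gt_0_nat)
  have HG: "H \<subseteq> carrier G" using H(1) by (rule subgroup.subset)
  have "card H > 0" using H(2) by (metis dvd_0_right gr0I)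
  then have fin: "finite (carrier G)" using ord p0 order_gt_0_iff_finite by simp
  let ?f = "\<lambda>(i::nat, q). u [^] i \<otimes> q"
  have aux: "i = j \<and> q = r" if "u [^] i \<otimes> q = u [^] j \<otimes> r" "j \<le> i" "i < p" "q \<in> H" "r \<in> H" for i j q r
  proof -
    have qr: "q \<in> carrier G" "r \<in> carrier G" using that HG by auto
    have "u [^] i = u [^] j \<otimes> u [^] (i - j)" using that u by (simp add: nat_pow_mult)
    then have "u [^] j \<otimes> (u [^] (i - j) \<otimes> q) = u [^] j \<otimes> r" using that(1) u qr by (simp add: m_assoc)
    then have e: "u [^] (i - j) \<otimes> q = r" using u qr by simp
    then have "u [^] (i - j) = r \<otimes> inv q" using u qr by (simp add: inv_solve_right)
    then have "u [^] (i - j) \<in> H" using that subgroup.m_closed[OF H(1)] subgroup.m_inv_closed[OF H(1)] by simp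
    then have 1: "u [^] (i - j) = \<one>" using prime_pow_mem_subgroup[OF fin u(1,3) p H] by blast
    then have "p dvd i - j" using prime_pow_eq_one_iff[OF u p] by blast
    then have "i = j" using that by (metis diff_is_0_eq dvd_imp_le le_antisym less_imp_diff_less linorder_not_le zero_less_iff_neq_zero)
    then show ?thesis using e 1 qr by simp
  qed
  have "inj_on ?f ({..<p} \<times> H)"
  proof (rule inj_onI)
    fix a b assume ab: "a \<in> {..<p} \<times> H" "b \<in> {..<p} \<times> H" "?f a = ?f b"
    obtain i q j r where e: "a = (i, q)" "b = (j, r)" by (cases a; cases b)
    show "a = b"
      using aux[of i q j r] aux[of j r i q] ab e by (cases "j \<le> i") auto
  qed
  then have "card (?f ` ({..<p} \<times> H)) = order G" using ord by (simp add: card_image card_cartesian_product)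
  moreover have "?f ` ({..<p} \<times> H) \<subseteq> carrier G" using u HG by auto
  ultimately have "?f ` ({..<p} \<times> H) = carrier G"
    using fin by (intro card_subset_eq) (auto simp: order_def)
  then have "g \<in> ?f ` ({..<p} \<times> H)" using g by simp
  then show thesis using that by auto
qed

lemma Cauchy_element:
  assumes "Factorial_Ring.prime (p::nat)" "p dvd order G" "finite (carrier G)"
  obtains u where "u \<in> carrier G" "u \<noteq> \<one>" "u [^] p = \<one>"
proof -
  obtain m where "order G = p ^ 1 * m" using assms by (auto simp: dvd_def)
  then obtain P where P: "subgroup P G" "card P = p ^ 1"
    using sylow_thm[OF assms(1) is_group _ assms(3)] by metis
  have "card P > 1" using P assms(1) prime_gt_1_nat by simp
  then obtain u where u: "u \<in> P" "u \<noteq> \<one>"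
  proof -
    have "\<not> P \<subseteq> {\<one>}" using \<open>card P > 1\<close> card_mono[of "{\<one>}" P] by auto
    then show thesis using that by blast
  qed
  interpret P: group "G\<lparr>carrier := P\<rparr>" using P(1) by (rule subgroup_imp_group)
  have "u [^]\<^bsub>G\<lparr>carrier := P\<rparr>\<^esub> p = \<one>"
    using P.pow_order_eq_1[of u] u P by (simp add: order_def)
  then have "u [^] p = \<one>" using nat_pow_consistent by metis
  then show thesis using that u P(1) subgroup.mem_carrier by metis
qed

end

section \<open>The core of a Sylow 2-subgroup\<close>

context group
begin

text \<open>Let \<open>N\<close> be the core of a Sylow 2-subgroup \<open>Q\<close>. An intersection \<open>D\<close> of two conjugates of \<open>Q\<close> of
  maximal size is \<open>N\<close>: since normalizers grow in 2-groups, the normalizer of \<open>D\<close> is not a 2-group,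
  and its elements of order \<open>p\<close> permute the conjugates of \<open>Q\<close> transitively. Hence any two
  conjugates meet in \<open>N\<close>.\<close>

lemma conjugates_inter_eq_core:
  assumes ord: "order G = 2 ^ n * p" and p: "Factorial_Ring.prime (p::nat)" "odd p"
    and Q: "subgroup Q G" "card Q = 2 ^ n"
    and CC: "CC = (\<lambda>g. conj_set G g Q) ` carrier G"
    and AB: "A \<in> CC" "B \<in> CC" "A \<noteq> B"
  shows "A \<inter> B = \<Inter> CC"
proof -
  have p0: "p > 0" using p by (simp add: prime_gt_0_nat)
  have fin: "finite (carrier G)" using ord p0 order_gt_0_iff_finite by simp
  have ndvd: "\<not> p dvd 2 ^ n" using p by (metis coprime_right_2_iff_odd primes_dvd_imp_eq prime_dvd_power two_is_prime_nat dvd_refl)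
  have QG: "Q \<subseteq> carrier G" using Q(1) by (rule subgroup.subset)
  have CCs: "subgroup E G" "card E = 2 ^ n" "E \<subseteq> carrier G" "finite E" if "E \<in> CC" for E
  proof -
    obtain g where g: "g \<in> carrier G" "E = conj_set G g Q" using \<open>E \<in> CC\<close> unfolding CC by (rule imageE)
    then show "subgroup E G" "card E = 2 ^ n" "E \<subseteq> carrier G"
      using subgroup_conj_set Q card_conj_set QG conj_set_carrier by auto
    then show "finite E" using fin finite_subset by blast
  qed
  have finCC: "finite CC" using CC fin by simp
  let ?PP = "{(E, F). E \<in> CC \<and> F \<in> CC \<and> E \<noteq> F}"
  have "finite ?PP" using finCC finite_subset[of ?PP "CC \<times> CC"] by auto
  moreover have "(A, B) \<in> ?PP" using AB by simp
  ultimately obtain m where m: "m \<in> ?PP" and mx: "\<And>q. q \<in> ?PP \<Longrightarrow> card (fst q \<inter> snd q) \<le> card (fst m \<inter> snd m)"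
    using finite_max_witness[of ?PP "(A, B)" "\<lambda>q. card (fst q \<inter> snd q)"] by blast
  obtain E F where EF: "m = (E, F)" by (cases m)
  with m have E: "E \<in> CC" and F: "F \<in> CC" and ne: "E \<noteq> F" by auto
  have max: "card (E' \<inter> F') \<le> card (E \<inter> F)" if "E' \<in> CC" "F' \<in> CC" "E' \<noteq> F'" for E' F'
    using mx[of "(E', F')"] that EF by simp
  define D where "D = E \<inter> F"
  have D: "subgroup D G" unfolding D_def using CCs E F subgroups_Inter_pair by blast
  have DG: "D \<subseteq> carrier G" using D by (rule subgroup.subset)
  have finD: "finite D" using DG fin finite_subset by blast
  have "\<not> E \<subseteq> F" using ne card_subset_eq[OF CCs(4)[OF F], of E] CCs(2) E F by metis
  then have DE: "D \<subset> E" unfolding D_def by blast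
  have "\<not> F \<subseteq> E" using ne card_subset_eq[OF CCs(4)[OF E], of F] CCs(2) E F by metis
  then have DF: "D \<subset> F" unfolding D_def by blast
  define K where "K = {g \<in> carrier G. conj_set G g D = D}"
  have K: "subgroup K G"
  proof (rule subgroupI)
    show "K \<subseteq> carrier G" by (auto simp: K_def)
    show "K \<noteq> {}" using conj_set_one[OF DG] by (auto simp: K_def)
    fix a assume a: "a \<in> K"
    then have aG: "a \<in> carrier G" and aD: "conj_set G a D = D" by (auto simp: K_def)
    have "conj_set G (inv a) (conj_set G a D) = D"
      using conj_set_mult[of "inv a" a D] aG DG conj_set_one by simp
    then show "inv a \<in> K" using aG aD by (simp add: K_def)
    fix b assume "b \<in> K"
    then show "a \<otimes> b \<in> K" using a conj_set_mult[of a b D] DG by (simp add: K_def)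
  qed
  have DK: "D \<subseteq> K" using conj_set_self[OF D finD] DG by (auto simp: K_def)
  have grow: "\<exists>g. g \<in> A' \<and> g \<notin> D \<and> g \<in> K" if A': "A' \<in> CC" "D \<subset> A'" for A'
  proof -
    obtain g where g: "g \<in> A'" "g \<notin> D" "\<And>d. d \<in> D \<Longrightarrow> g \<otimes> d \<otimes> inv g \<in> D"
      using two_subgroup_normalizer_grows[OF fin CCs(1)[OF A'(1)] CCs(2)[OF A'(1)] D A'(2)] by blast
    have gG: "g \<in> carrier G" using g(1) CCs(3)[OF A'(1)] by blast
    have "conj_set G g D \<subseteq> D" using g(3) by (auto simp: conj_set_def)
    then have "conj_set G g D = D" using card_subset_eq[OF finD] card_conj_set[OF gG DG] by blast
    then show ?thesis using g gG by (auto simp: K_def)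
  qed
  \<comment> \<open>Otherwise the normalizer \<open>K\<close> of \<open>D\<close> is a 2-group and
    lies in a single conjugate \<open>?L\<close> of \<open>Q\<close>. By \<open>grow\<close> it
    meets both \<open>E\<close> and \<open>F\<close> in more than \<open>D\<close>, so by maximality
    of \<open>D\<close> both are equal to \<open>?L\<close>.\<close>
  have "p dvd card K"
  proof (rule ccontr)
    assume nd: "\<not> p dvd card K"
    have "card K dvd 2 ^ n * p" using lagrange[OF K] ord by (metis dvd_triv_right)
    moreover have "coprime (card K) p" using nd p prime_imp_coprime coprime_commute by metis
    ultimately have "card K dvd 2 ^ n" by (simp add: coprime_dvd_mult_left_iff)
    then obtain k where k: "card K = 2 ^ k" by (auto simp: divides_primepow_nat)
    have "order G = card Q * p" using ord Q by simp
    from two_subgroup_conjugate[OF fin Q(1) this p(2) K k]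
    obtain g where g: "g \<in> carrier G" "\<And>r. r \<in> K \<Longrightarrow> g \<otimes> r \<otimes> inv g \<in> Q" by blast
    let ?L = "conj_set G (inv g) Q"
    have L: "?L \<in> CC" using CC g by auto
    have KL: "K \<subseteq> ?L"
    proof
      fix r assume r: "r \<in> K"
      then have "r \<in> carrier G" by (simp add: K_def)
      then show "r \<in> ?L" using mem_conj_set_iff[of "inv g" Q r] g r QG by simp
    qed
    have "A' = ?L" if A': "A' \<in> CC" "D \<subset> A'" for A'
    proof (rule ccontr)
      assume n: "A' \<noteq> ?L"
      obtain g' where "g' \<in> A'" "g' \<notin> D" "g' \<in> K" using grow A' by blast
      then have "D \<subset> A' \<inter> ?L" using DK KL A' by blast
      then have "card D < card (A' \<inter> ?L)" using CCs(4)[OF A'(1)] by (intro psubset_card_mono) auto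
      then show False using max[OF A'(1) L n] by (simp add: D_def)
    qed
    then show False using E F DE DF ne by metis
  qed
  interpret K: group "G\<lparr>carrier := K\<rparr>" using K by (rule subgroup_imp_group)
  have "finite K" using fin by (simp add: K_def)
  then obtain u where u: "u \<in> K" "u \<noteq> \<one>" "u [^]\<^bsub>G\<lparr>carrier := K\<rparr>\<^esub> p = \<one>"
    using K.Cauchy_element[OF p(1)] \<open>p dvd card K\<close> by (auto simp: order_def)
  have uG: "u \<in> carrier G" using u(1) by (simp add: K_def)
  have up: "u [^] p = \<one>" using u(3) nat_pow_consistent by metis
  have upK: "u [^] i \<in> K" for i :: nat
    using u(1) K by (induction i) (auto intro: subgroup.one_closed subgroup.m_closed)
  \<comment> \<open>Every conjugate of \<open>Q\<close> arises from \<open>E\<close> by conjugation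
    with a power of \<open>u\<close>, and \<open>u\<close> normalizes \<open>D\<close>.\<close>
  have "D \<subseteq> M" if M: "M \<in> CC" for M
  proof -
    obtain a where a: "a \<in> carrier G" "E = conj_set G a Q" using E unfolding CC by (rule imageE)
    obtain e where e: "e \<in> carrier G" "M = conj_set G e Q" using M unfolding CC by (rule imageE)
    have oE: "order G = card E * p" using ord CCs(2)[OF E] by simp
    have nE: "\<not> p dvd card E" using ndvd CCs(2)[OF E] by simp
    have ea: "e \<otimes> inv a \<in> carrier G" using a e by simp
    obtain i q where i: "q \<in> E" "e \<otimes> inv a = u [^] (i::nat) \<otimes> q"
      by (rule prime_power_complement[OF oE p(1) uG u(2) up CCs(1)[OF E] nE ea])
    have qG: "q \<in> carrier G" using i(1) CCs(3)[OF E] by blast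
    have "M = conj_set G (e \<otimes> inv a) E"
      using a e conj_set_mult[of "e \<otimes> inv a" a Q] QG by (simp add: m_assoc)
    also have "\<dots> = conj_set G (u [^] i) (conj_set G q E)"
      using i uG qG CCs(3)[OF E] conj_set_mult[of "u [^] i" q E] by simp
    also have "conj_set G q E = E" using conj_set_self CCs[OF E] i(1) by blast
    finally have "M = conj_set G (u [^] i) E" .
    moreover have "D \<subseteq> E" unfolding D_def by blast
    then have "conj_set G (u [^] i) D \<subseteq> conj_set G (u [^] i) E" by (auto simp: conj_set_def)
    moreover have "conj_set G (u [^] i) D = D" using upK by (simp add: K_def)
    ultimately show ?thesis by simp
  qed
  then have DN: "D = \<Inter> CC" using E F unfolding D_def by blast
  have "card (A \<inter> B) \<le> card D" using max AB by (simp add: D_def)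
  moreover have "D \<subseteq> A \<inter> B" using DN AB by blast
  ultimately have "D = A \<inter> B" using CCs(4)[OF AB(1)] card_seteq[of "A \<inter> B" D] by simp
  then show ?thesis using DN by simp
qed

text \<open>The last two properties express, without the quotient, that the image of
  \<open>x\<close> in G/N generates a normal subgroup containing its centralizer. For normality, the
  p conjugates of \<open>Q\<close> together leave out exactly (p - 1) |N| elements; these are the
  x^i a with 0 < i < p and a in N, and every conjugate of \<open>x\<close> is among them because it
  lies in no conjugate of \<open>Q\<close>. For the centralizer, an element of \<open>Q\<close>
  commuting with \<open>x\<close> modulo \<open>N\<close> stays in \<open>Q\<close> under
  conjugation by powers of \<open>x\<close>, hence lies in all conjugates of
  \<open>Q\<close>.\<close>

lemma two_power_times_prime_structure:
  assumes ord: "order G = 2 ^ n * p" and p: "Factorial_Ring.prime (p::nat)" "odd p"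
  obtains N m x where "N \<lhd> G" "card N = 2 ^ m" "x \<in> carrier G" "x [^] p = \<one>" "x \<notin> N"
    "\<And>g. g \<in> carrier G \<Longrightarrow> \<exists>i::nat. \<exists>a\<in>N. g \<otimes> x \<otimes> inv g = x [^] i \<otimes> a"
    "\<And>g. g \<in> carrier G \<Longrightarrow> \<exists>a\<in>N. g \<otimes> x \<otimes> inv g = x \<otimes> a \<Longrightarrow> \<exists>i::nat. \<exists>a\<in>N. g = x [^] i \<otimes> a"
proof -
  have p0: "p > 0" using p by (simp add: prime_gt_0_nat)
  have fin: "finite (carrier G)" using ord p0 order_gt_0_iff_finite by simp
  have ndvd: "\<not> p dvd 2 ^ k" for k
    using p by (metis coprime_right_2_iff_odd primes_dvd_imp_eq prime_dvd_power two_is_prime_nat dvd_refl)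
  obtain Q where Q: "subgroup Q G" "card Q = 2 ^ n"
    using sylow_thm[OF two_is_prime_nat is_group ord fin] by blast
  obtain x where x: "x \<in> carrier G" "x \<noteq> \<one>" "x [^] p = \<one>"
    using Cauchy_element[OF p(1) _ fin] ord by auto
  have QG: "Q \<subseteq> carrier G" using Q(1) by (rule subgroup.subset)
  define CC where "CC = (\<lambda>g. conj_set G g Q) ` carrier G"
  have CCs: "subgroup E G" "card E = 2 ^ n" "E \<subseteq> carrier G" "finite E" if "E \<in> CC" for E
  proof -
    obtain g where g: "g \<in> carrier G" "E = conj_set G g Q" using \<open>E \<in> CC\<close> unfolding CC_def by (rule imageE)
    then show "subgroup E G" "card E = 2 ^ n" "E \<subseteq> carrier G"
      using subgroup_conj_set Q card_conj_set QG conj_set_carrier by auto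
    then show "finite E" using fin finite_subset by blast
  qed
  have finCC: "finite CC" using CC_def fin by simp
  have QCC: "Q \<in> CC" unfolding CC_def using conj_set_one[OF QG] by (metis image_eqI one_closed)
  have conjCC: "conj_set G g E \<in> CC" if "g \<in> carrier G" "E \<in> CC" for g E
    using that conj_set_mult[OF _ _ QG] unfolding CC_def by auto
  define N where "N = \<Inter> CC"
  have N: "subgroup N G" unfolding N_def using CCs QCC by (intro subgroups_Inter) auto
  have NG: "N \<subseteq> carrier G" using N by (rule subgroup.subset)
  have NQ: "N \<subseteq> Q" unfolding N_def using QCC by blast
  have Nn: "N \<lhd> G"
    unfolding normal_inv_iff
  proof (intro conjI ballI N)
    fix g h assume g: "g \<in> carrier G" and h: "h \<in> N"
    show "g \<otimes> h \<otimes> inv g \<in> N"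
      unfolding N_def
    proof
      fix E assume E: "E \<in> CC"
      have "h \<in> conj_set G (inv g) E" using h conjCC[of "inv g" E] g E unfolding N_def by blast
      then show "g \<otimes> h \<otimes> inv g \<in> E" using mem_conj_set_iff[of "inv g" E h] g h NG CCs(3)[OF E] by auto
    qed
  qed
  interpret Q: group "G\<lparr>carrier := Q\<rparr>" using Q(1) by (rule subgroup_imp_group)
  have "card N dvd 2 ^ n"
    using Q.lagrange[OF subgroup_incl[OF N Q(1) NQ]] Q(2) by (simp add: order_def) (metis dvd_triv_right)
  then obtain m where m: "card N = 2 ^ m" by (auto simp: divides_primepow_nat)
  have notin: "x [^] i \<notin> E" if "E \<in> CC" "\<not> p dvd i" for E and i :: nat
    using prime_pow_mem_subgroup[OF fin x(1,3) p(1) CCs(1)[OF that(1)], of i] ndvd CCs(2)[OF that(1)]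
      prime_pow_eq_one_iff[OF x p(1), of i] that(2) by auto
  have xN: "x \<notin> N"
  proof
    assume "x \<in> N"
    then have "x [^] (1::nat) \<in> Q" using NQ x by auto
    moreover have "\<not> p dvd 1" using p(1) not_prime_1 by auto
    ultimately show False using notin[OF QCC] by blast
  qed
  have dec: "\<exists>i q. i < p \<and> q \<in> Q \<and> g = x [^] (i::nat) \<otimes> q" if "g \<in> carrier G" for g
    using prime_power_complement[OF _ p(1) x Q(1) _ that] ord Q ndvd by (metis mult.commute)
  have CCpow: "\<exists>i<p. E = conj_set G (x [^] (i::nat)) Q" if E: "E \<in> CC" for E
  proof -
    obtain g where g: "g \<in> carrier G" "E = conj_set G g Q" using E unfolding CC_def by (rule imageE)
    obtain i q where iq: "i < p" "q \<in> Q" "g = x [^] (i::nat) \<otimes> q" using dec[OF g(1)] by blast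
    have "E = conj_set G (x [^] i) (conj_set G q Q)"
      using g iq x QG conj_set_mult[of "x [^] i" q Q] by auto
    also have "conj_set G q Q = Q" using conj_set_self[OF Q(1) _ iq(2)] QG fin finite_subset by blast
    finally show ?thesis using iq by blast
  qed
  have C1: "\<exists>i::nat. \<exists>a\<in>N. g \<otimes> x \<otimes> inv g = x [^] i \<otimes> a" if g: "g \<in> carrier G" for g
  proof (cases "\<exists>A\<in>CC. \<exists>B\<in>CC. A \<noteq> B")
    case False
    then have "CC = {Q}" using QCC by blast
    then have "N = Q" by (simp add: N_def)
    then show ?thesis using dec[of "g \<otimes> x \<otimes> inv g"] g x by blast
  next
    case True
    let ?Q = "\<lambda>i::nat. conj_set G (x [^] i) Q"
    have inter: "A \<inter> B = N" if "A \<in> CC" "B \<in> CC" "A \<noteq> B" for A B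
      unfolding N_def using conjugates_inter_eq_core[OF ord p Q CC_def that] .
    have QiCC: "?Q i \<in> CC" for i using CC_def x by auto
    \<comment> \<open>A nontrivial power of \<open>x\<close> normalizing \<open>Q\<close> would
      generate, together with \<open>Q\<close>, the whole group, and \<open>Q\<close> would have no
      other conjugate.\<close>
    have nofix: "conj_set G (x [^] i) Q \<noteq> Q" if i: "\<not> p dvd i" for i
    proof
      assume fx: "conj_set G (x [^] i) Q = Q"
      let ?v = "x [^] i"
      have v: "?v \<in> carrier G" "?v \<noteq> \<one>" using x i prime_pow_eq_one_iff[OF x p(1)] by auto
      have "?v [^] p = (x [^] p) [^] i" using x(1) by (simp add: nat_pow_pow mult.commute)
      then have vp: "?v [^] p = \<one>" using x by simp
      have fxk: "conj_set G (?v [^] k) Q = Q" for k :: nat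
      proof (induction k)
        case 0 show ?case using conj_set_one[OF QG] by simp
      next
        case (Suc k)
        have "conj_set G (?v [^] Suc k) Q = conj_set G (?v [^] k) (conj_set G ?v Q)"
          using conj_set_mult[of "?v [^] k" ?v Q] v QG by simp
        then show ?case using Suc fx by simp
      qed
      have "conj_set G g Q = Q" if g: "g \<in> carrier G" for g
      proof -
        obtain k q where kq: "q \<in> Q" "g = ?v [^] (k::nat) \<otimes> q"
          using prime_power_complement[OF _ p(1) v vp Q(1) _ g] ord Q ndvd by (metis mult.commute)
        have "conj_set G g Q = conj_set G (?v [^] k) (conj_set G q Q)"
          using conj_set_mult[of "?v [^] k" q Q] v QG kq by auto
        also have "conj_set G q Q = Q" using conj_set_self[OF Q(1) _ kq(1)] QG fin finite_subset by blast
        finally show ?thesis using fxk by simp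
      qed
      then have "CC = {Q}" unfolding CC_def by auto
      then show False using True by blast
    qed
    have Qinj: "?Q i \<noteq> ?Q j" if "i < j" "j < p" for i j
    proof
      assume e: "?Q i = ?Q j"
      have "?Q j = conj_set G (x [^] i) (?Q (j - i))"
        using conj_set_mult[of "x [^] i" "x [^] (j - i)" Q] x QG that by (simp add: nat_pow_mult)
      then have "conj_set G (inv (x [^] i)) (?Q i) = conj_set G (inv (x [^] i)) (conj_set G (x [^] i) (?Q (j - i)))"
        using e by simp
      moreover have "conj_set G (inv (x [^] i)) (conj_set G (x [^] i) R) = R" if "R \<subseteq> carrier G" for R
        using conj_set_mult[of "inv (x [^] i)" "x [^] i" R] x that conj_set_one by simp
      ultimately have "Q = ?Q (j - i)" using QG conj_set_carrier[of "x [^] (j - i)" Q] x by simp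
      moreover have "\<not> p dvd j - i" using that by (auto dest: dvd_imp_le)
      ultimately show False using nofix by metis
    qed
    define V where "V = (\<lambda>(i::nat, a). x [^] i \<otimes> a) ` ({1..<p} \<times> N)"
    have inj: "inj_on (\<lambda>(i::nat, a). x [^] i \<otimes> a) ({1..<p} \<times> N)"
    proof (rule inj_onI, clarify)
      fix i j a b assume ij: "i \<in> {1..<p}" "j \<in> {1..<p}" "a \<in> N" "b \<in> N" and e: "x [^] i \<otimes> a = x [^] j \<otimes> b"
      have aux: "i = j" if "i \<le> j" "j < p" "a \<in> N" "b \<in> N" "x [^] i \<otimes> a = x [^] j \<otimes> b" for i j :: nat and a b
      proof (rule ccontr)
        assume "i \<noteq> j"
        have ab: "a \<in> carrier G" "b \<in> carrier G" using that NG by auto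
        have "x [^] j = x [^] i \<otimes> x [^] (j - i)" using that x by (simp add: nat_pow_mult)
        then have "x [^] i \<otimes> a = x [^] i \<otimes> (x [^] (j - i) \<otimes> b)" using that(5) x ab by (simp add: m_assoc)
        then have "a = x [^] (j - i) \<otimes> b" using x ab by simp
        then have "x [^] (j - i) = a \<otimes> inv b" using x ab by (simp add: inv_solve_right)
        then have "x [^] (j - i) \<in> N" using that subgroup.m_closed[OF N] subgroup.m_inv_closed[OF N] by simp
        then have "x [^] (j - i) \<in> Q" using NQ by blast
        moreover have "\<not> p dvd j - i" using that \<open>i \<noteq> j\<close> by (auto dest: dvd_imp_le)
        ultimately show False using notin[OF QCC] by blast
      qed
      have "i = j"
      proof (cases "i \<le> j")
        case True
        then show ?thesis using aux[OF True _ ij(3,4) e] ij(2) by simp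
      next
        case False
        then show ?thesis using aux[OF _ _ ij(4,3) e[symmetric]] ij(1) by simp
      qed
      moreover have "a \<in> carrier G" "b \<in> carrier G" using ij(3,4) NG by auto
      ultimately show "i = j \<and> a = b" using e x(1) by simp
    qed
    have cardV: "card V = (p - 1) * card N"
      unfolding V_def card_image[OF inj] by (simp add: card_cartesian_product)
    have finN: "finite N" using NG fin finite_subset by blast
    define U where "U = (\<Union>i<p. ?Q i)"
    have UCC: "\<Union> CC = U"
      unfolding U_def using CCpow QiCC by blast
    have Usplit: "U = N \<union> (\<Union>i<p. ?Q i - N)"
    proof -
      have "N \<subseteq> ?Q 0" unfolding N_def using QiCC by blast
      moreover have "0 \<in> {..<p}" using p0 by simp
      ultimately have "N \<subseteq> U" unfolding U_def by blast
      then show ?thesis unfolding U_def by blast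
    qed
    have "card (\<Union>i<p. ?Q i - N) = (\<Sum>i<p. card (?Q i - N))"
    proof (rule card_UN_disjoint)
      show "\<forall>i\<in>{..<p}. finite (?Q i - N)" using CCs(4) QiCC by blast
      show "\<forall>i\<in>{..<p}. \<forall>j\<in>{..<p}. i \<noteq> j \<longrightarrow> (?Q i - N) \<inter> (?Q j - N) = {}"
      proof (intro ballI impI)
        fix i j assume "i \<in> {..<p}" "j \<in> {..<p}" "i \<noteq> j"
        then have "?Q i \<noteq> ?Q j" using Qinj[of i j] Qinj[of j i] by (metis lessThan_iff linorder_neqE_nat)
        then have "?Q i \<inter> ?Q j = N" using inter QiCC by blast
        then show "(?Q i - N) \<inter> (?Q j - N) = {}" by blast
      qed
    qed simp
    also have "\<dots> = (\<Sum>i<p. 2 ^ n - card N)"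
    proof (rule sum.cong[OF refl])
      fix i
      have "N \<subseteq> ?Q i" unfolding N_def using QiCC by blast
      then show "card (?Q i - N) = 2 ^ n - card N" using card_Diff_subset[OF finN] CCs(2)[OF QiCC] by simp
    qed
    finally have c1: "card (\<Union>i<p. ?Q i - N) = p * (2 ^ n - card N)" by simp
    have "card U = card N + p * (2 ^ n - card N)"
      unfolding Usplit using c1 finN CCs(4)[OF QiCC] by (subst card_Un_disjoint) auto
    moreover have cN: "card N \<le> 2 ^ n" using card_mono[OF _ NQ] QG fin finite_subset Q(2) by metis
    have UG: "U \<subseteq> carrier G" using UCC CCs(3) by blast
    have "card (carrier G - U) = 2 ^ n * p - card U"
      using card_Diff_subset[of U "carrier G"] UG fin finite_subset ord by (metis order_def)
    ultimately have cW: "card (carrier G - U) = 2 ^ n * p - (card N + p * (2 ^ n - card N))" by simp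
    have "2 ^ n * p - (card N + p * (2 ^ n - card N)) = (p - 1) * card N"
    proof -
      obtain d where d: "2 ^ n = card N + d" using cN le_Suc_ex by blast
      obtain p' where "p = Suc p'" using p0 gr0_implies_Suc by blast
      then show ?thesis unfolding d by (simp add: algebra_simps)
    qed
    with cW have cW: "card (carrier G - U) = card V" using cardV by simp
    have "V \<subseteq> carrier G - U"
    proof
      fix v assume "v \<in> V"
      then obtain i a where ia: "1 \<le> i" "i < p" "a \<in> N" "v = x [^] (i::nat) \<otimes> a" by (auto simp: V_def)
      have aG: "a \<in> carrier G" using ia NG by blast
      have "v \<notin> E" if E: "E \<in> CC" for E
      proof
        assume "v \<in> E"
        moreover have "a \<in> E" using ia E by (simp add: N_def)
        ultimately have "v \<otimes> inv a \<in> E" using subgroup.m_closed[OF CCs(1)[OF E]] subgroup.m_inv_closed[OF CCs(1)[OF E]] by blast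
        then have "x [^] i \<in> E" using ia x aG by (simp add: m_assoc)
        moreover have "\<not> p dvd i" using ia by (auto dest: dvd_imp_le)
        ultimately show False using notin[OF E] by blast
      qed
      then show "v \<in> carrier G - U" using ia x aG UCC by auto
    qed
    then have VW: "V = carrier G - U" using cW fin by (intro card_subset_eq) auto
    \<comment> \<open>If a conjugate of \<open>x\<close> lay in some conjugate of \<open>Q\<close>,
      then so would \<open>x\<close>, against its order p.\<close>
    have "g \<otimes> x \<otimes> inv g \<notin> U"
    proof
      assume "g \<otimes> x \<otimes> inv g \<in> U"
      then obtain E where E: "E \<in> CC" "g \<otimes> x \<otimes> inv g \<in> E" using UCC by blast
      then have "x \<in> conj_set G (inv g) E" using mem_conj_set_iff[of "inv g" E x] g x CCs(3) by simp
      then have "x [^] (1::nat) \<in> conj_set G (inv g) E" using x by simp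
      moreover have "\<not> p dvd 1" using p(1) not_prime_1 by auto
      ultimately show False using notin[OF conjCC[of "inv g" E]] g E by blast
    qed
    then have "g \<otimes> x \<otimes> inv g \<in> V" using VW g x by simp
    then show ?thesis by (auto simp: V_def)
  qed
  have C2: "\<exists>i::nat. \<exists>a\<in>N. g = x [^] i \<otimes> a" if g: "g \<in> carrier G" "\<exists>a\<in>N. g \<otimes> x \<otimes> inv g = x \<otimes> a" for g
  proof -
    define C where "C = {g \<in> carrier G. \<exists>a\<in>N. g \<otimes> x = x \<otimes> a \<otimes> g}"
    have C_alt: "g \<in> C \<longleftrightarrow> inv x \<otimes> (g \<otimes> x \<otimes> inv g) \<in> N" if "g \<in> carrier G" for g
    proof
      assume "g \<in> C"
      then obtain a where a: "a \<in> N" "g \<otimes> x = x \<otimes> a \<otimes> g" by (auto simp: C_def)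
      then have "inv x \<otimes> (g \<otimes> x \<otimes> inv g) = a" using that x NG by (auto simp: m_assoc)
      then show "inv x \<otimes> (g \<otimes> x \<otimes> inv g) \<in> N" using a by simp
    next
      assume "inv x \<otimes> (g \<otimes> x \<otimes> inv g) \<in> N"
      moreover have "g \<otimes> x = x \<otimes> (inv x \<otimes> (g \<otimes> x \<otimes> inv g)) \<otimes> g" using that x by (simp add: m_assoc)
      ultimately show "g \<in> C" using that by (auto simp: C_def)
    qed
    have "g \<in> C" using g x NG C_alt[OF g(1)] by auto
    obtain i q where iq: "q \<in> Q" "g = x [^] (i::nat) \<otimes> q" using dec[OF g(1)] by blast
    have qG: "q \<in> carrier G" using iq QG by blast
    obtain a where a: "a \<in> N" "g \<otimes> x = x \<otimes> a \<otimes> g" using \<open>g \<in> C\<close> by (auto simp: C_def)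
    have aG: "a \<in> carrier G" using a NG by blast
    \<comment> \<open>The elements of \<open>Q\<close> that commute with \<open>x\<close> modulo
      \<open>N\<close>. Conjugating such an element by the inverse of \<open>x\<close> changes it by
      a factor in \<open>N\<close>, and \<open>N\<close> lies in \<open>Q\<close>; so
      \<open>D\<close> is mapped to itself.\<close>
    define D where "D = {d \<in> Q. inv d \<otimes> x \<otimes> d \<otimes> inv x \<in> N}"
    have D_pow: "inv (x [^] k) \<otimes> d \<otimes> x [^] k \<in> D" if d: "d \<in> D" for d and k :: nat
    proof (induction k)
      case 0 show ?case using d QG by (auto simp: D_def)
    next
      case (Suc k)
      define e where "e = inv (x [^] k) \<otimes> d \<otimes> x [^] k"
      have e: "e \<in> D" "e \<in> Q" "e \<in> carrier G" using Suc QG by (auto simp: e_def D_def)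
      have "inv (inv e \<otimes> x \<otimes> e \<otimes> inv x) \<in> N"
        using e(1) subgroup.m_inv_closed[OF N] by (simp add: D_def)
      then have "inv x \<otimes> inv (inv e \<otimes> x \<otimes> e \<otimes> inv x) \<otimes> x \<in> N"
        using normal.inv_op_closed1[OF Nn, of x] x by simp
      then have n1: "inv x \<otimes> (inv (inv e \<otimes> x \<otimes> e \<otimes> inv x)) \<otimes> x \<in> N" .
      have eq: "inv x \<otimes> e \<otimes> x = e \<otimes> (inv e \<otimes> inv x \<otimes> e \<otimes> x)" using e x by (simp add: m_assoc)
      have "inv e \<otimes> inv x \<otimes> e \<otimes> x = inv x \<otimes> (x \<otimes> inv e \<otimes> inv x \<otimes> e) \<otimes> x" using e x by (simp add: m_assoc)
      also have "x \<otimes> inv e \<otimes> inv x \<otimes> e = inv (inv e \<otimes> x \<otimes> e \<otimes> inv x)" using e x by (simp add: m_assoc inv_mult_group)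
      finally have n2: "inv e \<otimes> inv x \<otimes> e \<otimes> x \<in> N" using n1 by simp
      define f where "f = inv x \<otimes> e \<otimes> x"
      have fQ: "f \<in> Q" unfolding f_def eq using e(2) n2 NQ subgroup.m_closed[OF Q(1)] by blast
      have "inv x \<otimes> (inv e \<otimes> x \<otimes> e \<otimes> inv x) \<otimes> x \<in> N"
        using normal.inv_op_closed1[OF Nn, of x] x e(1) by (simp add: D_def)
      moreover have "inv x \<otimes> (inv e \<otimes> x \<otimes> e \<otimes> inv x) \<otimes> x = inv f \<otimes> x \<otimes> f \<otimes> inv x"
        using e x by (simp add: f_def m_assoc inv_mult_group)
      ultimately have "f \<in> D" using fQ by (simp add: D_def)
      moreover have "inv (x [^] Suc k) \<otimes> d \<otimes> x [^] Suc k = f"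
        using x d QG by (auto simp: f_def e_def m_assoc inv_mult_group D_def)
      ultimately show ?case by simp
    qed
    have "q \<in> D"
    proof -
      have "x [^] i \<otimes> q \<otimes> x = x \<otimes> a \<otimes> x [^] i \<otimes> q" using a(2) iq x qG aG by (simp add: m_assoc)
      then have "x [^] i \<otimes> (q \<otimes> x) = x \<otimes> a \<otimes> x [^] i \<otimes> q" using x qG by (simp add: m_assoc)
      then have "q \<otimes> x = inv (x [^] i) \<otimes> (x \<otimes> a \<otimes> x [^] i \<otimes> q)"
        using x qG aG by (metis inv_solve_left m_closed nat_pow_closed)
      then have "inv q \<otimes> x \<otimes> q \<otimes> inv x = \<one> \<otimes> (inv q \<otimes> x \<otimes> q \<otimes> inv x)" using x qG by simp
      have xi: "inv (x [^] i) \<otimes> x = x \<otimes> inv (x [^] i)"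
      proof -
        have "x \<otimes> x [^] i = x [^] i \<otimes> x" using x by (metis nat_pow_Suc nat_pow_Suc2)
        then show ?thesis using x by (metis inv_solve_left inv_solve_right m_assoc m_closed nat_pow_closed inv_closed)
      qed
      define b where "b = inv (x [^] i) \<otimes> a \<otimes> x [^] i"
      have b: "b \<in> N" unfolding b_def using normal.inv_op_closed1[OF Nn, of "x [^] i" a] x a by simp
      have bG: "b \<in> carrier G" using b NG by blast
      have "q \<otimes> x = (inv (x [^] i) \<otimes> x) \<otimes> (a \<otimes> (x [^] i \<otimes> q))"
        using \<open>q \<otimes> x = inv (x [^] i) \<otimes> (x \<otimes> a \<otimes> x [^] i \<otimes> q)\<close> x qG aG by (simp add: m_assoc)
      also have "\<dots> = x \<otimes> b \<otimes> q" unfolding xi b_def using x qG aG by (simp add: m_assoc)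
      finally have "inv q \<otimes> (q \<otimes> x) = inv q \<otimes> (x \<otimes> b \<otimes> q)" by simp
      then have xe: "x = inv q \<otimes> x \<otimes> b \<otimes> q" using x qG bG by (simp add: m_assoc)
      define c where "c = inv q \<otimes> b \<otimes> q"
      have c: "c \<in> N" unfolding c_def using normal.inv_op_closed1[OF Nn, of q b] qG b by simp
      have cG: "c \<in> carrier G" using c NG by blast
      have "x = inv q \<otimes> x \<otimes> q \<otimes> c" using xe x qG bG by (simp add: c_def m_assoc)
      then have "inv q \<otimes> x \<otimes> q = x \<otimes> inv c" using x qG cG by (metis inv_solve_right m_closed inv_closed)
      then have "inv q \<otimes> x \<otimes> q \<otimes> inv x = x \<otimes> inv c \<otimes> inv x" by simp
      moreover have "x \<otimes> inv c \<otimes> inv x \<in> N"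
        using normal.inv_op_closed2[OF Nn, of x "inv c"] x subgroup.m_inv_closed[OF N c] by simp
      ultimately show ?thesis using iq by (simp add: D_def)
    qed
    have "q \<in> N"
      unfolding N_def
    proof
      fix E assume E: "E \<in> CC"
      then obtain k where k: "E = conj_set G (x [^] (k::nat)) Q" using CCpow by blast
      have "inv (x [^] k) \<otimes> q \<otimes> x [^] k \<in> Q" using D_pow[OF \<open>q \<in> D\<close>] by (simp add: D_def)
      then show "q \<in> E" using k mem_conj_set_iff[of "x [^] k" Q q] x QG qG by simp
    qed
    then show ?thesis using iq by blast
  qed
  show thesis using that[OF Nn m x(1,3) xN] C1 C2 by blast
qed

end

section \<open>Groups with a self-centralizing normal subgroup of order p\<close>

lemma dvd_combination2:
  fixes p :: int
  assumes "p dvd a" "p dvd b" "e = a * k + b * l"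
  shows "p dvd e"
  using assms by simp

text \<open>As in the form with two terms, the coefficients are supplied at each use, which turns a
  congruence modulo \<open>p\<close> into a ring identity.\<close>

lemma dvd_combination3:
  fixes p :: int
  assumes "p dvd a" "p dvd b" "p dvd c" "e = a * k + b * l + c * m"
  shows "p dvd e"
  using assms by simp

context group
begin

text \<open>The map sending \<open>(i, b)\<close> to x^i s^b is a surjective homomorphism from the
  dihedral group. Injectivity comes from the bound \<open>2 * m \<le> order G\<close>, so neither
  the exact order of \<open>x\<close> nor the position of \<open>s\<close> outside the powers of
  \<open>x\<close> has to be checked.\<close>

lemma iso_dihedral_groupI:
  assumes m: "m \<ge> 1" "2 * m \<le> order G" and fin: "finite (carrier G)"
    and x: "x \<in> carrier G" "x [^] m = \<one>" and s: "s \<in> carrier G" "s \<otimes> s = \<one>"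
    and sx: "s \<otimes> x = inv x \<otimes> s"
    and gen: "\<And>g. g \<in> carrier G \<Longrightarrow> \<exists>i::nat. g = x [^] i \<or> g = x [^] i \<otimes> s"
  shows "G \<cong> dihedral_group m"
proof -
  let ?D = "dihedral_group m"
  define f where "f = (\<lambda>(i::int, b). x [^] i \<otimes> (if b then s else \<one>))"
  have xm: "x [^] (i mod int m) = x [^] i" for i :: int
  proof -
    have "x [^] i = x [^] (int m * (i div int m)) \<otimes> x [^] (i mod int m)"
      using int_pow_mult[OF x(1), of "int m * (i div int m)" "i mod int m"] by simp
    also have "x [^] (int m * (i div int m)) = \<one>"
      using x by (simp add: int_pow_pow[symmetric] int_pow_int)
    finally show ?thesis using x(1) by simp
  qed
  have xc: "x [^] i \<in> carrier G" for i :: int using x by simp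
  have sxn: "s \<otimes> x [^] i = inv x [^] i \<otimes> s" for i :: nat
  proof (induction i)
    case 0 show ?case using s by simp
  next
    case (Suc i)
    have "s \<otimes> x [^] Suc i = (s \<otimes> x [^] i) \<otimes> x" using s x by (simp add: m_assoc)
    also have "\<dots> = inv x [^] i \<otimes> (s \<otimes> x)" using Suc s x by (simp add: m_assoc)
    also have "\<dots> = inv x [^] Suc i \<otimes> s" unfolding sx using s x by (simp add: m_assoc)
    finally show ?case .
  qed
  have six: "s \<otimes> inv x = x \<otimes> s"
  proof -
    have "x \<otimes> (s \<otimes> x) = s" unfolding sx using x s by simp
    then have "x \<otimes> s \<otimes> x = s" using x s by (simp add: m_assoc)
    then show ?thesis using x s by (metis inv_solve_right m_closed)
  qed
  have sixn: "s \<otimes> inv x [^] i = x [^] i \<otimes> s" for i :: nat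
  proof (induction i)
    case 0 show ?case using s by simp
  next
    case (Suc i)
    have "s \<otimes> inv x [^] Suc i = (s \<otimes> inv x [^] i) \<otimes> inv x" using s x by (simp add: m_assoc)
    also have "\<dots> = x [^] i \<otimes> (s \<otimes> inv x)" using Suc s x by (simp add: m_assoc)
    also have "\<dots> = x [^] Suc i \<otimes> s" unfolding six using s x by (simp add: m_assoc)
    finally show ?case .
  qed
  have sxi: "s \<otimes> x [^] i = x [^] (- i) \<otimes> s" for i :: int
  proof (cases i rule: int_cases2)
    case (nonneg n)
    then show ?thesis using sxn[of n] x by (simp add: int_pow_int int_pow_neg nat_pow_inv)
  next
    case (nonpos n)
    then show ?thesis using sixn[of n] x by (simp add: int_pow_int int_pow_neg nat_pow_inv)
  qed
  have hom: "f \<in> hom ?D G"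
  proof (rule homI)
    fix a assume "a \<in> carrier ?D"
    then show "f a \<in> carrier G" using x s by (cases a) (simp add: f_def)
  next
    fix a b assume "a \<in> carrier ?D" "b \<in> carrier ?D"
    obtain i c j d where ab: "a = (i, c)" "b = (j, d)" by (cases a; cases b)
    show "f (a \<otimes>\<^bsub>?D\<^esub> b) = f a \<otimes> f b"
    proof (cases c)
      case False
      then have "f (a \<otimes>\<^bsub>?D\<^esub> b) = x [^] (i + j) \<otimes> (if d then s else \<one>)"
        using ab xm by (simp add: f_def dihedral_group_def)
      also have "\<dots> = f a \<otimes> f b" using ab False x s by (simp add: f_def int_pow_mult m_assoc)
      finally show ?thesis .
    next
      case True
      have "f a \<otimes> f b = x [^] i \<otimes> (s \<otimes> x [^] j) \<otimes> (if d then s else \<one>)"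
        using ab True x s by (simp add: f_def m_assoc)
      also have "\<dots> = x [^] (i - j) \<otimes> (s \<otimes> (if d then s else \<one>))"
        unfolding sxi using x s int_pow_mult[of x i "- j"] by (simp add: m_assoc)
      also have "\<dots> = f (a \<otimes>\<^bsub>?D\<^esub> b)"
        using ab True xm s x by (simp add: f_def dihedral_group_def)
      finally show ?thesis by simp
    qed
  qed
  have surj: "f ` carrier ?D = carrier G"
  proof
    show "f ` carrier ?D \<subseteq> carrier G" using hom by (auto simp: hom_def)
    show "carrier G \<subseteq> f ` carrier ?D"
    proof
      fix g assume "g \<in> carrier G"
      then obtain i :: nat where i: "g = x [^] i \<or> g = x [^] i \<otimes> s" using gen by blast
      have "x [^] i = x [^] (int i mod int m)" using xm[of "int i"] by (simp add: int_pow_int)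
      then have "g = f (int i mod int m, False) \<or> g = f (int i mod int m, True)"
        using i x by (auto simp: f_def)
      moreover have "(int i mod int m, b) \<in> carrier ?D" for b using m by (simp add: dihedral_group_def)
      ultimately show "g \<in> f ` carrier ?D" by blast
    qed
  qed
  have fD: "finite (carrier ?D)" "card (carrier ?D) = 2 * m"
    using order_dihedral_group[of m] by (auto simp: order_def dihedral_group_def)
  have "card (f ` carrier ?D) = card (carrier ?D)"
    using card_image_le[OF fD(1), of f] fD(2) surj m(2) by (simp add: order_def)
  then have "inj_on f (carrier ?D)" using fD(1) eq_card_imp_inj_on by blast
  then have "f \<in> iso ?D G" using hom surj by (simp add: iso_def bij_betw_def)
  then have "?D \<cong> G" by (auto simp: is_iso_def)
  then show ?thesis using group.iso_sym[OF group_dihedral_group[OF m(1)]] by blast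
qed

text \<open>The preimage of \<open>-1\<close> is locally maximal, since the elements with \<open>F g ^ 2 = -1\<close> have their squares
  in it; its products lie in the preimage of \<open>1\<close>.\<close>

lemma character_of_order_4_not_filled:
  fixes F :: "'a \<Rightarrow> int" and p :: int
  assumes fin: "finite (carrier G)" and p: "Factorial_Ring.prime p" "odd p"
    and mult: "\<And>a b. a \<in> carrier G \<Longrightarrow> b \<in> carrier G \<Longrightarrow> p dvd F (a \<otimes> b) - F a * F b"
    and four: "\<And>a. a \<in> carrier G \<Longrightarrow> p dvd F a ^ 4 - 1"
    and w: "w \<in> carrier G" "p dvd F w ^ 2 + 1"
  shows "\<not> filled G"
proof -
  have p2: "\<not> p dvd 2"
    using p by (metis dvd_refl even_numeral prime_ge_2_int zdvd_imp_le zero_less_numeral order_antisym)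
  \<comment> \<open>\<open>F\<close> stands for a character into the fourth roots of unity modulo
    \<open>p\<close>, given by integer representatives; its value at \<open>w\<close> is a square
    root of -1.\<close>
  define S where "S = {g \<in> carrier G. p dvd F g + 1}"
  have prodS: "p dvd F (a \<otimes> b) - 1" if "a \<in> S" "b \<in> S" for a b
  proof -
    have 1: "p dvd F (a \<otimes> b) - F a * F b" "p dvd F a + 1" "p dvd F b + 1"
      using that mult by (auto simp: S_def)
    show ?thesis
      by (rule dvd_combination3[OF 1, where k = 1 and l = "F b" and m = "-1"]) (simp add: algebra_simps)
  qed
  have pf: "product_free G S"
    unfolding product_free_iff
  proof (intro conjI ballI)
    have "p dvd F (w \<otimes> w) + 1"
      by (rule dvd_combination2[OF mult[OF w(1) w(1)] w(2), where k = 1 and l = 1]) (simp add: power2_eq_square)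
    then have "w \<otimes> w \<in> S" using w by (simp add: S_def)
    then show "S \<noteq> {}" by blast
    show "S \<subseteq> carrier G" by (auto simp: S_def)
    fix a b assume ab: "a \<in> S" "b \<in> S"
    show "a \<otimes> b \<notin> S"
    proof
      assume "a \<otimes> b \<in> S"
      then have d: "p dvd F (a \<otimes> b) + 1" by (simp add: S_def)
      have "p dvd 2" by (rule dvd_combination2[OF d prodS[OF ab], where k = 1 and l = "-1"]) simp
      then show False using p2 by simp
    qed
  qed
  have "w \<notin> T \<and> (\<forall>a\<in>T. \<forall>b\<in>T. a \<otimes> b \<noteq> w)" if T: "product_free G T" "S \<subseteq> T" for T
  proof -
    have no: "\<And>s t. s \<in> T \<Longrightarrow> t \<in> T \<Longrightarrow> s \<otimes> t \<notin> T" using T(1) by (rule product_free_mult)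
    obtain s where s: "s \<in> S" using pf by (auto simp: product_free_iff)
    have nsq: "\<not> p dvd F t ^ 2 + 1" if t: "t \<in> T" "t \<in> carrier G" for t
    proof
      assume d: "p dvd F t ^ 2 + 1"
      have "p dvd F (t \<otimes> t) + 1"
        by (rule dvd_combination2[OF mult[OF t(2) t(2)] d, where k = 1 and l = 1]) (simp add: power2_eq_square)
      then have "t \<otimes> t \<in> S" using t by (simp add: S_def)
      then show False using no t T by blast
    qed
    have TS: "t \<in> S" if t: "t \<in> T" for t
    proof -
      have tG: "t \<in> carrier G" using t product_free_subset[OF T(1)] by blast
      have "F t ^ 4 - 1 = (F t ^ 2 + 1) * ((F t - 1) * (F t + 1))"
        by (simp add: algebra_simps power2_eq_square power4_eq_xxxx)
      then have "p dvd (F t ^ 2 + 1) * ((F t - 1) * (F t + 1))" using four[OF tG] by simp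
      then have "p dvd F t - 1 \<or> p dvd F t + 1"
        using nsq[OF t tG] prime_dvd_mult_iff[OF p(1)] by blast
      moreover have "\<not> p dvd F t - 1"
      proof
        assume d: "p dvd F t - 1"
        have s': "s \<in> carrier G" "p dvd F s + 1" using s by (auto simp: S_def)
        have "p dvd F (t \<otimes> s) + 1"
          by (rule dvd_combination3[OF mult[OF tG s'(1)] d s'(2), where k = 1 and l = "F s" and m = 1])
            (simp add: algebra_simps)
        then have "t \<otimes> s \<in> S" using tG s' by (simp add: S_def)
        then show False using no t s T by blast
      qed
      ultimately show ?thesis using tG by (simp add: S_def)
    qed
    have "a \<otimes> b \<noteq> w" if "a \<in> T" "b \<in> T" for a b
    proof
      assume "a \<otimes> b = w"
      then have d: "p dvd F w - 1" using prodS TS that by blast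
      have "p dvd 2"
        by (rule dvd_combination2[OF w(2) d, where k = 1 and l = "- F w - 1"]) (simp add: algebra_simps power2_eq_square)
      then show False using p2 by simp
    qed
    moreover have "w \<notin> T" using nsq w by blast
    ultimately show ?thesis by blast
  qed
  moreover have "w \<noteq> \<one>"
  proof
    assume "w = \<one>"
    then have 1: "p dvd F w - F w * F w" using mult[of \<one> \<one>] by simp
    have 2: "p dvd F w + 1"
      by (rule dvd_combination2[OF 1 w(2), where k = 1 and l = 1]) (simp add: power2_eq_square)
    have "p dvd 2"
      by (rule dvd_combination2[OF w(2) 2, where k = 1 and l = "1 - F w"]) (simp add: algebra_simps power2_eq_square)
    then show False using p2 by simp
  qed
  ultimately show ?thesis using not_filledI[OF fin pf w(1)] by blast
qed

lemma conj_pow: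
  assumes "g \<in> carrier G" "x \<in> carrier G"
  shows "g \<otimes> x [^] (n::nat) \<otimes> inv g = (g \<otimes> x \<otimes> inv g) [^] n"
proof (induction n)
  case 0 show ?case using assms by simp
next
  case (Suc n)
  then show ?case using conj_mult[OF assms(1), of "x [^] n" x] assms by simp
qed

lemma prime_pow_eq_iff:
  assumes "u \<in> carrier G" "u \<noteq> \<one>" "u [^] p = \<one>" "Factorial_Ring.prime (p::nat)"
  shows "u [^] (i::nat) = u [^] (j::nat) \<longleftrightarrow> int p dvd int i - int j"
proof -
  have aux: "u [^] i = u [^] j \<longleftrightarrow> int p dvd int i - int j" if "j \<le> i" for i j :: nat
  proof -
    have "u [^] i = u [^] j \<otimes> u [^] (i - j)" using assms(1) that by (simp add: nat_pow_mult)
    then have "u [^] i = u [^] j \<longleftrightarrow> u [^] (i - j) = \<one>" using assms(1) by simp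
    also have "\<dots> \<longleftrightarrow> p dvd i - j" using prime_pow_eq_one_iff[OF assms] .
    also have "\<dots> \<longleftrightarrow> int p dvd int i - int j" using of_nat_diff[OF that, where 'a = int] int_dvd_int_iff[of p "i - j"] by metis
    finally show ?thesis .
  qed
  show ?thesis
  proof (cases "j \<le> i")
    case True then show ?thesis by (rule aux)
  next
    case False
    then have "u [^] j = u [^] i \<longleftrightarrow> int p dvd int j - int i" using aux[of i j] by simp
    then show ?thesis using dvd_diff_commute by metis
  qed
qed

text \<open>Conjugation by \<open>g\<close> raises \<open>x\<close> to the power \<open>c g\<close>,
  and \<open>c\<close> is a character modulo \<open>p\<close> whose kernel consists of the powers of
  \<open>x\<close> by \<open>cent\<close>. Its values have 2-power order. If one had order above 2,
  a suitable power of \<open>c\<close> would have order 4 and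
  \<open>character_of_order_4_not_filled\<close> would apply. So the values are 1 and -1, and the
  powers of \<open>x\<close> have index at most 2.\<close>

lemma self_centralizing_prime_cases:
  assumes ord: "order G = 2 ^ k * p" and p: "Factorial_Ring.prime (p::nat)" "odd p"
    and x: "x \<in> carrier G" "x \<noteq> \<one>" "x [^] p = \<one>"
    and norm: "\<And>g. g \<in> carrier G \<Longrightarrow> \<exists>i::nat. g \<otimes> x \<otimes> inv g = x [^] i"
    and cent: "\<And>g. g \<in> carrier G \<Longrightarrow> g \<otimes> x \<otimes> inv g = x \<Longrightarrow> \<exists>i::nat. g = x [^] i"
    and fil: "filled G"
  shows "carrier G = (\<lambda>i::nat. x [^] i) ` {..<p} \<or> G \<cong> dihedral_group p"
proof -
  have p0: "p > 0" using p by (simp add: prime_gt_0_nat)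
  have fin: "finite (carrier G)" using ord p0 order_gt_0_iff_finite by simp
  have ip: "Factorial_Ring.prime (int p)" "odd (int p)" using p by auto
  note peq = prime_pow_eq_iff[OF x p(1)]
  obtain c :: "'a \<Rightarrow> nat" where c: "\<And>g. g \<in> carrier G \<Longrightarrow> g \<otimes> x \<otimes> inv g = x [^] c g"
    using norm by metis
  have cm: "int p dvd int (c (a \<otimes> b)) - int (c a) * int (c b)" if ab: "a \<in> carrier G" "b \<in> carrier G" for a b
  proof -
    have "x [^] c (a \<otimes> b) = a \<otimes> (b \<otimes> x \<otimes> inv b) \<otimes> inv a" using c conj_conj[of a b x] ab x by simp
    also have "\<dots> = x [^] (c a * c b)" using c conj_pow[of a x "c b"] ab x by (simp add: nat_pow_pow)
    finally show ?thesis using peq by (metis of_nat_mult)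
  qed
  have c1: "int p dvd int (c \<one>) - 1" using c[of \<one>] x peq[of "c \<one>" 1] by simp
  have cpow: "int p dvd int (c (a [^] n)) - int (c a) ^ n" if a: "a \<in> carrier G" for a and n :: nat
  proof (induction n)
    case 0 then show ?case using c1 by simp
  next
    case (Suc n)
    show ?case
      by (rule dvd_combination2[OF cm[of "a [^] n" a] Suc, where k = 1 and l = "int (c a)"])
        (use a in \<open>simp_all add: algebra_simps\<close>)
  qed
  have pw: "int p dvd a ^ n - b ^ n" if "int p dvd a - b" for a b :: int and n :: nat
    using that power_diff_sumr2[of a n b] by simp
  \<comment> \<open>Writing \<open>g\<close> as a power of \<open>x\<close> times an element
    \<open>q\<close> of a Sylow 2-subgroup, only \<open>q\<close> acts, and its order is a power of
    2.\<close>
  have e2: "\<exists>e. int p dvd int (c g) ^ (2 ^ e) - 1" if g: "g \<in> carrier G" for g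
  proof -
    obtain Q where Q: "subgroup Q G" "card Q = 2 ^ k"
      using sylow_thm[OF two_is_prime_nat is_group ord fin] by blast
    have nd: "\<not> p dvd card Q"
      unfolding Q using p by (metis coprime_right_2_iff_odd primes_dvd_imp_eq prime_dvd_power two_is_prime_nat dvd_refl)
    have oQ: "order G = card Q * p" using ord Q by simp
    obtain i q where iq: "q \<in> Q" "g = x [^] (i::nat) \<otimes> q"
      by (rule prime_power_complement[OF oQ p(1) x Q(1) nd g])
    have qG: "q \<in> carrier G" using iq Q(1) subgroup.mem_carrier by fast
    have "g \<otimes> x \<otimes> inv g = x [^] i \<otimes> x [^] c q \<otimes> inv (x [^] i)"
      using conj_conj[of "x [^] i" q x] c[OF qG] x qG iq by simp
    also have "x [^] i \<otimes> x [^] c q = x [^] c q \<otimes> x [^] i" using x by (simp add: nat_pow_mult add.commute)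
    finally have "x [^] c g = x [^] c q" using c[OF g] x by (simp add: m_assoc)
    then have gq: "int p dvd int (c g) - int (c q)" using peq by simp
    interpret Q: group "G\<lparr>carrier := Q\<rparr>" using Q(1) by (rule subgroup_imp_group)
    have "q [^]\<^bsub>G\<lparr>carrier := Q\<rparr>\<^esub> card Q = \<one>" using Q.pow_order_eq_1[of q] iq by (simp add: order_def)
    then have "q [^] ((2::nat) ^ k) = \<one>" using Q(2) nat_pow_consistent by metis
    then have d: "int p dvd int (c \<one>) - int (c q) ^ (2 ^ k)" using cpow[OF qG, of "2 ^ k"] by simp
    have "int p dvd int (c g) ^ (2 ^ k) - 1"
      by (rule dvd_combination3[OF pw[OF gq, of "2 ^ k"] d c1, where k = 1 and l = "-1" and m = 1]) simp
    then show ?thesis by blast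
  qed
  define E where "E = (\<lambda>g. LEAST e. int p dvd int (c g) ^ (2 ^ e) - 1)"
  have E: "int p dvd int (c g) ^ (2 ^ E g) - 1" if "g \<in> carrier G" for g
    unfolding E_def using e2[OF that] by (rule LeastI_ex)
  have Emin: "E g \<le> e" if "int p dvd int (c g) ^ (2 ^ e) - 1" for g e
    unfolding E_def using that by (rule Least_le)
  have up: "int p dvd int (c g) ^ (2 ^ e) - 1" if "E g \<le> e" "g \<in> carrier G" for g e
  proof -
    have "int (c g) ^ (2 ^ e) = (int (c g) ^ (2 ^ E g)) ^ (2 ^ (e - E g))"
      using that(1) by (simp add: power_mult[symmetric] power_add[symmetric])
    then show ?thesis using pw[OF E[OF that(2)], of "2 ^ (e - E g)"] by simp
  qed
  have sq: "int p dvd int (c g) ^ 2 - 1" if g: "g \<in> carrier G" for g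
  proof (rule ccontr)
    assume n: "\<not> ?thesis"
    have "\<not> E g \<le> 1" using up[of g 1] g n by auto
    define M where "M = Max (E ` carrier G)"
    have "M \<in> E ` carrier G" unfolding M_def using fin g by (intro Max_in) auto
    then obtain w where w: "w \<in> carrier G" "E w = M" by blast
    have ME: "E a \<le> M" if "a \<in> carrier G" for a unfolding M_def using fin that by simp
    have M2: "M \<ge> 2" using ME[OF g] \<open>\<not> E g \<le> 1\<close> by simp
    then obtain r where r: "M = r + 2" by (metis add.commute le_Suc_ex)
    \<comment> \<open>All values of \<open>c\<close> have order dividing 2^M, and 2^M is attained at
      \<open>w\<close>. Raising \<open>c\<close> to the power 2^(M - 2) leaves fourth roots of
      unity, with order exactly 4 at \<open>w\<close>.\<close>
    define F where "F = (\<lambda>a. int (c a) ^ (2 ^ r))"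
    have four: "int p dvd F a ^ 4 - 1" if "a \<in> carrier G" for a
    proof -
      have "F a ^ 4 = int (c a) ^ (2 ^ M)"
        unfolding F_def r by (simp add: power_mult[symmetric] power_add mult.commute)
      then show ?thesis using up[OF ME] that by simp
    qed
    moreover have "int p dvd F (a \<otimes> b) - F a * F b" if "a \<in> carrier G" "b \<in> carrier G" for a b
      unfolding F_def using pw[OF cm[OF that]] by (simp add: power_mult_distrib)
    moreover have "int p dvd F w ^ 2 + 1"
    proof -
      have "\<not> int p dvd F w ^ 2 - 1"
      proof
        assume "int p dvd F w ^ 2 - 1"
        moreover have "F w ^ 2 = int (c w) ^ (2 ^ (r + 1))" unfolding F_def by (simp add: power_mult[symmetric] mult.commute)
        ultimately have "E w \<le> r + 1" using Emin by simp
        then show False using w r by simp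
      qed
      moreover have "F w ^ 4 - 1 = (F w ^ 2 - 1) * (F w ^ 2 + 1)"
        by (simp add: algebra_simps power2_eq_square power4_eq_xxxx)
      then have "int p dvd (F w ^ 2 - 1) * (F w ^ 2 + 1)" using four[OF w(1)] by simp
      ultimately show ?thesis using prime_dvd_mult_iff[OF ip(1)] by blast
    qed
    ultimately have "\<not> filled G" using character_of_order_4_not_filled[OF fin ip, of F w] w by blast
    then show False using fil by simp
  qed
  have pm: "int p dvd int (c g) - 1 \<or> int p dvd int (c g) + 1" if "g \<in> carrier G" for g
  proof -
    have "int (c g) ^ 2 - 1 = (int (c g) - 1) * (int (c g) + 1)" by (simp add: algebra_simps power2_eq_square)
    then show ?thesis using sq[OF that] prime_dvd_mult_iff[OF ip(1)] by metis
  qed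
  have ker: "\<exists>i::nat. g = x [^] i" if g: "g \<in> carrier G" "int p dvd int (c g) - 1" for g
  proof -
    have "x [^] c g = x [^] (1::nat)" using g(2) peq[of "c g" 1] by simp
    then show ?thesis using cent[OF g(1)] c[OF g(1)] x by simp
  qed
  have red: "x [^] i = x [^] (i mod p)" for i :: nat
    unfolding peq by (metis dvd_minus_mod int_ops(9) of_nat_mod)
  show ?thesis
  proof (cases "\<forall>g\<in>carrier G. int p dvd int (c g) - 1")
    case True
    have "carrier G \<subseteq> (\<lambda>i::nat. x [^] i) ` {..<p}"
    proof
      fix g assume "g \<in> carrier G"
      then obtain i :: nat where "g = x [^] i" using ker True by blast
      then have "g = x [^] (i mod p)" using red by metis
      then show "g \<in> (\<lambda>i::nat. x [^] i) ` {..<p}" using p0 by simp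
    qed
    then show ?thesis using x by auto
  next
    case False
    then obtain s where s: "s \<in> carrier G" "\<not> int p dvd int (c s) - 1" by blast
    then have cs: "int p dvd int (c s) + 1" using pm by blast
    have p2: "\<not> int p dvd 2"
      using ip by (metis dvd_refl even_numeral prime_ge_2_int zdvd_imp_le zero_less_numeral order_antisym)
    have "int p dvd int (c s + 1) - int 0" using cs by (simp add: add.commute)
    then have "x [^] (c s + 1) = x [^] (0::nat)" using peq by blast
    then have "x [^] c s \<otimes> x = \<one>" using x by simp
    then have "x [^] c s = inv x" using x by (metis inv_equality nat_pow_closed inv_inv)
    then have sx: "s \<otimes> x \<otimes> inv s = inv x" using c s by simp
    have prod: "int p dvd int (c (g \<otimes> s)) - 1" if g: "g \<in> carrier G" "int p dvd int (c g) + 1" for g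
    proof -
      show ?thesis
        by (rule dvd_combination3[OF cm[OF g(1) s(1)] g(2) cs, where k = 1 and l = "int (c s)" and m = "-1"])
          (simp add: algebra_simps)
    qed
    obtain j :: nat where j: "s \<otimes> s = x [^] j" using ker[of "s \<otimes> s"] prod[OF s(1) cs] s by auto
    \<comment> \<open>The square of \<open>s\<close> is a power of \<open>x\<close> that commutes
      with \<open>s\<close>, while \<open>s\<close> inverts all powers of \<open>x\<close>. As
      \<open>p\<close> is odd, this square is 1.\<close>
    have "x [^] j = s \<otimes> x [^] j \<otimes> inv s" unfolding j[symmetric] using s by (simp add: m_assoc)
    also have "\<dots> = inv (x [^] j)" using conj_pow[of s x j] s x sx by (simp add: nat_pow_inv)
    finally have "x [^] j \<otimes> x [^] j = \<one>" using x by (metis nat_pow_closed r_inv)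
    then have "x [^] (j + j) = x [^] (0::nat)" using x by (simp add: nat_pow_mult)
    then have "int p dvd 2 * int j" using peq[of "j + j" 0] by simp
    then have "int p dvd int j" using p2 prime_dvd_mult_iff[OF ip(1)] by blast
    then have "x [^] j = x [^] (0::nat)" using peq[of j 0] by simp
    then have ss: "s \<otimes> s = \<one>" using j x by simp
    have sxe: "s \<otimes> x = inv x \<otimes> s" using sx s x by (metis inv_solve_right' inv_closed m_closed)
    \<comment> \<open>For k = 0 every element would be a power of \<open>x\<close>, contradicting
      that \<open>s\<close> does not centralize \<open>x\<close>.\<close>
    have "2 * p \<le> order G"
    proof (cases k)
      case 0
      have o1: "order G = card {\<one>} * p" using ord 0 by simp
      have d1: "\<not> p dvd card {\<one>}" using p(1) not_prime_1 by auto
      obtain i q where "q \<in> {\<one>}" "s = x [^] (i::nat) \<otimes> q"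
        by (rule prime_power_complement[OF o1 p(1) x triv_subgroup d1 s(1)])
      then have "s = x [^] i" using x(1) by simp
      then have "s \<otimes> x \<otimes> inv s = x" using x by (metis inv_solve_right' m_closed nat_pow_Suc nat_pow_Suc2 nat_pow_closed)
      then have "x [^] c s = x [^] (1::nat)" using c s x by simp
      then show ?thesis using s peq[of "c s" 1] by simp
    next
      case (Suc k')
      then show ?thesis using ord by simp
    qed
    moreover have "\<exists>i::nat. g = x [^] i \<or> g = x [^] i \<otimes> s" if g: "g \<in> carrier G" for g
    proof -
      consider "int p dvd int (c g) - 1" | "int p dvd int (c g) + 1" using pm g by blast
      then show ?thesis
      proof cases
        case 1 then show ?thesis using ker g by blast
      next
        case 2
        then obtain i :: nat where "g \<otimes> s = x [^] i" using ker[of "g \<otimes> s"] prod g s by auto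
        then have "g \<otimes> s \<otimes> s = x [^] i \<otimes> s" by simp
        then show ?thesis using g s ss by (auto simp: m_assoc)
      qed
    qed
    ultimately have "G \<cong> dihedral_group p"
      using iso_dihedral_groupI[OF _ _ fin x(1,3) s(1) ss sxe] p0 by simp
    then show ?thesis by blast
  qed
qed

end

section \<open>Extensions of the dihedral group of order 6\<close>

text \<open>Projections let the simplifier compute with images \<open>h a\<close> that are not
  written as pairs.\<close>

lemma fst_mult_dihedral [simp]:
  "fst (u \<otimes>\<^bsub>dihedral_group m\<^esub> v) = (if snd u then fst u - fst v else fst u + fst v) mod int m"
  and snd_mult_dihedral [simp]: "snd (u \<otimes>\<^bsub>dihedral_group m\<^esub> v) = (snd u \<noteq> snd v)"
  and fst_one_dihedral [simp]: "fst \<one>\<^bsub>dihedral_group m\<^esub> = 0"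
  and snd_one_dihedral [simp]: "snd \<one>\<^bsub>dihedral_group m\<^esub> = False"
  by (cases u; cases v; simp add: dihedral_group_def)+

lemma fst_range_dihedral: "u \<in> carrier (dihedral_group m) \<Longrightarrow> 0 \<le> fst u \<and> fst u < int m"
  by (auto simp: dihedral_group_def)

lemma inv_dihedral:
  assumes "u \<in> carrier (dihedral_group m)"
  shows "inv\<^bsub>dihedral_group m\<^esub> u = (if snd u then u else ((- fst u) mod int m, False))"
proof -
  have m: "m \<ge> 1" using fst_range_dihedral[OF assms] by linarith
  interpret D: group "dihedral_group m" by (rule group_dihedral_group[OF m])
  show ?thesis
    using assms m by (intro D.inv_equality) (auto simp: dihedral_group_def mod_simps)
qed

lemma fst_inv_dihedral [simp]: "u \<in> carrier (dihedral_group m) \<Longrightarrow>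
    fst (inv\<^bsub>dihedral_group m\<^esub> u) = (if snd u then fst u else (- fst u) mod int m)"
  and snd_inv_dihedral [simp]: "u \<in> carrier (dihedral_group m) \<Longrightarrow> snd (inv\<^bsub>dihedral_group m\<^esub> u) = snd u"
  by (simp_all add: inv_dihedral)

context group_hom
begin

lemma card_fibre:
  assumes a: "a \<in> carrier G"
  shows "card {u \<in> carrier G. h u = h a} = card (kernel G H h)"
proof -
  have "{u \<in> carrier G. h u = h a} = (\<lambda>n. n \<otimes> a) ` kernel G H h"
  proof (intro equalityI subsetI)
    fix u assume u: "u \<in> {u \<in> carrier G. h u = h a}"
    then have "u \<otimes> inv a \<in> kernel G H h" using a by (simp add: kernel_def)
    moreover have "u = u \<otimes> inv a \<otimes> a" using u a by (simp add: G.m_assoc)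
    ultimately show "u \<in> (\<lambda>n. n \<otimes> a) ` kernel G H h" by blast
  qed (use a in \<open>auto simp: kernel_def\<close>)
  moreover have "inj_on (\<lambda>n. n \<otimes> a) (kernel G H h)"
    using a by (intro inj_onI) (auto simp: kernel_def)
  ultimately show ?thesis by (simp add: card_image)
qed

lemma card_fibre_le:
  shows "card {u \<in> carrier G. h u = c} \<le> card (kernel G H h)"
proof (cases "\<exists>a\<in>carrier G. h a = c")
  case True then show ?thesis using card_fibre by auto
next
  case False
  then have "{u \<in> carrier G. h u = c} = {}" by blast
  then show ?thesis by (metis card.empty le0)
qed

end

text \<open>With \<open>b\<^sub>1, b\<^sub>2\<close> reflections that become involutions in \<open>Q\<close> and \<open>u = b\<^sub>1 b\<^sub>2\<close> over the rotation \<open>1\<close>, the set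
  consisting of the fibre over the rotation \<open>1\<close> without \<open>u K\<close> and of \<open>b\<^sub>1 K\<close> and \<open>b\<^sub>2 K\<close>,
  where \<open>K\<close> is the kernel of \<open>k\<close>, meets and covers nothing of the kernel of \<open>h\<close> outside \<open>K\<close>.\<close>

lemma reflection_involution_bound:
  fixes G (structure)
  assumes hD: "group_hom G (dihedral_group 3) h" and hQ: "group_hom G Q k"
    and fin: "finite (carrier G)" and surj: "h ` carrier G = carrier (dihedral_group 3)"
    and ker: "\<And>a. a \<in> carrier G \<Longrightarrow> k a = \<one>\<^bsub>Q\<^esub> \<Longrightarrow> h a = \<one>\<^bsub>dihedral_group 3\<^esub>"
    and s: "s \<in> carrier G" "snd (h s)" "k (s \<otimes> s) = \<one>\<^bsub>Q\<^esub>"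
    and fil: "filled G"
  shows "card (kernel G (dihedral_group 3) h) < 3 * card (kernel G Q k)"
proof (rule ccontr)
  assume big: "\<not> ?thesis"
  let ?D = "dihedral_group 3"
  interpret G: group G by (rule group_hom.axioms(1)[OF hD])
  interpret h: group_hom G ?D h by (rule hD)
  interpret k: group_hom G Q k by (rule hQ)
  note [simp] = G.inv_mult_cancel k.H.inv_mult_cancel
  have K1: "card (kernel G Q k) \<ge> 1"
  proof -
    have "\<one> \<in> kernel G Q k" by (simp add: kernel_def)
    moreover have "finite (kernel G Q k)" using fin by (simp add: kernel_def)
    ultimately show ?thesis by (metis One_nat_def Suc_leI card_gt_0_iff empty_iff)
  qed
  have rng: "fst (h a) = 0 \<or> fst (h a) = 1 \<or> fst (h a) = 2" if "a \<in> carrier G" for a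
    using fst_range_dihedral[OF h.hom_closed[OF that]] by simp linarith
  have hk: "h a = h b" if "a \<in> carrier G" "b \<in> carrier G" "k a = k b" for a b
  proof -
    have "h (a \<otimes> inv b) = \<one>\<^bsub>?D\<^esub>" using that by (intro ker) auto
    then have "h a \<otimes>\<^bsub>?D\<^esub> inv\<^bsub>?D\<^esub> (h b) = \<one>\<^bsub>?D\<^esub>" using that by simp
    then show ?thesis using that h.H.inv_solve_right'[of "\<one>\<^bsub>?D\<^esub>" "h a" "h b"] by simp
  qed
  have "(1, False) \<in> carrier ?D" by (simp add: dihedral_group_def)
  then obtain g where g: "g \<in> carrier G" "h g = (1, False)" using surj by (metis imageE)
  \<comment> \<open>Conjugation by the rotation 1 shifts the coordinate of a reflection by 2. The
    product of \<open>s\<close> and \<open>b\<close> therefore lies over the rotation -2, which is 1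
    modulo 3.\<close>
  define b where "b = g \<otimes> s \<otimes> inv g"
  have ig: "inv\<^bsub>?D\<^esub> (1, False) = (2, False)" using inv_dihedral[OF \<open>(1, False) \<in> carrier ?D\<close>] by simp
  have m3: "(i - 1) mod 3 = (i + 2) mod 3" for i :: int by presburger
  have b: "b \<in> carrier G" "snd (h b)" "fst (h b) = (fst (h s) + 2) mod 3"
    using g s by (auto simp: b_def ig m3 mod_simps)
  \<comment> \<open>Only the images in \<open>Q\<close> are assumed to be involutions: the bound is
    applied both with \<open>k\<close> the identity and with \<open>k\<close> the quotient map by a
    central subgroup of order 2.\<close>
  define \<beta>1 \<beta>2 w where "\<beta>1 = k s" and "\<beta>2 = k b" and "w = \<beta>1 \<otimes>\<^bsub>Q\<^esub> \<beta>2"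
  have \<beta>: "\<beta>1 \<in> carrier Q" "\<beta>2 \<in> carrier Q" "w \<in> carrier Q" using s b by (auto simp: \<beta>1_def \<beta>2_def w_def)
  have sq1: "\<beta>1 \<otimes>\<^bsub>Q\<^esub> \<beta>1 = \<one>\<^bsub>Q\<^esub>" using s by (simp add: \<beta>1_def)
  have sq2: "\<beta>2 \<otimes>\<^bsub>Q\<^esub> \<beta>2 = \<one>\<^bsub>Q\<^esub>"
  proof -
    have "\<beta>2 = k g \<otimes>\<^bsub>Q\<^esub> \<beta>1 \<otimes>\<^bsub>Q\<^esub> inv\<^bsub>Q\<^esub> (k g)" using g(1) s(1) by (simp add: b_def \<beta>1_def \<beta>2_def)
    then have "\<beta>2 \<otimes>\<^bsub>Q\<^esub> \<beta>2 = k g \<otimes>\<^bsub>Q\<^esub> (\<beta>1 \<otimes>\<^bsub>Q\<^esub> \<beta>1) \<otimes>\<^bsub>Q\<^esub> inv\<^bsub>Q\<^esub> (k g)"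
      using g(1) \<beta>(1) by (simp add: k.H.m_assoc)
    then show ?thesis using sq1 g(1) by simp
  qed
  have inv\<beta>: "inv\<^bsub>Q\<^esub> \<beta>1 = \<beta>1" "inv\<^bsub>Q\<^esub> \<beta>2 = \<beta>2"
    using k.H.inv_equality[OF sq1] k.H.inv_equality[OF sq2] \<beta> by auto
  have c1: "\<beta>1 \<otimes>\<^bsub>Q\<^esub> (\<beta>1 \<otimes>\<^bsub>Q\<^esub> a) = a" "\<beta>2 \<otimes>\<^bsub>Q\<^esub> (\<beta>2 \<otimes>\<^bsub>Q\<^esub> a) = a" if "a \<in> carrier Q" for a
    using that sq1 sq2 \<beta> by (simp_all add: k.H.m_assoc[symmetric])
  have c2: "a = \<beta>1" if "a \<in> carrier Q" "a \<otimes>\<^bsub>Q\<^esub> \<beta>2 = w" for a using that \<beta> by (simp add: w_def)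
  have c3: "a = \<beta>2" if "a \<in> carrier Q" "\<beta>1 \<otimes>\<^bsub>Q\<^esub> a = w" for a using that \<beta> by (simp add: w_def)
  have c4: "a = w" if "a \<in> carrier Q" "a \<otimes>\<^bsub>Q\<^esub> \<beta>2 = \<beta>1" for a
  proof -
    have "a = a \<otimes>\<^bsub>Q\<^esub> (\<beta>2 \<otimes>\<^bsub>Q\<^esub> \<beta>2)" using sq2 that(1) by simp
    also have "\<dots> = a \<otimes>\<^bsub>Q\<^esub> \<beta>2 \<otimes>\<^bsub>Q\<^esub> \<beta>2" using that(1) \<beta> by (simp only: k.H.m_assoc)
    also have "\<dots> = w" unfolding that(2) w_def ..
    finally show ?thesis .
  qed
  have c5: "a = w" if "a \<in> carrier Q" "\<beta>1 \<otimes>\<^bsub>Q\<^esub> a = \<beta>2" for a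
  proof -
    have "\<beta>1 \<otimes>\<^bsub>Q\<^esub> (\<beta>1 \<otimes>\<^bsub>Q\<^esub> a) = w" using that by (simp add: w_def)
    then show ?thesis using c1(1)[OF that(1)] by metis
  qed
  define R where "R = (\<lambda>u. u \<in> carrier G \<and> h u = (1, False))"
  \<comment> \<open>The factor 3 enters here: a fibre of \<open>h\<close> is too large to be covered
    by two fibres of \<open>k\<close>.\<close>
  have pick: "\<exists>u. R u \<and> k u \<noteq> \<alpha> \<and> k u \<noteq> \<gamma>" for \<alpha> \<gamma>
  proof (rule ccontr)
    assume "\<not> ?thesis"
    then have "{u \<in> carrier G. h u = h g} \<subseteq> {u \<in> carrier G. k u = \<alpha>} \<union> {u \<in> carrier G. k u = \<gamma>}"
      using g by (auto simp: R_def)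
    then have "card {u \<in> carrier G. h u = h g} \<le> card ({u \<in> carrier G. k u = \<alpha>} \<union> {u \<in> carrier G. k u = \<gamma>})"
      using fin by (intro card_mono) auto
    also have "\<dots> \<le> card {u \<in> carrier G. k u = \<alpha>} + card {u \<in> carrier G. k u = \<gamma>}" by (rule card_Un_le)
    also have "\<dots> \<le> 2 * card (kernel G Q k)" using k.card_fibre_le[of \<alpha>] k.card_fibre_le[of \<gamma>] by simp
    finally show False using h.card_fibre[OF g(1)] big K1 by simp
  qed
  define S where "S = {u. R u \<and> k u \<noteq> w} \<union> {u \<in> carrier G. k u = \<beta>1} \<union> {u \<in> carrier G. k u = \<beta>2}"
  have lab1: "snd (h u) \<and> fst (h u) = fst (h s)" if "u \<in> carrier G" "k u = \<beta>1" for u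
    using hk[of u s] that s by (simp add: \<beta>1_def)
  have lab2: "snd (h u) \<and> fst (h u) = (fst (h s) + 2) mod 3" if "u \<in> carrier G" "k u = \<beta>2" for u
    using hk[of u b] that b by (simp add: \<beta>2_def)
  have SG: "S \<subseteq> carrier G" by (auto simp: S_def R_def)
  have ir: "fst (h s) = 0 \<or> fst (h s) = 1 \<or> fst (h s) = 2" using rng s by blast
  have pf: "product_free G S"
    unfolding product_free_iff
  proof (intro conjI ballI SG)
    show "S \<noteq> {}" using s(1) by (auto simp: S_def \<beta>1_def)
    fix u v assume u: "u \<in> S" and v: "v \<in> S"
    have uv: "u \<in> carrier G" "v \<in> carrier G" using u v SG by auto
    have cs: "R a \<and> k a \<noteq> w \<or> snd (h a) \<and> fst (h a) = fst (h s) \<and> k a = \<beta>1 \<or>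
      snd (h a) \<and> fst (h a) = (fst (h s) + 2) mod 3 \<and> k a = \<beta>2" if "a \<in> S" for a
      using that lab1 lab2 unfolding S_def by blast
    show "u \<otimes> v \<notin> S"
    proof
      assume "u \<otimes> v \<in> S"
      note c = cs[OF this] cs[OF u] cs[OF v]
      have kq: "k u \<in> carrier Q" "k v \<in> carrier Q" using uv by auto
      have kuv: "k (u \<otimes> v) = k u \<otimes>\<^bsub>Q\<^esub> k v" "h (u \<otimes> v) = h u \<otimes>\<^bsub>?D\<^esub> h v" using uv by auto
      show False
        using c ir c4[OF kq(1)] c5[OF kq(2)] unfolding R_def kuv prod_eq_iff
        by (elim disjE conjE) (simp_all add: w_def)
    qed
  qed
  have main: "w0 \<notin> T \<and> (\<forall>a\<in>T. \<forall>b\<in>T. a \<otimes> b \<noteq> w0)"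
    if T: "product_free G T" "S \<subseteq> T" and w0: "w0 \<in> carrier G" "h w0 = \<one>\<^bsub>?D\<^esub>" "k w0 \<noteq> \<one>\<^bsub>Q\<^esub>" for T w0
  proof -
    have no: "\<And>s t. s \<in> T \<Longrightarrow> t \<in> T \<Longrightarrow> s \<otimes> t \<notin> T" using T(1) by (rule product_free_mult)
    have TG: "t \<in> carrier G" if "t \<in> T" for t using that product_free_subset[OF T(1)] by blast
    have UT: "u \<in> T" if "u \<in> carrier G" "fst (h u) = 1" "\<not> snd (h u)" "k u \<noteq> w" for u
      using that T(2) by (auto simp: S_def R_def prod_eq_iff)
    have sT: "s \<in> T" using s T(2) by (auto simp: S_def \<beta>1_def)
    have bT: "b \<in> T" using b T(2) by (auto simp: S_def \<beta>2_def)
    have t0: "\<not> (fst (h t) = 0 \<and> \<not> snd (h t))" if t: "t \<in> T" for t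
    proof
      assume l: "fst (h t) = 0 \<and> \<not> snd (h t)"
      have tG: "t \<in> carrier G" using TG t .
      \<comment> \<open>The two exceptions keep both \<open>u\<close> and
        \<open>t \<otimes> u\<close> off the removed coset, so both belong to
        \<open>S\<close>.\<close>
      obtain u where u: "R u" "k u \<noteq> w" "k u \<noteq> inv\<^bsub>Q\<^esub> (k t) \<otimes>\<^bsub>Q\<^esub> w" using pick by blast
      have uG: "u \<in> carrier G" "fst (h u) = 1" "\<not> snd (h u)" using u(1) by (auto simp: R_def)
      have "k t \<otimes>\<^bsub>Q\<^esub> k u \<noteq> w" using u(3) uG(1) tG \<beta>(3) by (metis k.H.inv_solve_left k.hom_closed)
      then have "t \<otimes> u \<in> T" using uG tG l by (intro UT) auto
      then show False using no[OF t UT[OF uG u(2)]] by blast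
    qed
    have t1: "k t \<noteq> w" if t: "t \<in> T" for t
    proof
      assume e: "k t = w"
      have tG: "t \<in> carrier G" using TG t .
      have "k (inv s \<otimes> t) = \<beta>2" using e tG s(1) c1 inv\<beta> \<beta> by (simp add: \<beta>1_def[symmetric] w_def)
      then have "inv s \<otimes> t \<in> T" using T(2) s(1) tG by (auto simp: S_def)
      then have "s \<otimes> (inv s \<otimes> t) \<notin> T" using no sT by blast
      then show False using t tG s(1) by simp
    qed
    have t2: "\<not> (fst (h t) = 2 \<and> \<not> snd (h t))" if t: "t \<in> T" for t
    proof
      assume l: "fst (h t) = 2 \<and> \<not> snd (h t)"
      have tG: "t \<in> carrier G" using TG t .
      obtain u where u: "R u" "k u \<noteq> w" "k u \<noteq> k t \<otimes>\<^bsub>Q\<^esub> inv\<^bsub>Q\<^esub> w" using pick by blast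
      have uG: "u \<in> carrier G" "fst (h u) = 1" "\<not> snd (h u)" using u(1) by (auto simp: R_def)
      have "inv\<^bsub>Q\<^esub> (k u) \<otimes>\<^bsub>Q\<^esub> k t \<noteq> w"
      proof
        assume "inv\<^bsub>Q\<^esub> (k u) \<otimes>\<^bsub>Q\<^esub> k t = w"
        then have "k t = k u \<otimes>\<^bsub>Q\<^esub> w" using uG(1) tG \<beta>(3) k.H.inv_solve_left' by simp
        then show False using u(3) uG(1) tG \<beta>(3) by (simp add: k.H.m_assoc)
      qed
      then have "inv u \<otimes> t \<in> T" using uG tG l by (intro UT) auto
      then have "u \<otimes> (inv u \<otimes> t) \<notin> T" using no UT[OF uG u(2)] by blast
      then show False using t tG uG(1) by simp
    qed
    have t3: "k t = \<beta>1" if t: "t \<in> T" "snd (h t)" "fst (h t) = fst (h s)" for t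
    proof (rule ccontr)
      assume n: "k t \<noteq> \<beta>1"
      have tG: "t \<in> carrier G" using TG t by blast
      let ?u = "t \<otimes> inv b"
      have "k ?u = k t \<otimes>\<^bsub>Q\<^esub> \<beta>2" using tG b(1) inv\<beta> by (simp add: \<beta>2_def[symmetric])
      then have "k ?u \<noteq> w" using c2[of "k t"] n tG by auto
      moreover have "fst (h ?u) = 1" using tG b t ir by auto
      moreover have "\<not> snd (h ?u)" using tG b t by simp
      ultimately have "?u \<in> T" using tG b(1) by (intro UT) auto
      then have "?u \<otimes> b \<notin> T" using no bT by blast
      then show False using t tG b(1) by (simp add: G.m_assoc)
    qed
    have t4: "k t = \<beta>2" if t: "t \<in> T" "snd (h t)" "fst (h t) = (fst (h s) + 2) mod 3" for t
    proof (rule ccontr)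
      assume n: "k t \<noteq> \<beta>2"
      have tG: "t \<in> carrier G" using TG t by blast
      let ?u = "inv s \<otimes> t"
      have "k ?u = \<beta>1 \<otimes>\<^bsub>Q\<^esub> k t" using tG s(1) inv\<beta> by (simp add: \<beta>1_def[symmetric])
      then have "k ?u \<noteq> w" using c3[of "k t"] n tG by auto
      moreover have "fst (h ?u) = 1" using tG s t ir by auto
      moreover have "\<not> snd (h ?u)" using tG s t by simp
      ultimately have "?u \<in> T" using tG s(1) by (intro UT) auto
      then have "s \<otimes> ?u \<notin> T" using no sT by blast
      then show False using t tG s(1) by simp
    qed
    \<comment> \<open>Reflections with the third coordinate may belong to \<open>T\<close>, but all
      with one and the same image in \<open>Q\<close>. That image is an involution by
      \<open>sqw\<close>, so their products, too, die in \<open>Q\<close>.\<close>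
    have t5: "k t = w \<otimes>\<^bsub>Q\<^esub> \<beta>1" if t: "t \<in> T" "snd (h t)" "fst (h t) = (fst (h s) + 1) mod 3" for t
    proof -
      have tG: "t \<in> carrier G" using TG t by blast
      have "fst (h (t \<otimes> s)) = 1" "\<not> snd (h (t \<otimes> s))" using tG s t ir by auto
      then have "k (t \<otimes> s) = w" using UT[of "t \<otimes> s"] no[OF t(1) sT] tG s(1) by auto
      then have "k t \<otimes>\<^bsub>Q\<^esub> \<beta>1 = w" using tG s(1) by (simp add: \<beta>1_def)
      then have "k t \<otimes>\<^bsub>Q\<^esub> \<beta>1 \<otimes>\<^bsub>Q\<^esub> \<beta>1 = w \<otimes>\<^bsub>Q\<^esub> \<beta>1" by simp
      then show ?thesis using tG \<beta> sq1 by (simp add: k.H.m_assoc)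
    qed
    have sqw: "w \<otimes>\<^bsub>Q\<^esub> \<beta>1 \<otimes>\<^bsub>Q\<^esub> (w \<otimes>\<^bsub>Q\<^esub> \<beta>1) = \<one>\<^bsub>Q\<^esub>"
      using \<beta> c1 sq1 by (simp add: w_def k.H.m_assoc)
    have "a \<otimes> c \<noteq> w0" if ac: "a \<in> T" "c \<in> T" for a c
    proof
      assume e: "a \<otimes> c = w0"
      have acG: "a \<in> carrier G" "c \<in> carrier G" using ac TG by auto
      have hac: "h a \<otimes>\<^bsub>?D\<^esub> h c = \<one>\<^bsub>?D\<^esub>" using e w0(2) acG by (metis h.hom_mult)
      have sn: "snd (h a) = snd (h c)" using arg_cong[OF hac, of snd] by simp
      have fs: "(if snd (h a) then fst (h a) - fst (h c) else fst (h a) + fst (h c)) mod 3 = 0"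
        using arg_cong[OF hac, of fst] by simp
      note ra = rng[OF acG(1)] and rc = rng[OF acG(2)]
      show False
      proof (cases "snd (h a)")
        case False
        then have "fst (h a) = 1" "fst (h c) = 1" using t0 t2 ac sn ra rc by auto
        then show False using fs False by simp
      next
        case True
        then have f: "fst (h a) = fst (h c)" using fs ra rc by auto
        have "k a \<otimes>\<^bsub>Q\<^esub> k c = \<one>\<^bsub>Q\<^esub>"
        proof -
          consider "fst (h a) = fst (h s)" | "fst (h a) = (fst (h s) + 2) mod 3" | "fst (h a) = (fst (h s) + 1) mod 3"
            using ra ir by auto
          then show ?thesis
          proof cases
            case 1 then show ?thesis using t3[OF ac(1)] t3[OF ac(2)] True sn f sq1 by simp
          next
            case 2 then show ?thesis using t4[OF ac(1)] t4[OF ac(2)] True sn f sq2 by simp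
          next
            case 3 then show ?thesis using t5[OF ac(1)] t5[OF ac(2)] True sn f sqw by simp
          qed
        qed
        then show False using e w0(3) acG by auto
      qed
    qed
    moreover have "w0 \<notin> T" using t0[of w0] w0(2) by auto
    ultimately show ?thesis by blast
  qed
  obtain w0 where w0: "w0 \<in> carrier G" "h w0 = \<one>\<^bsub>?D\<^esub>" "k w0 \<noteq> \<one>\<^bsub>Q\<^esub>"
  proof -
    have "\<not> kernel G ?D h \<subseteq> kernel G Q k"
    proof
      assume "kernel G ?D h \<subseteq> kernel G Q k"
      then have "card (kernel G ?D h) \<le> card (kernel G Q k)" using fin by (intro card_mono) (auto simp: kernel_def)
      then show False using big K1 by simp
    qed
    then show thesis using that by (auto simp: kernel_def)
  qed
  then have "w0 \<noteq> \<one>" by auto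
  then have "\<not> filled G" using not_filledI[OF fin pf w0(1)] main[OF _ _ w0] by blast
  then show False using fil by simp
qed

section \<open>Quotient maps and induced homomorphisms\<close>

lemma (in normal) quotient_group_hom: "group_hom G (G Mod H) (\<lambda>a. H #> a)"
  unfolding group_hom_def group_hom_axioms_def
  using is_group factorgroup_is_group r_coset_hom_Mod by blast

lemma (in normal) rcoset_eq_self_iff: "a \<in> carrier G \<Longrightarrow> H #> a = H \<longleftrightarrow> a \<in> H"
  using coset_join1 coset_join2 subgroup_axioms subset by metis

lemma (in normal) kernel_quotient: "kernel G (G Mod H) (\<lambda>a. H #> a) = H"
  using rcoset_eq_self_iff subset by (auto simp: kernel_def)

lemma (in normal) filled_quotient: "filled G \<Longrightarrow> filled (G Mod H)"
  using group_hom.filled_image[OF quotient_group_hom] by (simp add: carrier_FactGroup)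

lemma (in normal) quotient_induced_hom:
  assumes h: "group_hom G K h" and ker: "H \<subseteq> kernel G K h"
  obtains h' where "group_hom (G Mod H) K h'" "\<And>a. a \<in> carrier G \<Longrightarrow> h' (H #> a) = h a"
proof -
  interpret h: group_hom G K h by (rule h)
  have "h a = h b" if "a \<in> carrier G" "b \<in> carrier G" "H #> a = H #> b" for a b
  proof -
    have "a \<in> H #> b" using that rcos_self[OF that(1) subgroup_axioms] by simp
    then obtain c where "c \<in> H" "a = c \<otimes> b" by (auto simp: r_coset_def)
    then show ?thesis using that ker by (auto simp: kernel_def)
  qed
  from FactGroup_universal[OF h.homh normal_axioms this]
  obtain h' where "h' \<in> hom (G Mod H) K" "\<And>a. a \<in> carrier G \<Longrightarrow> h' (H #> a) = h a" by blast
  then show thesis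
    using that[of h'] factorgroup_is_group h.H.is_group by (simp add: group_hom_def group_hom_axioms_def)
qed

lemma (in group_hom) order_eq_image_kernel:
  assumes "h ` carrier G = carrier H"
  shows "order G = order H * card (kernel G H h)"
proof -
  have "card (rcosets kernel G H h) * card (kernel G H h) = order G"
    by (rule G.lagrange[OF subgroup_kernel])
  moreover have "order (G Mod kernel G H h) = order H"
    using FactGroup_iso[OF assms] iso_same_order unfolding is_iso_def by blast
  ultimately show ?thesis by (simp add: order_def FactGroup_def)
qed

text \<open>The assumptions single out a minimal quotient without involutory reflections. Some reflection \<open>s\<close>
  has its square in the group of central elements of exponent 2 of the kernel \<open>N\<close>; multiplying \<open>s\<close> by
  a rotation conjugate of \<open>s\<^sup>2\<close> replaces the square by the product \<open>\<tau>\<close> of the three conjugates,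
  which is central in the whole group. The bound for reflection involutions modulo \<open>\<tau>\<close> gives
  \<open>card N \<le> 4\<close>, so every reflection has square \<open>\<tau>\<close>, and a locally maximal product-free set
  containing \<open>\<tau>\<close> has no reflections.\<close>

lemma minimal_extension_contradiction:
  fixes G (structure)
  assumes hD: "group_hom G (dihedral_group 3) h"
    and fin: "finite (carrier G)" and surj: "h ` carrier G = carrier (dihedral_group 3)"
    and card: "card (kernel G (dihedral_group 3) h) = 2 ^ m"
    and fil: "filled G"
    and no: "\<And>s. s \<in> carrier G \<Longrightarrow> snd (h s) \<Longrightarrow> s \<otimes>\<^bsub>G\<^esub> s \<noteq> \<one>\<^bsub>G\<^esub>"
    and ind: "\<And>K. K \<lhd> G \<Longrightarrow> K \<subseteq> kernel G (dihedral_group 3) h \<Longrightarrow> K \<noteq> {\<one>\<^bsub>G\<^esub>} \<Longrightarrow>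
      \<exists>s\<in>carrier G. snd (h s) \<and> s \<otimes>\<^bsub>G\<^esub> s \<in> K"
  shows False
proof -
  let ?D = "dihedral_group 3"
  interpret group G by (rule group_hom.axioms(1)[OF hD])
  interpret h: group_hom G ?D h by (rule hD)
  define N where "N = kernel G ?D h"
  have N: "subgroup N G" "N \<lhd> G" unfolding N_def by (rule h.subgroup_kernel, rule h.normal_kernel)
  have NG: "N \<subseteq> carrier G" using N(1) by (rule subgroup.subset)
  have Nm: "a \<otimes> b \<in> N" if "a \<in> N" "b \<in> N" for a b using subgroup.m_closed[OF N(1)] that .
  have Nc: "g \<otimes> a \<otimes> inv g \<in> N" if "g \<in> carrier G" "a \<in> N" for a g
    using normal.inv_op_closed2[OF N(2)] that by blast
  have NI: "a \<in> N" if "a \<in> carrier G" "fst (h a) = 0" "\<not> snd (h a)" for a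
    using that by (simp add: N_def kernel_def prod_eq_iff)
  have NE: "h a = \<one>\<^bsub>?D\<^esub>" if "a \<in> N" for a using that by (simp add: N_def kernel_def)
  have rng: "fst (h a) = 0 \<or> fst (h a) = 1 \<or> fst (h a) = 2" if "a \<in> carrier G" for a
    using fst_range_dihedral[OF h.hom_closed[OF that]] by simp linarith
  have lab: "\<exists>g\<in>carrier G. fst (h g) = i \<and> snd (h g) = b" if "0 \<le> i" "i < 3" for i b
  proof -
    have "(i, b) \<in> h ` carrier G" using surj that by (simp add: dihedral_group_def)
    then obtain g where "g \<in> carrier G" "h g = (i, b)" by (metis imageE)
    then show ?thesis by (metis fst_conv snd_conv)
  qed
  obtain r where r: "r \<in> carrier G" "snd (h r)" using lab[of 0 True] by auto
  have "r \<otimes> r \<in> N" using r by (intro NI) auto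
  moreover have "r \<otimes> r \<noteq> \<one>" using no r by blast
  ultimately have "N \<noteq> {\<one>}" by blast
  then have "card N \<noteq> 1" using subgroup.one_closed[OF N(1)] by (auto simp: card_1_singleton_iff)
  then have m0: "m > 0" using card by (cases m) (auto simp: N_def)
  interpret N: group "G\<lparr>carrier := N\<rparr>" using N(1) by (rule subgroup_imp_group)
  let ?N = "G\<lparr>carrier := N\<rparr>"
  have oN: "order ?N = 2 ^ m" using card by (simp add: order_def N_def)
  obtain c where c0: "c \<in> carrier ?N" "c \<noteq> \<one>\<^bsub>?N\<^esub>" "c \<otimes>\<^bsub>?N\<^esub> c = \<one>\<^bsub>?N\<^esub>"
    "\<And>g. g \<in> carrier ?N \<Longrightarrow> g \<otimes>\<^bsub>?N\<^esub> c = c \<otimes>\<^bsub>?N\<^esub> g"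
    using N.two_group_central_involution[OF oN m0] by metis
  have c: "c \<in> N" "c \<noteq> \<one>" "c \<otimes> c = \<one>" using c0(1-3) by simp_all
  have cN: "g \<otimes> c = c \<otimes> g" if "g \<in> N" for g using c0(4)[of g] that by auto
  define K where "K = {n \<in> N. n \<otimes> n = \<one> \<and> (\<forall>a\<in>N. a \<otimes> n = n \<otimes> a)}"
  have KN: "n \<in> N" "n \<in> carrier G" "n \<otimes> n = \<one>" if "n \<in> K" for n using that NG by (auto simp: K_def)
  have Kcomm: "a \<otimes> n = n \<otimes> a" if "n \<in> K" "a \<in> N" for a n using that by (simp add: K_def)
  have Kconj: "g \<otimes> n \<otimes> inv g \<in> K" if g: "g \<in> carrier G" and n: "n \<in> K" for g n
    unfolding K_def
  proof (intro CollectI conjI ballI)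
    show "g \<otimes> n \<otimes> inv g \<in> N" using Nc g KN n by blast
    show "g \<otimes> n \<otimes> inv g \<otimes> (g \<otimes> n \<otimes> inv g) = \<one>" using conj_mult[of g n n] g KN[OF n] by simp
    fix a assume a: "a \<in> N"
    have aG: "a \<in> carrier G" using a NG by blast
    have a': "inv g \<otimes> a \<otimes> g \<in> N" using Nc[of "inv g" a] g a by simp
    have "a \<otimes> (g \<otimes> n \<otimes> inv g) = g \<otimes> ((inv g \<otimes> a \<otimes> g) \<otimes> n) \<otimes> inv g"
      using g aG KN[OF n] by (simp add: m_assoc)
    also have "\<dots> = g \<otimes> (n \<otimes> (inv g \<otimes> a \<otimes> g)) \<otimes> inv g" using Kcomm[OF n a'] by simp
    also have "\<dots> = g \<otimes> n \<otimes> inv g \<otimes> a" using g aG KN[OF n] by (simp add: m_assoc)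
    finally show "a \<otimes> (g \<otimes> n \<otimes> inv g) = g \<otimes> n \<otimes> inv g \<otimes> a" .
  qed
  have Kmult: "a \<otimes> b \<in> K" if a: "a \<in> K" and b: "b \<in> K" for a b
    unfolding K_def
  proof (intro CollectI conjI ballI)
    show "a \<otimes> b \<in> N" using Nm KN a b by blast
    have "a \<otimes> b \<otimes> (a \<otimes> b) = a \<otimes> (b \<otimes> a) \<otimes> b" using KN[OF a] KN[OF b] by (simp add: m_assoc)
    also have "b \<otimes> a = a \<otimes> b" using Kcomm[OF a KN(1)[OF b]] .
    also have "a \<otimes> (a \<otimes> b) \<otimes> b = (a \<otimes> a) \<otimes> (b \<otimes> b)" using KN(2)[OF a] KN(2)[OF b] by (simp add: m_assoc)
    finally show "a \<otimes> b \<otimes> (a \<otimes> b) = \<one>" using KN[OF a] KN[OF b] by simp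
    fix d assume d: "d \<in> N"
    have dG: "d \<in> carrier G" using d NG by blast
    have "d \<otimes> (a \<otimes> b) = (d \<otimes> a) \<otimes> b" using dG KN[OF a] KN[OF b] by (simp add: m_assoc)
    also have "\<dots> = a \<otimes> (d \<otimes> b)" using Kcomm[OF a d] dG KN[OF a] KN[OF b] by (simp add: m_assoc)
    also have "\<dots> = a \<otimes> b \<otimes> d" using Kcomm[OF b d] dG KN[OF a] KN[OF b] by (simp add: m_assoc)
    finally show "d \<otimes> (a \<otimes> b) = a \<otimes> b \<otimes> d" .
  qed
  have "c \<in> K" using c cN unfolding K_def by blast
  have "subgroup K G"
  proof (rule subgroupI)
    show "K \<subseteq> carrier G" using KN by blast
    show "K \<noteq> {}" using \<open>c \<in> K\<close> by blast
    show "inv a \<in> K" if "a \<in> K" for a using inv_equality[OF KN(3)[OF that]] KN[OF that] that by simp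
  qed (rule Kmult)
  then have "K \<lhd> G" unfolding normal_inv_iff using Kconj by blast
  moreover have "K \<noteq> {\<one>}" using \<open>c \<in> K\<close> c by blast
  moreover have "K \<subseteq> kernel G ?D h" using KN by (auto simp: N_def)
  ultimately obtain s where s: "s \<in> carrier G" "snd (h s)" "s \<otimes> s \<in> K" using ind by blast
  define cj where "cj = (\<lambda>g n. g \<otimes> n \<otimes> inv g)"
  have cjc: "cj a (cj b n) = cj (a \<otimes> b) n" if "a \<in> carrier G" "b \<in> carrier G" "n \<in> carrier G" for a b n
    unfolding cj_def using conj_conj that by simp
  have cjm: "cj g (a \<otimes> b) = cj g a \<otimes> cj g b" if "a \<in> carrier G" "b \<in> carrier G" "g \<in> carrier G" for a b g
    unfolding cj_def using conj_mult that by simp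
  have cjK: "cj g n \<in> K" if "g \<in> carrier G" "n \<in> K" for g n unfolding cj_def using Kconj that .
  \<comment> \<open>As \<open>K\<close> is central in \<open>N\<close>, the conjugation action of
    the group on \<open>K\<close> factors through the dihedral group of order 6.\<close>
  have cjlab: "cj a n = cj b n" if a: "a \<in> carrier G" and b: "b \<in> carrier G" and e: "h a = h b" and n: "n \<in> K" for a b n
  proof -
    have "a \<otimes> inv b \<in> N" using a b e by (intro NI) (simp_all add: mod_simps)
    then have e: "(a \<otimes> inv b) \<otimes> cj b n = cj b n \<otimes> (a \<otimes> inv b)" using Kcomm[OF cjK[OF b n]] by simp
    have "cj (a \<otimes> inv b) (cj b n) = (a \<otimes> inv b) \<otimes> cj b n \<otimes> inv (a \<otimes> inv b)" by (simp add: cj_def)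
    then have "cj (a \<otimes> inv b) (cj b n) = cj b n"
      unfolding e using a b KN(2)[OF cjK[OF b n]] m_assoc[of "cj b n" "a \<otimes> inv b" "inv (a \<otimes> inv b)"]
      by (simp del: inv_mult_group)
    moreover have "cj (a \<otimes> inv b) (cj b n) = cj a n" using cjc[of "a \<otimes> inv b" b n] a b KN(2)[OF n] by (simp add: m_assoc)
    ultimately show ?thesis by simp
  qed
  obtain y where y: "y \<in> carrier G" "fst (h y) = 1" "\<not> snd (h y)" using lab[of 1 False] by auto
  \<comment> \<open>The element \<open>s\<close> commutes with its square \<open>z\<close> and
    interchanges \<open>z1\<close> and \<open>z2\<close>, while \<open>y\<close> permutes the three
    cyclically; so their product is fixed by all conjugations. Its factors stand in the order in
    which they arise from the square of \<open>s \<otimes> z1\<close>.\<close>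
  define z z1 z2 \<tau> where "z = s \<otimes> s" and "z1 = cj y z" and "z2 = cj (inv y) z" and "\<tau> = z2 \<otimes> z \<otimes> z1"
  have zK: "z \<in> K" "z1 \<in> K" "z2 \<in> K" "\<tau> \<in> K"
    using s y cjK Kmult by (auto simp: z_def z1_def z2_def \<tau>_def)
  note zG = KN(2)[OF zK(1)] KN(2)[OF zK(2)] KN(2)[OF zK(3)] KN(2)[OF zK(4)]
  have cc: "a \<otimes> b = b \<otimes> a" if "a \<in> K" "b \<in> K" for a b using Kcomm KN that by blast
  have sz: "cj s z = z" using s(1) by (simp add: cj_def z_def m_assoc)
  have heq: "h a = h b" if "fst (h a) = fst (h b)" "snd (h a) = snd (h b)" for a b using that by (simp add: prod_eq_iff)
  have m3: "(i - 1) mod 3 = (2 + i) mod 3" "(i - 2) mod 3 = (1 + i) mod 3" for i :: int by presburger+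
  have sz1: "cj s z1 = z2"
  proof -
    have "cj s z1 = cj (s \<otimes> y) z" unfolding z1_def using cjc s y zG by simp
    also have "\<dots> = cj (inv y \<otimes> s) z"
      using s y zK by (intro cjlab heq) (auto simp: mod_simps m3)
    also have "\<dots> = cj (inv y) (cj s z)" using cjc s y zG by simp
    finally show ?thesis using sz by (simp add: z2_def)
  qed
  have sz2: "cj s z2 = z1"
  proof -
    have "cj s z2 = cj (s \<otimes> inv y) z" unfolding z2_def using cjc s y zG by simp
    also have "\<dots> = cj (y \<otimes> s) z"
    proof (intro cjlab heq)
      show "fst (h (s \<otimes> inv y)) = fst (h (y \<otimes> s))" using s y by (simp add: m3)
    qed (use s y zK in auto)
    also have "\<dots> = cj y (cj s z)" using cjc s y zG by simp
    finally show ?thesis using sz by (simp add: z1_def)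
  qed
  have yz1: "cj y z1 = z2"
  proof -
    have "cj y z1 = cj (y \<otimes> y) z" unfolding z1_def using cjc y zG by simp
    also have "\<dots> = cj (inv y) z" using y zK by (intro cjlab heq) auto
    finally show ?thesis by (simp add: z2_def)
  qed
  have yz2: "cj y z2 = z"
    unfolding z2_def using cjc[of y "inv y" z] y zG by (simp add: cj_def)
  define t where "t = s \<otimes> z1"
  have t: "t \<in> carrier G" "snd (h t)" using s zG NE[OF KN(1)[OF zK(2)]] by (auto simp: t_def)
  have tt: "t \<otimes> t = \<tau>"
  proof -
    have "t \<otimes> t = cj s z1 \<otimes> (s \<otimes> s) \<otimes> z1" using s(1) zG by (simp add: t_def cj_def m_assoc)
    then show ?thesis by (simp add: sz1 z_def \<tau>_def)
  qed
  have \<tau>1: "\<tau> \<noteq> \<one>" using no[OF t] tt by simp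
  have \<tau>s: "cj s \<tau> = \<tau>"
  proof -
    have "cj s \<tau> = z1 \<otimes> z \<otimes> z2" unfolding \<tau>_def using cjm s zG by (simp add: sz sz1 sz2)
    also have "\<dots> = z2 \<otimes> (z1 \<otimes> z)" using cc[OF Kmult[OF zK(2,1)] zK(3)] .
    also have "\<dots> = z2 \<otimes> (z \<otimes> z1)" using cc[OF zK(2,1)] by simp
    finally show ?thesis using zG by (simp add: \<tau>_def m_assoc)
  qed
  have \<tau>y: "cj y \<tau> = \<tau>"
  proof -
    have "cj y \<tau> = z \<otimes> z1 \<otimes> z2" unfolding \<tau>_def using cjm y zG by (simp add: yz1 yz2 z1_def[symmetric])
    also have "\<dots> = z2 \<otimes> (z \<otimes> z1)" using cc[OF Kmult[OF zK(1,2)] zK(3)] .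
    finally show ?thesis using zG by (simp add: \<tau>_def m_assoc)
  qed
  have \<tau>iy: "cj (y \<otimes> y) \<tau> = \<tau>" using cjc[of y y \<tau>] y zG \<tau>y by simp
  have \<tau>c: "cj g \<tau> = \<tau>" if g: "g \<in> carrier G" for g
  proof -
    have sr: "fst (h s) = 0 \<or> fst (h s) = 1 \<or> fst (h s) = 2" using rng s by blast
    have one: "cj \<one> \<tau> = \<tau>" using zG by (simp add: cj_def)
    have ys: "cj (y \<otimes> s) \<tau> = \<tau>" "cj (y \<otimes> y \<otimes> s) \<tau> = \<tau>"
      using cjc[of y s \<tau>] cjc[of "y \<otimes> y" s \<tau>] y s zG \<tau>s \<tau>y \<tau>iy by auto
    have "\<exists>b\<in>{\<one>, y, y \<otimes> y, s, y \<otimes> s, y \<otimes> y \<otimes> s}. h g = h b"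
      using rng[OF g] sr s y by (cases "snd (h g)") (auto simp: prod_eq_iff)
    then obtain b where b: "b \<in> {\<one>, y, y \<otimes> y, s, y \<otimes> s, y \<otimes> y \<otimes> s}" "h g = h b" by blast
    then have "b \<in> carrier G" using y s by auto
    then have "cj g \<tau> = cj b \<tau>" using cjlab g b(2) zK(4) by blast
    then show ?thesis using b(1) one ys \<tau>s \<tau>y \<tau>iy by auto
  qed
  have \<tau>comm: "g \<otimes> \<tau> = \<tau> \<otimes> g" if g: "g \<in> carrier G" for g
  proof -
    have "g \<otimes> \<tau> = cj g \<tau> \<otimes> g" unfolding cj_def using g zG by (simp add: m_assoc)
    then show ?thesis using \<tau>c[OF g] by simp
  qed
  define L where "L = {\<one>, \<tau>}"
  have \<tau>\<tau>: "\<tau> \<otimes> \<tau> = \<one>" "inv \<tau> = \<tau>" using KN(3)[OF zK(4)] inv_equality zG by auto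
  have L: "subgroup L G"
    using zG \<tau>\<tau> by (intro subgroupI) (auto simp: L_def)
  have Ln: "L \<lhd> G"
    unfolding normal_inv_iff using L \<tau>c by (auto simp: L_def cj_def)
  have LN: "L \<subseteq> N" using KN(1)[OF zK(4)] subgroup.one_closed[OF N(1)] by (auto simp: L_def)
  interpret L: normal L G by (rule Ln)
  have cL: "card L = 2" using \<tau>1 by (simp add: L_def)
  have "card (kernel G ?D h) < 3 * card (kernel G (G Mod L) (\<lambda>a. L #> a))"
  proof (rule reflection_involution_bound[OF hD L.quotient_group_hom fin surj _ t _ fil])
    fix a assume "a \<in> carrier G" "L #> a = \<one>\<^bsub>G Mod L\<^esub>"
    then have "a \<in> L" using L.rcoset_eq_self_iff by simp
    then show "h a = \<one>\<^bsub>?D\<^esub>" using LN NE by blast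
  next
    have "t \<otimes> t \<in> L" by (simp add: tt L_def)
    then show "L #> (t \<otimes> t) = \<one>\<^bsub>G Mod L\<^esub>" using L.rcoset_eq_self_iff t by simp
  qed
  then have cN6: "card N < 6" unfolding L.kernel_quotient cL N_def by simp
  have finN: "finite N" using NG fin finite_subset by blast
  have c5: "card N \<noteq> 5"
  proof
    assume "card N = 5"
    then have "odd (card N)" by simp
    then show False using card m0 by (simp add: N_def)
  qed
  have sq: "t \<otimes> n \<otimes> (t \<otimes> n) = \<tau>" if n: "n \<in> N" for n
  proof -
    have nG: "n \<in> carrier G" using n NG by blast
    define n' where "n' = cj t n"
    have n': "n' \<in> N" "n' \<in> carrier G" using Nc t n NG by (auto simp: n'_def cj_def)
    have "t \<otimes> n \<otimes> (t \<otimes> n) = n' \<otimes> (t \<otimes> t) \<otimes> n" using t nG by (simp add: n'_def cj_def m_assoc)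
    also have "\<dots> = \<tau> \<otimes> (n' \<otimes> n)" using \<tau>comm[OF n'(2)] nG n' zG by (simp add: tt m_assoc)
    finally have e: "t \<otimes> n \<otimes> (t \<otimes> n) = \<tau> \<otimes> (n' \<otimes> n)" .
    \<comment> \<open>Conjugation by \<open>t\<close> preserves \<open>L\<close>, and with
      \<open>card N\<close> at most 4 there is at most one other coset of \<open>L\<close> in
      \<open>N\<close>. If the claim failed, the elements of \<open>L\<close>, their products with
      \<open>inv n\<close>, and \<open>n'\<close> would be five distinct members of
      \<open>N\<close>.\<close>
    have "n' \<otimes> n \<in> L"
    proof (cases "n \<in> L")
      case True
      then have "n' = n" using \<tau>c[OF t(1)] t(1) by (auto simp: L_def n'_def cj_def)
      then show ?thesis using True L subgroup.m_closed by metis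
    next
      case False
      have n'L: "n' \<notin> L"
      proof
        assume "n' \<in> L"
        then have "cj (inv t) n' = n'" using \<tau>c[of "inv t"] t(1) by (auto simp: L_def cj_def)
        moreover have "cj (inv t) n' = n" unfolding n'_def using cjc[of "inv t" t n] t nG by (simp add: cj_def)
        ultimately show False using \<open>n' \<in> L\<close> False by simp
      qed
      show ?thesis
      proof (rule ccontr)
        assume nL: "n' \<otimes> n \<notin> L"
        have i: "inv n \<in> N" using subgroup.m_inv_closed[OF N(1) n] .
        have iL: "inv n \<notin> L" using False L subgroup.m_inv_closed nG by (metis inv_inv)
        have 1: "n' \<noteq> inv n" using nL nG by (auto simp: L_def)
        have 2: "n' \<noteq> \<tau> \<otimes> inv n" using nL nG zG by (auto simp: L_def m_assoc)
        have 3: "\<tau> \<otimes> inv n \<noteq> inv n" using \<tau>1 nG zG by simp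
        have 4: "\<tau> \<otimes> inv n \<notin> L"
        proof
          assume "\<tau> \<otimes> inv n \<in> L"
          then have "\<tau> \<otimes> (\<tau> \<otimes> inv n) \<in> L" using L subgroup.m_closed by (metis L_def insertCI)
          then show False using iL nG zG \<tau>\<tau> by (simp add: m_assoc[symmetric])
        qed
        have card5: "card {a1, a2, a3, a4, a5} = 5"
          if "a1 \<noteq> a2" "a3 \<notin> {a1, a2}" "a4 \<notin> {a1, a2}" "a5 \<notin> {a1, a2}" "a3 \<noteq> a4" "a3 \<noteq> a5" "a4 \<noteq> a5"
          for a1 a2 a3 a4 a5 :: 'a
          using that by auto
        have "card {\<one>, \<tau>, inv n, \<tau> \<otimes> inv n, n'} = 5"
          by (rule card5) (use 1 2 3 4 iL n'L \<tau>1 in \<open>metis L_def\<close>)+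
        moreover have "{\<one>, \<tau>, inv n, \<tau> \<otimes> inv n, n'} \<subseteq> N"
          using i n' LN Nm by (auto simp: L_def)
        ultimately have "5 \<le> card N" using card_mono[OF finN] by metis
        then show False using cN6 c5 by simp
      qed
    qed
    then have "t \<otimes> n \<otimes> (t \<otimes> n) \<in> {\<one>, \<tau>}" unfolding e using zG \<tau>\<tau> by (auto simp: L_def)
    moreover have "snd (h (t \<otimes> n))" using t nG NE[OF n] by simp
    then have "t \<otimes> n \<otimes> (t \<otimes> n) \<noteq> \<one>" using no t nG by simp
    ultimately show ?thesis by blast
  qed
  have all: "g \<otimes> g = \<tau>" if g: "g \<in> carrier G" "snd (h g)" for g
  proof -
    \<comment> \<open>Conjugation by the inverse of a rotation \<open>d\<close> changes the
      coordinate of a reflection by -2 d, which is d modulo 3. So every reflection is conjugate to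
      one in the coset of \<open>t\<close>, and \<tau> is central.\<close>
    obtain d where d: "d \<in> carrier G" "fst (h d) = (fst (h t) - fst (h g)) mod 3" "\<not> snd (h d)"
      using lab[of "(fst (h t) - fst (h g)) mod 3" False] by auto
    let ?q = "inv d \<otimes> g \<otimes> d"
    have qG: "?q \<in> carrier G" using d g by simp
    have tr: "fst (h t) = 0 \<or> fst (h t) = 1 \<or> fst (h t) = 2" using rng t by blast
    have "inv t \<otimes> ?q \<in> N"
      using d g t rng[OF g(1)] tr by (intro NI) auto
    then have "t \<otimes> (inv t \<otimes> ?q) \<otimes> (t \<otimes> (inv t \<otimes> ?q)) = \<tau>" by (rule sq)
    then have "?q \<otimes> ?q = \<tau>" using t qG by simp
    then have "inv d \<otimes> (g \<otimes> g) \<otimes> d = \<tau>" using d g by (simp add: m_assoc)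
    then have "cj d (inv d \<otimes> (g \<otimes> g) \<otimes> d) = \<tau>" using \<tau>c[OF d(1)] by simp
    then show ?thesis using d g by (simp add: cj_def m_assoc)
  qed
  have pf: "product_free G {\<tau>}" unfolding product_free_iff using zG \<tau>\<tau> \<tau>1 by simp
  have key: "t \<notin> T \<and> (\<forall>a\<in>T. \<forall>b\<in>T. a \<otimes> b \<noteq> t)" if T: "product_free G T" "{\<tau>} \<subseteq> T" for T
  proof -
    have TG: "a \<in> carrier G" if "a \<in> T" for a using that product_free_subset[OF T(1)] by blast
    have nr: "\<not> snd (h a)" if "a \<in> T" for a
      using all[OF TG[OF that]] product_free_mult[OF T(1) that that] T(2) by auto
    have "a \<otimes> b \<noteq> t" if "a \<in> T" "b \<in> T" for a b
    proof
      assume "a \<otimes> b = t"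
      then have "snd (h (a \<otimes> b))" using t by simp
      then show False using nr that TG by simp
    qed
    then show ?thesis using nr t by blast
  qed
  have "t \<noteq> \<one>" using t by auto
  then have "\<not> filled G" using not_filledI[OF fin pf t(1)] key by blast
  then show False using fil by simp
qed

text \<open>If there were none, take \<open>M\<close> largest among the normal subgroups inside the
  kernel that contain no square of a reflection; {1} is one of them. The quotient by
  \<open>M\<close> is filled, has no involutory reflection, and by the choice of \<open>M\<close>
  every nontrivial normal subgroup of it inside the new kernel contains the square of a reflection.
  This is the situation of \<open>minimal_extension_contradiction\<close>.\<close>

lemma reflection_involution_exists:
  fixes G (structure)
  assumes hD: "group_hom G (dihedral_group 3) h"
    and fin: "finite (carrier G)" and surj: "h ` carrier G = carrier (dihedral_group 3)"
    and card: "card (kernel G (dihedral_group 3) h) = 2 ^ m"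
    and fil: "filled G"
  obtains s where "s \<in> carrier G" "snd (h s)" "s \<otimes> s = \<one>"
proof (rule ccontr)
  assume neg: "\<not> thesis"
  let ?D = "dihedral_group 3"
  interpret group G by (rule group_hom.axioms(1)[OF hD])
  interpret h: group_hom G ?D h by (rule hD)
  define N where "N = kernel G ?D h"
  have N: "subgroup N G" unfolding N_def by (rule h.subgroup_kernel)
  define B where "B = {M. M \<lhd> G \<and> M \<subseteq> N \<and> (\<forall>s\<in>carrier G. snd (h s) \<longrightarrow> s \<otimes> s \<notin> M)}"
  have "finite B"
    by (rule finite_subset[of _ "Pow (carrier G)"]) (use fin in \<open>auto simp: B_def N_def kernel_def\<close>)
  moreover have "{\<one>} \<in> B"
    unfolding B_def using neg that one_is_normal subgroup.one_closed[OF N] by auto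
  ultimately obtain M where M: "M \<in> B" and mx: "\<And>L. L \<in> B \<Longrightarrow> card L \<le> card M"
    using finite_max_witness[of B _ card] by metis
  have Mn: "M \<lhd> G" and MN: "M \<subseteq> N" and Mno: "\<And>s. s \<in> carrier G \<Longrightarrow> snd (h s) \<Longrightarrow> s \<otimes> s \<notin> M"
    using M by (auto simp: B_def)
  interpret M: normal M G by (rule Mn)
  let ?F = "G Mod M"
  interpret \<pi>: group_hom G ?F "\<lambda>a. M #> a" by (rule M.quotient_group_hom)
  obtain h' where h': "group_hom ?F ?D h'" "\<And>a. a \<in> carrier G \<Longrightarrow> h' (M #> a) = h a"
    using M.quotient_induced_hom[OF hD] MN unfolding N_def by blast
  interpret h': group_hom ?F ?D h' by (rule h'(1))
  have Fc: "carrier ?F = (\<lambda>a. M #> a) ` carrier G" by (rule carrier_FactGroup)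
  have kF: "kernel ?F ?D h' = (\<lambda>a. M #> a) ` N"
    using h'(2) by (auto simp: kernel_def Fc N_def)
  interpret NG: group "G\<lparr>carrier := N\<rparr>" using N by (rule subgroup_imp_group)
  have "card (rcosets\<^bsub>G\<lparr>carrier := N\<rparr>\<^esub> M) * card M = order (G\<lparr>carrier := N\<rparr>)"
    using subgroup_incl[OF M.subgroup_axioms N MN] by (rule NG.lagrange)
  moreover have "rcosets\<^bsub>G\<lparr>carrier := N\<rparr>\<^esub> M = kernel ?F ?D h'"
    unfolding kF by (auto simp: RCOSETS_def)
  ultimately have "card (kernel ?F ?D h') dvd 2 ^ m"
    using card by (simp add: order_def N_def) (metis dvd_triv_left)
  then obtain l where l: "card (kernel ?F ?D h') = 2 ^ l" by (auto simp: divides_primepow_nat)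
  show False
  proof (rule minimal_extension_contradiction[OF h'(1) _ _ l M.filled_quotient[OF fil]])
    show "finite (carrier ?F)" using fin by (simp add: Fc)
    show "h' ` carrier ?F = carrier ?D"
      unfolding Fc image_image using surj h'(2) by (metis (no_types, lifting) image_cong)
    fix \<sigma> assume s: "\<sigma> \<in> carrier ?F" "snd (h' \<sigma>)"
    then obtain a where a: "a \<in> carrier G" "\<sigma> = M #> a" by (auto simp: Fc)
    show "\<sigma> \<otimes>\<^bsub>?F\<^esub> \<sigma> \<noteq> \<one>\<^bsub>?F\<^esub>"
    proof
      assume "\<sigma> \<otimes>\<^bsub>?F\<^esub> \<sigma> = \<one>\<^bsub>?F\<^esub>"
      then have "M #> (a \<otimes> a) = M" using a \<pi>.hom_mult[OF a(1) a(1)] by (metis one_FactGroup)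
      then have "a \<otimes> a \<in> M" using M.rcoset_eq_self_iff[of "a \<otimes> a"] a(1) by blast
      then show False using Mno[OF a(1)] s(2) a h'(2) by simp
    qed
  next
    fix K assume K: "K \<lhd> ?F" "K \<subseteq> kernel ?F ?D h'" "K \<noteq> {\<one>\<^bsub>?F\<^esub>}"
    interpret K: normal K ?F by (rule K(1))
    define L where "L = {a \<in> carrier G. M #> a \<in> K}"
    have "L \<lhd> G"
      unfolding normal_inv_iff
    proof (intro conjI ballI)
      show "subgroup L G"
      proof (rule subgroupI)
        show "L \<subseteq> carrier G" by (auto simp: L_def)
        have "\<one> \<in> L" using K.one_closed M.rcoset_eq_self_iff[of \<one>] M.one_closed by (simp add: L_def)
        then show "L \<noteq> {}" by blast
        fix a assume a: "a \<in> L"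
        then show "inv a \<in> L" using K.m_inv_closed[of "M #> a"] by (simp add: L_def)
        fix b assume "b \<in> L"
        then show "a \<otimes> b \<in> L" using a K.m_closed[of "M #> a" "M #> b"] by (simp add: L_def)
      qed
      fix g a assume g: "g \<in> carrier G" and a: "a \<in> L"
      have aG: "a \<in> carrier G" using a by (simp add: L_def)
      have "M #> (g \<otimes> a \<otimes> inv g) = (M #> g) \<otimes>\<^bsub>?F\<^esub> (M #> a) \<otimes>\<^bsub>?F\<^esub> inv\<^bsub>?F\<^esub> (M #> g)"
        using g aG \<pi>.hom_inv[OF g] \<pi>.hom_mult[of "g \<otimes> a" "inv g"] \<pi>.hom_mult[of g a] by simp
      moreover have "(M #> g) \<otimes>\<^bsub>?F\<^esub> (M #> a) \<otimes>\<^bsub>?F\<^esub> inv\<^bsub>?F\<^esub> (M #> g) \<in> K"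
        using K.inv_op_closed2[of "M #> g" "M #> a"] a g by (simp add: L_def Fc)
      ultimately show "g \<otimes> a \<otimes> inv g \<in> L" using g aG by (simp add: L_def)
    qed
    moreover have "L \<subseteq> N"
      using K(2) h'(2) by (auto simp: L_def N_def kernel_def)
    moreover have "card M < card L"
    proof (rule psubset_card_mono)
      show "finite L" using fin by (simp add: L_def)
      have "M \<subseteq> L"
      proof
        fix a assume a: "a \<in> M"
        then have "M #> a = M" using M.rcoset_eq_self_iff M.subset by blast
        then show "a \<in> L" using a K.one_closed M.subset by (auto simp: L_def)
      qed
      moreover have "L \<noteq> M"
      proof
        assume LM: "L = M"
        have "K \<subseteq> {\<one>\<^bsub>?F\<^esub>}"
        proof
          fix \<kappa> assume k: "\<kappa> \<in> K"
          then obtain a where a: "a \<in> carrier G" "\<kappa> = M #> a" using K.subset by (auto simp: Fc)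
          then have "a \<in> M" using k LM by (auto simp: L_def)
          then show "\<kappa> \<in> {\<one>\<^bsub>?F\<^esub>}" using a M.rcoset_eq_self_iff by simp
        qed
        then show False using K(3) K.one_closed by blast
      qed
      ultimately show "M \<subset> L" by blast
    qed
    ultimately have "\<not> (\<forall>s\<in>carrier G. snd (h s) \<longrightarrow> s \<otimes> s \<notin> L)"
      using mx[of L] unfolding B_def by auto
    then obtain s where s: "s \<in> carrier G" "snd (h s)" "s \<otimes> s \<in> L" by blast
    then have "(M #> s) \<otimes>\<^bsub>?F\<^esub> (M #> s) \<in> K" using \<pi>.hom_mult[OF s(1) s(1)] by (simp add: L_def)
    moreover have "M #> s \<in> carrier ?F" "snd (h' (M #> s))" using s h'(2) by (auto simp: Fc)
    ultimately show "\<exists>s\<in>carrier ?F. snd (h' s) \<and> s \<otimes>\<^bsub>?F\<^esub> s \<in> K" by blast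
  qed
qed

text \<open>The kernel {1, z} is central. The involution \<open>s\<close> inverts \<open>x\<close>
  up to a kernel factor \<open>n\<close>; comparing cubes gives n = 1, since elements of order 2 are
  their own cubes. Then \<open>s\<close> inverts y = x z as well, and y^3 = z and y^4 = x recover
  all rotations from \<open>y\<close>.\<close>

lemma dihedral_3_double_extension:
  fixes G (structure)
  assumes hD: "group_hom G (dihedral_group 3) h"
    and fin: "finite (carrier G)" and surj: "h ` carrier G = carrier (dihedral_group 3)"
    and card: "card (kernel G (dihedral_group 3) h) = 2"
    and x: "x \<in> carrier G" "x [^] (3::nat) = \<one>" "h x \<noteq> \<one>\<^bsub>dihedral_group 3\<^esub>"
    and s: "s \<in> carrier G" "snd (h s)" "s \<otimes> s = \<one>"
  shows "G \<cong> dihedral_group 6"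
proof -
  let ?D = "dihedral_group 3"
  interpret group G by (rule group_hom.axioms(1)[OF hD])
  interpret h: group_hom G ?D h by (rule hD)
  define N where "N = kernel G ?D h"
  have N: "subgroup N G" "N \<lhd> G" unfolding N_def by (rule h.subgroup_kernel, rule h.normal_kernel)
  have NG: "N \<subseteq> carrier G" using N(1) by (rule subgroup.subset)
  have "\<one> \<in> N" using subgroup.one_closed[OF N(1)] .
  then obtain z where z: "N = {\<one>, z}" "z \<noteq> \<one>"
  proof -
    obtain a b where ab: "N = {a, b}" "a \<noteq> b" using card unfolding N_def by (auto simp: card_2_iff)
    have "a = \<one> \<or> b = \<one>" using \<open>\<one> \<in> N\<close> ab by blast
    then show thesis using that[of a] that[of b] ab by (auto simp: insert_commute)
  qed
  have zG: "z \<in> carrier G" using z NG by blast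
  have zN: "z \<in> N" using z by blast
  have NI: "a \<in> N" if "a \<in> carrier G" "fst (h a) = 0" "\<not> snd (h a)" for a
    using that by (simp add: N_def kernel_def prod_eq_iff)
  have hz: "h z = \<one>\<^bsub>?D\<^esub>" using zN by (simp add: N_def kernel_def)
  have zz: "z \<otimes> z = \<one>" using subgroup.m_closed[OF N(1) zN zN] z zG by auto
  have zc: "g \<otimes> z = z \<otimes> g" if g: "g \<in> carrier G" for g
  proof -
    have "g \<otimes> z \<otimes> inv g \<in> N" using normal.inv_op_closed2[OF N(2) g zN] .
    moreover have "g \<otimes> z \<otimes> inv g \<noteq> \<one>"
    proof
      assume "g \<otimes> z \<otimes> inv g = \<one>"
      then have "inv g \<otimes> (g \<otimes> z \<otimes> inv g) \<otimes> g = \<one>" using g by simp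
      then show False using z(2) g zG by (simp add: m_assoc)
    qed
    ultimately have "g \<otimes> z \<otimes> inv g = z" using z by blast
    then show ?thesis using inv_solve_right'[of z "g \<otimes> z" g] g zG by simp
  qed
  have rng: "fst (h a) = 0 \<or> fst (h a) = 1 \<or> fst (h a) = 2" if "a \<in> carrier G" for a
    using fst_range_dihedral[OF h.hom_closed[OF that]] by simp linarith
  have x3: "x \<otimes> x \<otimes> x = \<one>" using x(1,2) by (simp add: numeral_3_eq_3)
  have "h x \<otimes>\<^bsub>?D\<^esub> h x \<otimes>\<^bsub>?D\<^esub> h x = \<one>\<^bsub>?D\<^esub>" using arg_cong[OF x3, of h] x(1) by simp
  from arg_cong[OF this, of snd] have nx: "\<not> snd (h x)" by simp
  have fx: "fst (h x) = 1 \<or> fst (h x) = 2"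
    using x(3) nx rng[OF x(1)] by (auto simp: prod_eq_iff)
  define n where "n = x \<otimes> (s \<otimes> x \<otimes> inv s)"
  have n: "n \<in> N" using x s nx rng[OF s(1)] fx by (intro NI) (auto simp: n_def)
  have sxs: "s \<otimes> x \<otimes> inv s = inv x \<otimes> n" using x s by (simp add: n_def m_assoc)
  have nG: "n \<in> carrier G" using n NG by blast
  have nc: "g \<otimes> n = n \<otimes> g" if "g \<in> carrier G" for g using n z zc[OF that] that by auto
  have "n = \<one>"
  proof -
    have "(s \<otimes> x \<otimes> inv s) [^] (3::nat) = \<one>" using conj_pow[of s x 3] x s by simp
    then have "(inv x \<otimes> n) [^] (3::nat) = \<one>" by (simp add: sxs)
    moreover have "(inv x \<otimes> n) [^] (3::nat) = inv x [^] (3::nat) \<otimes> n [^] (3::nat)"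
      by (rule pow_mult_distrib) (use nc x nG in auto)
    moreover have "inv x [^] (3::nat) = \<one>" using x by (simp add: nat_pow_inv)
    moreover have "n [^] (3::nat) = n" using n z zz zG by (auto simp: numeral_3_eq_3)
    ultimately show ?thesis using nG by simp
  qed
  then have sx: "s \<otimes> x = inv x \<otimes> s" using sxs s x by (metis inv_closed inv_solve_right' m_closed r_one)
  define y where "y = x \<otimes> z"
  have yG: "y \<in> carrier G" using x zG by (simp add: y_def)
  have ypow: "y [^] (i::nat) = x [^] i \<otimes> z [^] i" for i
    unfolding y_def by (rule pow_mult_distrib) (use zc x zG in auto)
  have z2: "z [^] (2::nat) = \<one>" using zz zG by (simp add: numeral_2_eq_2)
  have z34: "z [^] (3::nat) = z" "z [^] (4::nat) = \<one>" "z [^] (6::nat) = \<one>"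
  proof -
    show "z [^] (3::nat) = z" using nat_pow_mult[OF zG, of 2 1] zG unfolding z2 by simp
    show "z [^] (4::nat) = \<one>" using nat_pow_pow[OF zG, of 2 2] unfolding z2 by simp
    show "z [^] (6::nat) = \<one>" using nat_pow_pow[OF zG, of 2 3] unfolding z2 by simp
  qed
  have x46: "x [^] (4::nat) = x" "x [^] (6::nat) = \<one>"
  proof -
    show "x [^] (4::nat) = x" using nat_pow_mult[OF x(1), of 3 1] x(1) unfolding x(2) by simp
    show "x [^] (6::nat) = \<one>" using nat_pow_pow[OF x(1), of 3 2] unfolding x(2) by simp
  qed
  have y346: "y [^] (3::nat) = z" "y [^] (4::nat) = x" "y [^] (6::nat) = \<one>"
    using ypow[of 3] ypow[of 4] ypow[of 6] z34 x46 x zG by auto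
  have sy: "s \<otimes> y = inv y \<otimes> s"
  proof -
    have "inv z = z" using inv_equality[OF zz] zG by simp
    then have iy: "inv y = z \<otimes> inv x" using x zG by (simp add: y_def inv_mult_group)
    have "s \<otimes> y = inv x \<otimes> s \<otimes> z" using sx s x zG by (simp add: y_def m_assoc[symmetric])
    also have "\<dots> = z \<otimes> (inv x \<otimes> s)" using zc[of "inv x \<otimes> s"] x s by simp
    finally show ?thesis using iy x s zG by (simp add: m_assoc)
  qed
  have rot: "\<exists>i::nat. g = y [^] i" if g: "g \<in> carrier G" "\<not> snd (h g)" for g
  proof -
    have "\<exists>e\<in>{0, 1, 2::nat}. fst (h (g \<otimes> inv (x [^] e))) = 0"
      using rng[OF g(1)] fx nx g x by (auto simp: numeral_2_eq_2)
    then obtain e :: nat where e: "fst (h (g \<otimes> inv (x [^] e))) = 0" by blast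
    have "\<not> snd (h (x [^] i))" for i :: nat using nx x by (induction i) auto
    then have "g \<otimes> inv (x [^] e) \<in> N" using e g x by (intro NI) auto
    then consider "g \<otimes> inv (x [^] e) = \<one>" | "g \<otimes> inv (x [^] e) = z" using z by blast
    then have "g = x [^] e \<or> g = z \<otimes> x [^] e"
      by cases (use g x zG in \<open>auto simp: inv_solve_right'\<close>)
    moreover have "x [^] e = y [^] (4 * e)" using y346(2) yG nat_pow_pow[of y 4 e] by simp
    ultimately have "g = y [^] (4 * e) \<or> g = y [^] (3 + 4 * e)"
      using y346(1) yG nat_pow_mult[of y 3 "4 * e"] by auto
    then show ?thesis by blast
  qed
  have "order G = 12" using h.order_eq_image_kernel[OF surj] card order_dihedral_group[of 3] by simp
  then have "2 * 6 \<le> order G" by simp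
  moreover have "\<exists>i::nat. g = y [^] i \<or> g = y [^] i \<otimes> s" if g: "g \<in> carrier G" for g
  proof (cases "snd (h g)")
    case False then show ?thesis using rot g by blast
  next
    case True
    then obtain i :: nat where "g \<otimes> s = y [^] i" using rot[of "g \<otimes> s"] g s by auto
    then have "g \<otimes> s \<otimes> s = y [^] i \<otimes> s" by simp
    then show ?thesis using g s by (auto simp: m_assoc)
  qed
  ultimately show ?thesis
    using iso_dihedral_groupI[OF _ _ fin yG y346(3) s(1,3) sy] by simp
qed

section \<open>The classification\<close>

lemma large_dihedral_prime_not_filled:
  assumes p: "Factorial_Ring.prime (p::nat)" "p \<ge> 13"
  shows "\<not> filled (dihedral_group p)"
proof -
  have "\<not> 2 dvd p" using p(1) primes_dvd_imp_eq[OF two_is_prime_nat p(1)] p(2) by auto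
  moreover have "\<not> 3 dvd p" using primes_dvd_imp_eq[of 3 p] p by auto
  ultimately have "p \<noteq> 14" "p \<noteq> 15" by presburger+
  define q where "q = p div 4"
  have q: "4 * q \<le> p" "p \<le> 4 * q + 3" unfolding q_def by presburger+
  show ?thesis
  \<comment> \<open>With w = 0 the upper bound reads p \<le> 5 q - 2 for q = p div 4. From 13 on it
    fails only at 14, 15 and 19; the first two are not prime, and w = 1 repairs 19.\<close>
  proof (rule dihedral_group_not_filled[of "int q" "if p = 19 then 1 else 0"])
    show "int p \<le> 5 * int q + (if p = 19 then 1 else 0) - 2"
    proof (cases "p \<ge> 20")
      case True then show ?thesis using q by auto
    next
      case False
      then have "p \<in> {13, 16, 17, 18, 19}" using p(2) \<open>p \<noteq> 14\<close> \<open>p \<noteq> 15\<close> by auto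
      then show ?thesis by (auto simp: q_def)
    qed
    show "2 \<le> int q" using p(2) q by auto
    show "4 * int q + (if p = 19 then 1 else 0) \<le> int p" using q by auto
    show "0 \<le> (if p = 19 then 1 else 0 :: int)" by simp
    show "(if p = 19 then 1 else 0) \<le> int q - 2" using p(2) q by auto
  qed
qed

text \<open>If the quotient is cyclic of order p, then \<open>N\<close> has order 2^n, and n \<ge> 1
  supplies a nontrivial kernel element \<open>z\<close>. For p \<ge> 7 the quotient is already not
  filled; for p = 3 and p = 5 the witnesses exploit \<open>z\<close>.\<close>

lemma prime_quotient_not_filled:
  fixes G (structure)
  assumes "group G" and ord: "order G = 2 ^ n * p" "n \<ge> 1" and p: "Factorial_Ring.prime (p::nat)" "odd p"
    and N: "N \<lhd> G" "card N = 2 ^ m"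
    and x: "x \<in> carrier G" "x [^] p = \<one>" "x \<notin> N"
    and gen: "carrier (G Mod N) = (\<lambda>i::nat. (N #> x) [^]\<^bsub>G Mod N\<^esub> i) ` {..<p}"
  shows "\<not> filled G"
proof
  assume fil: "filled G"
  interpret group G by fact
  interpret N: normal N G by (rule N(1))
  let ?F = "G Mod N"
  let ?c = "N #> x"
  interpret \<pi>: group_hom G ?F "\<lambda>a. N #> a" by (rule N.quotient_group_hom)
  have surj: "(\<lambda>a. N #> a) ` carrier G = carrier ?F" by (simp add: carrier_FactGroup)
  have fin: "finite (carrier G)" using ord p order_gt_0_iff_finite by (simp add: prime_gt_0_nat)
  have finF: "finite (carrier ?F)" using gen by simp
  have c: "?c \<in> carrier ?F" "?c \<noteq> \<one>\<^bsub>?F\<^esub>" "?c [^]\<^bsub>?F\<^esub> p = \<one>\<^bsub>?F\<^esub>"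
  proof -
    show "?c \<in> carrier ?F" using x by (rule_tac \<pi>.hom_closed)
    show "?c \<noteq> \<one>\<^bsub>?F\<^esub>" using x N.rcoset_eq_self_iff by simp
    show "?c [^]\<^bsub>?F\<^esub> p = \<one>\<^bsub>?F\<^esub>" using N.FactGroup_pow[OF x(1), of p] x N.rcoset_eq_self_iff[of \<one>] by simp
  qed
  have inj: "inj_on (\<lambda>i::nat. ?c [^]\<^bsub>?F\<^esub> i) {..<p}"
  proof (rule inj_onI)
    fix i j assume "i \<in> {..<p}" "j \<in> {..<p}" "?c [^]\<^bsub>?F\<^esub> i = ?c [^]\<^bsub>?F\<^esub> j"
    then show "i = j" using \<pi>.H.prime_pow_eq_iff[OF c p(1), of i j] zdvd_imp_le[of "int p" "int i - int j"]
      zdvd_imp_le[of "int p" "int j - int i"] dvd_diff_commute[of "int p" "int i" "int j"]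
      by (cases i j rule: linorder_cases) auto
  qed
  have "order ?F = p" using gen inj by (simp add: order_def card_image)
  then have "2 ^ n * p = p * 2 ^ m"
    using \<pi>.order_eq_image_kernel[OF surj] ord(1) N(2) N.kernel_quotient by simp
  then have "(2::nat) ^ n = 2 ^ m" using p by (simp add: prime_gt_0_nat)
  then have "card N \<noteq> 1" using N(2) ord(2) by (metis one_less_numeral_iff one_less_power less_numeral_extra(4) semiring_norm(76) less_le_trans zero_less_one)
  then have "N \<noteq> {\<one>}" by auto
  then obtain z where z: "z \<in> N" "z \<noteq> \<one>" using N.one_closed by blast
  have zG: "z \<in> carrier G" using z N.subset by blast
  have hz: "N #> z = \<one>\<^bsub>?F\<^esub>" using N.rcoset_eq_self_iff[OF zG] z by simp
  consider "p = 3" | "p = 5" | "p \<ge> 7"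
  proof -
    have "p \<noteq> 0" "p \<noteq> 1" using p(1) by auto
    moreover have "p \<noteq> 2" "p \<noteq> 4" "p \<noteq> 6" using p(2) by auto
    ultimately have "p = 3 \<or> p = 5 \<or> p \<ge> 7" by presburger
    then show thesis using that by blast
  qed
  then show False
  proof cases
    case 1
    have "{..<p} = {0, 1, 2}" using 1 by auto
    moreover have sq: "?c [^]\<^bsub>?F\<^esub> (2::nat) = ?c \<otimes>\<^bsub>?F\<^esub> ?c"
      using \<pi>.H.nat_pow_mult[OF c(1), of 1 1] \<pi>.H.nat_pow_eone[OF c(1)] by (metis one_add_one)
    moreover have "?c [^]\<^bsub>?F\<^esub> (1::nat) = ?c" "?c [^]\<^bsub>?F\<^esub> (0::nat) = \<one>\<^bsub>?F\<^esub>"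
      using \<pi>.H.nat_pow_eone[OF c(1)] \<pi>.H.nat_pow_0 by blast+
    ultimately have "carrier ?F = {\<one>\<^bsub>?F\<^esub>, ?c, ?c \<otimes>\<^bsub>?F\<^esub> ?c}"
      unfolding gen by (simp only: image_insert image_empty)
    moreover have "?c \<otimes>\<^bsub>?F\<^esub> ?c \<noteq> \<one>\<^bsub>?F\<^esub>"
    proof -
      have "?c [^]\<^bsub>?F\<^esub> (2::nat) \<noteq> \<one>\<^bsub>?F\<^esub>" using \<pi>.H.prime_pow_eq_one_iff[OF c p(1), of 2] 1 by simp
      then show ?thesis unfolding sq .
    qed
    ultimately have "\<not> filled G" using \<pi>.index_3_not_filled[OF fin surj _ c(2) _ zG z(2) hz] by blast
    then show False using fil by simp
  next
    case 2
    have x5: "x [^] (5::nat) = \<one>" using x(2) 2 by simp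
    have cov: "(\<exists>i<5. k = ?c [^]\<^bsub>?F\<^esub> (i::nat)) \<or> k \<in> {} \<or> (\<exists>a\<in>{}. \<exists>i\<in>{1,2::nat}.
        k = ?c [^]\<^bsub>?F\<^esub> i \<otimes>\<^bsub>?F\<^esub> a \<or> k = a \<otimes>\<^bsub>?F\<^esub> ?c [^]\<^bsub>?F\<^esub> i)" if "k \<in> carrier ?F" for k
      using that unfolding gen 2 by auto
    have "\<not> filled G"
      by (rule \<pi>.quotient_5_not_filled[OF fin surj x(1) x5 refl c(2) zG z(2) hz _ _ _ cov]) auto
    then show False using fil by simp
  next
    case 3
    have "\<not> filled ?F" using \<pi>.H.cyclic_not_filled[OF finF c(1) gen c(3) inj 3] .
    then show False using N.filled_quotient[OF fil] by simp
  qed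
qed

lemma dihedral_quotient_cases:
  fixes G (structure)
  assumes hD: "group_hom G (dihedral_group p) h" and p: "Factorial_Ring.prime (p::nat)" "odd p"
    and fin: "finite (carrier G)" and surj: "h ` carrier G = carrier (dihedral_group p)"
    and card: "card (kernel G (dihedral_group p) h) = 2 ^ m"
    and x: "x \<in> carrier G" "x [^] p = \<one>" "h x \<noteq> \<one>\<^bsub>dihedral_group p\<^esub>"
    and fil: "filled G"
  shows "G \<cong> dihedral_group 3 \<or> G \<cong> dihedral_group 5 \<or> G \<cong> dihedral_group 6 \<or>
    G \<cong> dihedral_group 7 \<or> G \<cong> dihedral_group 11"
proof -
  interpret group G by (rule group_hom.axioms(1)[OF hD])
  interpret h: group_hom G "dihedral_group p" h by (rule hD)
  define N where "N = kernel G (dihedral_group p) h"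
  have N1: "\<one> \<in> N" by (simp add: N_def kernel_def)
  have "\<not> p \<ge> 13" using large_dihedral_prime_not_filled[OF p(1)] h.filled_image[OF surj fil] by blast
  then have cs: "p = 3 \<or> p = 5 \<or> p = 7 \<or> p = 11"
  proof -
    have "p \<noteq> 0" "p \<noteq> 1" using p(1) by auto
    moreover have "p \<noteq> 2" "p \<noteq> 4" "p \<noteq> 6" "p \<noteq> 8" "p \<noteq> 10" "p \<noteq> 12" using p(2) by auto
    moreover have "p \<noteq> 9" using primes_dvd_imp_eq[of 3 p] p(1) by auto
    ultimately show ?thesis using \<open>\<not> p \<ge> 13\<close> by presburger
  qed
  show ?thesis
  proof (cases "N = {\<one>}")
    case True
    then have "inj_on h (carrier G)" using h.inj_iff_trivial_ker by (simp add: N_def)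
    then have "h \<in> iso G (dihedral_group p)" using surj h.homh by (simp add: iso_def bij_betw_def)
    then have "G \<cong> dihedral_group p" by (auto simp: is_iso_def)
    then show ?thesis using cs by auto
  next
    case False
    then obtain z where "z \<in> N" "z \<noteq> \<one>" using N1 by blast
    then have z: "z \<in> carrier G" "z \<noteq> \<one>" "h z = \<one>\<^bsub>dihedral_group p\<^esub>" by (auto simp: N_def kernel_def)
    consider "p = 3" | "p = 5" | "p = 7" | "p = 11" using cs by blast
    then show ?thesis
    proof cases
      case 1
      note h3 = hD[unfolded 1] and surj3 = surj[unfolded 1] and card3 = card[unfolded 1] and x3 = x[unfolded 1]
      obtain s where s: "s \<in> carrier G" "snd (h s)" "s \<otimes> s = \<one>"
        using reflection_involution_exists[OF h3 fin surj3 card3 fil] by blast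
      \<comment> \<open>With the identity as second map the smaller kernel is trivial, and the bound
        becomes \<open>card N < 3\<close>.\<close>
      have "group_hom G G (\<lambda>a. a)"
        by (simp add: group_hom_def group_hom_axioms_def hom_def)
      then have "card (kernel G (dihedral_group 3) h) < 3 * card (kernel G G (\<lambda>a. a))"
        using s by (intro reflection_involution_bound[OF h3 _ fin surj3 _ s(1,2) _ fil]) (auto simp: 1)
      moreover have "kernel G G (\<lambda>a. a) = {\<one>}" by (auto simp: kernel_def)
      ultimately have "card N < 3" by (simp add: N_def 1)
      moreover have "card N \<noteq> 1" using False N1 by (auto simp: card_1_singleton_iff)
      moreover have "card N \<noteq> 0" using card by (simp add: N_def)
      ultimately have "card (kernel G (dihedral_group 3) h) = 2" by (simp add: N_def 1)
      then show ?thesis using dihedral_3_double_extension[OF h3 fin surj3 _ x3 s] by blast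
    next
      case 2
      then show ?thesis using dihedral_5_extension_not_filled[of G h z x] hD fin surj z x fil by simp
    next
      case 3
      then show ?thesis using dihedral_7_extension_not_filled[of G h z] hD fin surj z fil by simp
    next
      case 4
      then show ?thesis using dihedral_11_extension_not_filled[of G h z] hD fin surj z fil by simp
    qed
  qed
qed

theorem theorem4p7:
  fixes G :: "('a, 'b) monoid_scheme" and n p :: nat
  assumes "group G"
    and "n \<ge> 1"
    and "Factorial_Ring.prime p" and "odd p"
    and "order G = 2 ^ n * p"
    and "filled G"
  shows "G \<cong> dihedral_group 3 \<or> G \<cong> dihedral_group 5 \<or> G \<cong> dihedral_group 6 \<or>
    G \<cong> dihedral_group 7 \<or> G \<cong> dihedral_group 11"
proof -
  interpret group G by (rule assms(1))
  note p = assms(3,4)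
  have fin: "finite (carrier G)" using assms order_gt_0_iff_finite by (simp add: prime_gt_0_nat)
  obtain N m x where N: "N \<lhd> G" "card N = 2 ^ m" and x: "x \<in> carrier G" "x [^]\<^bsub>G\<^esub> p = \<one>\<^bsub>G\<^esub>" "x \<notin> N"
    and norm: "\<And>g. g \<in> carrier G \<Longrightarrow> \<exists>i::nat. \<exists>a\<in>N. g \<otimes>\<^bsub>G\<^esub> x \<otimes>\<^bsub>G\<^esub> inv\<^bsub>G\<^esub> g = x [^]\<^bsub>G\<^esub> i \<otimes>\<^bsub>G\<^esub> a"
    and cent: "\<And>g. g \<in> carrier G \<Longrightarrow> \<exists>a\<in>N. g \<otimes>\<^bsub>G\<^esub> x \<otimes>\<^bsub>G\<^esub> inv\<^bsub>G\<^esub> g = x \<otimes>\<^bsub>G\<^esub> a \<Longrightarrow>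
      \<exists>i::nat. \<exists>a\<in>N. g = x [^]\<^bsub>G\<^esub> i \<otimes>\<^bsub>G\<^esub> a"
    using two_power_times_prime_structure[OF assms(5) p] by blast
  interpret N: normal N G by (rule N(1))
  let ?F = "G Mod N"
  let ?\<pi> = "\<lambda>a. N #>\<^bsub>G\<^esub> a"
  interpret \<pi>: group_hom G ?F ?\<pi> by (rule N.quotient_group_hom)
  have surj: "?\<pi> ` carrier G = carrier ?F" by (simp add: carrier_FactGroup)
  have \<pi>N: "?\<pi> a = \<one>\<^bsub>?F\<^esub>" if "a \<in> N" for a using that N.rcoset_eq_self_iff N.subset by auto
  have \<pi>pow: "?\<pi> (x [^]\<^bsub>G\<^esub> (i::nat) \<otimes>\<^bsub>G\<^esub> a) = ?\<pi> x [^]\<^bsub>?F\<^esub> i" if "a \<in> N" for i a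
  proof -
    have "a \<in> carrier G" using that N.subset by blast
    then have "?\<pi> (x [^]\<^bsub>G\<^esub> i \<otimes>\<^bsub>G\<^esub> a) = ?\<pi> (x [^]\<^bsub>G\<^esub> i) \<otimes>\<^bsub>?F\<^esub> ?\<pi> a"
      using x(1) by (intro \<pi>.hom_mult) auto
    then show ?thesis using \<pi>N[OF that] x(1) \<pi>.hom_nat_pow[OF x(1), of i] \<pi>.H.r_one[of "?\<pi> x [^]\<^bsub>?F\<^esub> i"]
      by (metis \<pi>.H.nat_pow_closed \<pi>.hom_closed)
  qed
  have \<pi>conj: "?\<pi> (g \<otimes>\<^bsub>G\<^esub> x \<otimes>\<^bsub>G\<^esub> inv\<^bsub>G\<^esub> g) = ?\<pi> g \<otimes>\<^bsub>?F\<^esub> ?\<pi> x \<otimes>\<^bsub>?F\<^esub> inv\<^bsub>?F\<^esub> (?\<pi> g)"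
    if "g \<in> carrier G" for g
    using that x(1) \<pi>.hom_mult \<pi>.hom_inv by (metis inv_closed m_closed)
  have ordF: "2 ^ n * p = order ?F * 2 ^ m"
    using \<pi>.order_eq_image_kernel[OF surj] assms(5) N(2) N.kernel_quotient by simp
  obtain k where k: "order ?F = 2 ^ k * p"
  proof -
    have "coprime (2 ^ m) p" using p(2) by simp
    moreover have "2 ^ m dvd 2 ^ n * p" using ordF by (metis dvd_triv_right)
    ultimately have "(2::nat) ^ m dvd 2 ^ n" by (simp add: coprime_dvd_mult_left_iff)
    then have "m \<le> n" by (simp add: power_dvd_imp_le)
    then have "(2::nat) ^ n = 2 ^ (n - m) * 2 ^ m" by (simp add: power_add[symmetric])
    then have "order ?F = 2 ^ (n - m) * p" using ordF by simp
    then show thesis by (rule that)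
  qed
  have xF: "?\<pi> x \<in> carrier ?F" "?\<pi> x \<noteq> \<one>\<^bsub>?F\<^esub>" "?\<pi> x [^]\<^bsub>?F\<^esub> p = \<one>\<^bsub>?F\<^esub>"
  proof -
    show "?\<pi> x \<in> carrier ?F" using x(1) by (rule \<pi>.hom_closed)
    show "?\<pi> x \<noteq> \<one>\<^bsub>?F\<^esub>" using x N.rcoset_eq_self_iff by simp
    show "?\<pi> x [^]\<^bsub>?F\<^esub> p = \<one>\<^bsub>?F\<^esub>" using \<pi>pow[OF N.one_closed, of p] x(2) \<pi>N[OF N.one_closed] by simp
  qed
  have "carrier ?F = (\<lambda>i::nat. ?\<pi> x [^]\<^bsub>?F\<^esub> i) ` {..<p} \<or> ?F \<cong> dihedral_group p"
  proof (rule \<pi>.H.self_centralizing_prime_cases[OF k p xF _ _ N.filled_quotient[OF assms(6)]])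
    fix \<gamma> assume "\<gamma> \<in> carrier ?F"
    then obtain g where g: "g \<in> carrier G" "\<gamma> = ?\<pi> g" using surj by blast
    obtain i a where ia: "a \<in> N" "g \<otimes>\<^bsub>G\<^esub> x \<otimes>\<^bsub>G\<^esub> inv\<^bsub>G\<^esub> g = x [^]\<^bsub>G\<^esub> (i::nat) \<otimes>\<^bsub>G\<^esub> a"
      using norm[OF g(1)] by blast
    then show "\<exists>i::nat. \<gamma> \<otimes>\<^bsub>?F\<^esub> ?\<pi> x \<otimes>\<^bsub>?F\<^esub> inv\<^bsub>?F\<^esub> \<gamma> = ?\<pi> x [^]\<^bsub>?F\<^esub> i"
      using \<pi>conj[OF g(1)] \<pi>pow[OF ia(1), of i] g(2) by metis
    assume "\<gamma> \<otimes>\<^bsub>?F\<^esub> ?\<pi> x \<otimes>\<^bsub>?F\<^esub> inv\<^bsub>?F\<^esub> \<gamma> = ?\<pi> x"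
    then have e: "?\<pi> (g \<otimes>\<^bsub>G\<^esub> x \<otimes>\<^bsub>G\<^esub> inv\<^bsub>G\<^esub> g) = ?\<pi> x" using \<pi>conj[OF g(1)] g(2) by metis
    \<comment> \<open>Equality with the image of \<open>x\<close> in the quotient becomes, in
      \<open>G\<close>, a right factor \<open>a'\<close> in \<open>N\<close>, which is the form
      required by \<open>cent\<close>.\<close>
    define a' where "a' = inv\<^bsub>G\<^esub> x \<otimes>\<^bsub>G\<^esub> (g \<otimes>\<^bsub>G\<^esub> x \<otimes>\<^bsub>G\<^esub> inv\<^bsub>G\<^esub> g)"
    have gx: "g \<otimes>\<^bsub>G\<^esub> x \<otimes>\<^bsub>G\<^esub> inv\<^bsub>G\<^esub> g \<in> carrier G" using g(1) x(1) by simp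
    have "?\<pi> a' = inv\<^bsub>?F\<^esub> (?\<pi> x) \<otimes>\<^bsub>?F\<^esub> ?\<pi> x"
      unfolding a'_def using \<pi>.hom_mult[OF inv_closed[OF x(1)] gx] \<pi>.hom_inv[OF x(1)] e by metis
    then have "?\<pi> a' = \<one>\<^bsub>?F\<^esub>" using \<pi>.H.l_inv[OF xF(1)] by metis
    then have "a' \<in> N" using N.rcoset_eq_self_iff[of a'] gx x(1) by (simp add: a'_def)
    moreover have "g \<otimes>\<^bsub>G\<^esub> x \<otimes>\<^bsub>G\<^esub> inv\<^bsub>G\<^esub> g = x \<otimes>\<^bsub>G\<^esub> a'"
      unfolding a'_def using gx x(1) inv_mult_cancel(2)[OF x(1) gx] by metis
    ultimately obtain j b where jb: "b \<in> N" "g = x [^]\<^bsub>G\<^esub> (j::nat) \<otimes>\<^bsub>G\<^esub> b" using cent[OF g(1)] by blast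
    then show "\<exists>i::nat. \<gamma> = ?\<pi> x [^]\<^bsub>?F\<^esub> i" using \<pi>pow[OF jb(1), of j] g(2) by metis
  qed
  \<comment> \<open>The cyclic alternative means that \<open>N\<close> is a normal Sylow 2-subgroup,
    which is nontrivial as n \<ge> 1.\<close>
  moreover have "carrier ?F \<noteq> (\<lambda>i::nat. ?\<pi> x [^]\<^bsub>?F\<^esub> i) ` {..<p}"
    using prime_quotient_not_filled[OF assms(1,5,2) p N x] assms(6) by blast
  ultimately obtain \<phi> where \<phi>: "\<phi> \<in> iso ?F (dihedral_group p)" by (auto simp: is_iso_def)
  define h where "h = (\<lambda>a. \<phi> (?\<pi> a))"
  have p1: "p \<ge> 1" using p(1) prime_ge_1_nat by blast
  interpret D: group "dihedral_group p" by (rule group_dihedral_group[OF p1])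
  have \<phi>h: "group_hom ?F (dihedral_group p) \<phi>"
    using \<phi> \<pi>.H.is_group D.is_group by (simp add: iso_def group_hom_def group_hom_axioms_def)
  interpret \<phi>: group_hom ?F "dihedral_group p" \<phi> by (rule \<phi>h)
  have hD: "group_hom G (dihedral_group p) h"
  proof -
    have "h \<in> hom G (dihedral_group p)"
    proof (rule homI)
      fix a b assume ab: "a \<in> carrier G" "b \<in> carrier G"
      show "h a \<in> carrier (dihedral_group p)"
        unfolding h_def using ab(1) by (intro \<phi>.hom_closed \<pi>.hom_closed)
      show "h (a \<otimes>\<^bsub>G\<^esub> b) = h a \<otimes>\<^bsub>dihedral_group p\<^esub> h b"
        unfolding h_def using \<pi>.hom_mult[OF ab] \<phi>.hom_mult[OF \<pi>.hom_closed[OF ab(1)] \<pi>.hom_closed[OF ab(2)]]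
        by metis
    qed
    then show ?thesis
      using is_group D.is_group by (simp add: group_hom_def group_hom_axioms_def)
  qed
  have bij: "bij_betw \<phi> (carrier ?F) (carrier (dihedral_group p))" using \<phi> by (simp add: iso_def)
  have "h ` carrier G = \<phi> ` (?\<pi> ` carrier G)" unfolding h_def image_image ..
  then have hs: "h ` carrier G = carrier (dihedral_group p)"
    unfolding surj bij_betw_imp_surj_on[OF bij] .
  have \<phi>1: "\<phi> u = \<one>\<^bsub>dihedral_group p\<^esub> \<longleftrightarrow> u = \<one>\<^bsub>?F\<^esub>" if "u \<in> carrier ?F" for u
    using inj_on_eq_iff[OF bij_betw_imp_inj_on[OF bij] that \<pi>.H.one_closed] unfolding \<phi>.hom_one .
  have "kernel G (dihedral_group p) h = kernel G ?F ?\<pi>"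
    unfolding kernel_def h_def using \<phi>1 \<pi>.hom_closed by blast
  then have "card (kernel G (dihedral_group p) h) = 2 ^ m" using N.kernel_quotient N(2) by simp
  moreover have "h x \<noteq> \<one>\<^bsub>dihedral_group p\<^esub>" unfolding h_def using \<phi>1[OF xF(1)] xF(2) by blast
  ultimately show ?thesis
    using dihedral_quotient_cases[OF hD p fin hs _ x(1,2) _ assms(6)] by blast
qed

end
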